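(* Let $M\subset LG(2,4)$ be a hyperbolic 2-generic surface with $\dim(M')=2$. Then the conjugate manifold $M'$ is also hyperbolic. Moreover, $(M')'=M$ if and only if $\tau=0$, if and only if the central tangent spheres to $M$ and $M'$ agree at conjugate points.
   Context: $V=\mathbb{R}^5$ with $\langle z,w\rangle=-z_0w_4-z_4w_0+z_1w_3+z_3w_1-2z_2w_2$ (signature $(2,3)$), and $\mathcal{Q}=\{[z]\in\mathbb{P}V:\langle z,z\rangle=0\}$. $LG(2,4)$ (Lagrangian planes in the standard symplectic $\mathbb{R}^4$) is identified with $\mathcal{Q}$ by the Plücker embedding, $\mathrm{span}\{e_1+re_3+se_4,e_2+se_3+te_4\}\leftrightarrow[1,r,s,t,rt-s^2]$. The invariant conformal Lorentzian structure is represented by $dr\,dt-ds^2$. A surface is hyperbolic if every tangent plane contains exactly two null lines. For $[z]\in\mathbb{P}V$ the sphere $\mathcal{S}_{[z]}$ is $\mathbb{P}(z^\perp)\cap\mathcal{Q}$. A hyperbolic frame is a basis $(v_0,\dots,v_4)$ of $V$ with $\langle v_0,v_4\rangle=-1$, $\langle v_1,v_2\rangle=1$, $\langle v_3,v_3\rangle=-2$, all other products zero. A 1-adapted moving frame on a hyperbolic surface is a smooth field of hyperbolic frames with $[v_0]$ the point of the surface and $$\begin{aligned}dv_0&=(\alpha_{11}+\alpha_{22})v_0+\theta_1v_1+\theta_2v_2,\\ dv_1&=\beta_1v_0+(\alpha_{22}-\alpha_{11})v_1-\alpha_{12}v_3+\theta_2v_4,\\ dv_2&=\beta_2v_0+(\alpha_{11}-\alpha_{22})v_2-\alpha_{21}v_3+\theta_1v_4,\\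 dv_3&=2\beta_3v_0-2\alpha_{21}v_1-2\alpha_{12}v_2,\\ dv_4&=\beta_2v_1+\beta_1v_2-\beta_3v_3-(\alpha_{11}+\alpha_{22})v_4,\end{aligned}$$ $\theta_1\wedge\theta_2\neq0$. Then $\alpha_{12}=\lambda_{11}\theta_1+\lambda_{12}\theta_2$, $\alpha_{21}=\lambda_{12}\theta_1+\lambda_{22}\theta_2$. The central tangent sphere at $[v_0]$ is $\mathcal{S}_{[v_3+2\lambda_{12}v_0]}$ (independent of the 1-adapted frame). The surface is 2-generic if $\lambda_{11}\lambda_{22}\neq0$ and singly-ruled (2-parabolic) if exactly one of them vanishes; $\epsilon=\mathrm{sgn}(\lambda_{11}\lambda_{22})$. The frame is 2-adapted if $\lambda_{12}=0$. On a 2-generic surface a frame is 3-adapted if it is 2-adapted and $\beta_3=0$. On a singly-ruled surface, labelled so that $\lambda_{11}\neq0=\lambda_{22}$, it is 3-adapted if it is 2-adapted, $\beta_3=0$ and $d\lambda_{11}+\lambda_{11}(3\alpha_{11}-\alpha_{22})=0$. Such frames exist locally and the point $[v_4]$, called the conjugate point of $[v_0]$, is independent of the 3-adapted frame; the conjugate manifold $M'$ is the image of $[v_4]:M\to\mathcal{Q}$ and $\dim(M')$ is the rank of this map (assumed constant). When $M'$ is a surface which is again 2-generic or singly-ruled, $(M')'$ is defined; $(M')'=M$ means that the conjugate point of $[v_4]$ with respect to $M'$ is $[v_0]$. On 2-generic $M$ the 3-adapted frame can be normalized so that $\lambda_{11}=1,\lambda_{22}=\epsilon$; then $\beta_1=\tau\theta_1+b_{12}\theta_2$,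 $\beta_2=b_{21}\theta_1+\epsilon\tau\theta_2$ defines $\tau$ (the condition $\tau=0$ is independent of the choice of normalized frame); $\tau=0$ means $\tau$ vanishes identically. *)

theory Defs
  imports "HOL-Analysis.Analysis"
begin

section \<open>Smooth maps between normed spaces\<close>

primrec Ck_on :: "nat \<Rightarrow> ('a::real_normed_vector \<Rightarrow> 'b::real_normed_vector) \<Rightarrow> 'a set \<Rightarrow> bool" where
  "Ck_on 0 f U \<longleftrightarrow> continuous_on U f"
| "Ck_on (Suc k) f U \<longleftrightarrow>
     (\<forall>u\<in>U. f differentiable at u) \<and> (\<forall>h. Ck_on k (\<lambda>u. frechet_derivative f (at u) h) U)"

text \<open>Used only for open \<open>U\<close> in a finite-dimensional space, where the existence and continuity of
  all iterated directional derivatives is the usual notion of a smooth map.\<close>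

definition smooth_on :: "'a::real_normed_vector set \<Rightarrow> ('a \<Rightarrow> 'b::real_normed_vector) \<Rightarrow> bool" where
  "smooth_on U f \<longleftrightarrow> (\<forall>k. Ck_on k f U)"

abbreviation D :: "('a::real_normed_vector \<Rightarrow> 'b::real_normed_vector) \<Rightarrow> 'a \<Rightarrow> 'a \<Rightarrow> 'b" where
  "D f u \<equiv> frechet_derivative f (at u)"


section \<open>The quadric\<close>

text \<open>The index type \<open>5\<close> has the elements 0, 1, 2, 3, 4, so that \<open>z $ i\<close> is the coordinate
  \<open>z\<^sub>i\<close>.\<close>

type_synonym V = "real ^ 5"

definition qform :: "V \<Rightarrow> V \<Rightarrow> real" where
  "qform z w = - (z$0 * w$4) - z$4 * w$0 + z$1 * w$3 + z$3 * w$1 - 2 * (z$2 * w$2)"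

text \<open>A point of the projective space of \<open>V\<close> is a line through the origin, as a set of vectors.\<close>

definition proj_pt :: "V \<Rightarrow> V set" where
  "proj_pt z = span {z}"

definition proj_space :: "V set \<Rightarrow> V set set" where
  "proj_space W = {proj_pt z | z. z \<in> W \<and> z \<noteq> 0}"

definition quadric :: "V set set" where
  "quadric = {proj_pt z | z. z \<noteq> 0 \<and> qform z z = 0}"

definition quadric_sphere :: "V \<Rightarrow> V set set" where
  "quadric_sphere z = proj_space {w. qform z w = 0} \<inter> quadric"


section \<open>Surfaces in the quadric\<close>

text \<open>A surface is a map \<open>imm\<close> from a 2-manifold to the projective space. Surfaces are immersed,
  not embedded: the conjugate manifold is by definition the image of a map of constant rank. A
  chart \<open>(U, \<phi>)\<close> is a parametrization \<open>\<phi>\<close> of an open part of the manifold by the open set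
  \<open>U\<close> of the plane.\<close>

record 'm surface =
  manifold :: "'m topology"
  charts :: "((real^2) set \<times> (real^2 \<Rightarrow> 'm)) set"
  imm :: "'m \<Rightarrow> V set"

definition smooth_2_manifold :: "'m surface \<Rightarrow> bool" where
  "smooth_2_manifold M \<longleftrightarrow>
     Hausdorff_space (manifold M) \<and> second_countable (manifold M) \<and>
     (\<forall>(U, \<phi>) \<in> charts M. open U \<and> openin (manifold M) (\<phi> ` U) \<and>
        homeomorphic_map (top_of_set U) (subtopology (manifold M) (\<phi> ` U)) \<phi>) \<and>
     (\<Union>(U, \<phi>) \<in> charts M. \<phi> ` U) = topspace (manifold M) \<and>
     (\<forall>(U, \<phi>) \<in> charts M. \<forall>(W, \<psi>) \<in> charts M.
        smooth_on {u \<in> U. \<phi> u \<in> \<psi> ` W} (inv_into W \<psi> \<circ> \<phi>))"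

definition patch :: "'m surface \<Rightarrow> (real^2) set \<Rightarrow> (real^2 \<Rightarrow> 'm) \<Rightarrow> bool" where
  "patch M U \<phi> \<longleftrightarrow> open U \<and> (\<exists>U0. (U0, \<phi>) \<in> charts M \<and> U \<subseteq> U0)"

definition local_lift :: "'m surface \<Rightarrow> (real^2) set \<Rightarrow> (real^2 \<Rightarrow> 'm) \<Rightarrow> (real^2 \<Rightarrow> V) \<Rightarrow> bool" where
  "local_lift M U \<phi> z \<longleftrightarrow> patch M U \<phi> \<and> smooth_on U z \<and>
     (\<forall>u\<in>U. z u \<noteq> 0 \<and> imm M (\<phi> u) = proj_pt (z u))"

text \<open>The notions at a point that follow do not depend on the chart, lift or frame used to compute
  them; their definitions ask for some chart, lift or frame around the point.\<close>

text \<open>The tangent space of the projective space at \<open>[z]\<close> is \<open>Hom([z], V/[z])\<close>, so that the map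
  \<open>[z]\<close> has rank \<open>r\<close> if \<open>z\<close> and its derivatives span a space of dimension \<open>r + 1\<close>.\<close>

definition has_rank_at :: "'m surface \<Rightarrow> 'm \<Rightarrow> nat \<Rightarrow> bool" where
  "has_rank_at M p r \<longleftrightarrow> (\<exists>U \<phi> z. \<exists>u\<in>U. local_lift M U \<phi> z \<and> \<phi> u = p \<and>
     dim (span (insert (z u) (range (D z u)))) = r + 1)"

definition surface_in_quadric :: "'m surface \<Rightarrow> bool" where
  "surface_in_quadric M \<longleftrightarrow> smooth_2_manifold M \<and>
     (\<forall>p \<in> topspace (manifold M). imm M p \<in> quadric \<and> has_rank_at M p 2)"

text \<open>The invariant conformal structure is \<open>\<langle>dz, dz\<rangle>\<close> for any lift \<open>z\<close>: replacing \<open>z\<close> by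
  \<open>f z\<close> multiplies it by \<open>f\<^sup>2\<close>, as \<open>\<langle>z, z\<rangle> = \<langle>z, dz\<rangle> = 0\<close>. For the lift
  \<open>(1, r, s, t, r t - s\<^sup>2)\<close> in the coordinates of the Pluecker embedding it is
  \<open>2 (dr dt - ds\<^sup>2)\<close>.\<close>

lemma qform_affine_chart:
  fixes r s t :: "real \<Rightarrow> real" and x r' s' t' :: real
  assumes "(r has_real_derivative r') (at x)" "(s has_real_derivative s') (at x)"
    "(t has_real_derivative t') (at x)"
  defines "z \<equiv> (\<lambda>x. \<chi> i::5. if i = 0 then 1 else if i = 1 then r x else if i = 2 then s x
                    else if i = 3 then t x else r x * t x - (s x)\<^sup>2)"
  shows "\<exists>z'. (z has_vector_derivative z') (at x) \<and> qform (z x) (z x) = 0 \<and>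
           qform z' z' = 2 * (r' * t' - s'\<^sup>2)"
proof -
  define z' :: V where "z' = (\<chi> i. if i = 0 then 0 else if i = 1 then r' else if i = 2 then s'
      else if i = 3 then t' else r' * t x + r x * t' - 2 * s x * s')"
  have "((\<lambda>y. z y $ i) has_vector_derivative z' $ i) (at x)" for i
    using assms(1-3) unfolding z_def z'_def has_real_derivative_iff_has_vector_derivative[symmetric]
    by (auto intro!: derivative_eq_intros)
  then have "(z has_vector_derivative z') (at x)"
    unfolding has_vector_derivative_def has_derivative_componentwise_within[of z]
    by (auto simp: Basis_vec_def inner_axis)
  moreover have "qform (z x) (z x) = 0" "qform z' z' = 2 * (r' * t' - s'\<^sup>2)"
    by (auto simp: qform_def z_def z'_def power2_eq_square)
  ultimately show ?thesis by blast
qed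

text \<open>As \<open>M\<close> is immersed, its tangent plane at \<open>\<phi> u\<close> is identified with the plane of the
  parameters.\<close>

definition null_lines :: "(real^2 \<Rightarrow> V) \<Rightarrow> real^2 \<Rightarrow> (real^2) set set" where
  "null_lines z u = {span {h} | h. h \<noteq> 0 \<and> qform (D z u h) (D z u h) = 0}"

definition hyperbolic_surface :: "'m surface \<Rightarrow> bool" where
  "hyperbolic_surface M \<longleftrightarrow> surface_in_quadric M \<and>
     (\<forall>p \<in> topspace (manifold M). \<exists>U \<phi> z. \<exists>u\<in>U. local_lift M U \<phi> z \<and> \<phi> u = p \<and>
        card (null_lines z u) = 2)"


section \<open>Adapted moving frames\<close>

definition hyperbolic_frame :: "(5 \<Rightarrow> V) \<Rightarrow> bool" where
  "hyperbolic_frame v \<longleftrightarrow> inj v \<and> independent (range v) \<and> span (range v) = UNIV \<and>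
     (\<forall>i j. qform (v i) (v j) =
        (if {i, j} = {0, 4} then -1 else if {i, j} = {1, 2} then 1
         else if i = 3 \<and> j = 3 then -2 else 0))"

text \<open>The 1-forms on a parameter domain are functions of the point and the tangent vector. For
  the forms of a moving frame, linearity and smoothness follow from the structure equations.\<close>

type_synonym oneform = "real^2 \<Rightarrow> real^2 \<Rightarrow> real"

record frame_forms =
  th1 :: oneform  th2 :: oneform
  al11 :: oneform  al12 :: oneform  al21 :: oneform  al22 :: oneform
  be1 :: oneform  be2 :: oneform  be3 :: oneform

definition wedge :: "oneform \<Rightarrow> oneform \<Rightarrow> real^2 \<Rightarrow> real^2 \<Rightarrow> real^2 \<Rightarrow> real" where
  "wedge \<eta> \<xi> u h k = \<eta> u h * \<xi> u k - \<eta> u k * \<xi> u h"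

definition structure_equations :: "(5 \<Rightarrow> real^2 \<Rightarrow> V) \<Rightarrow> frame_forms \<Rightarrow> real^2 \<Rightarrow> real^2 \<Rightarrow> bool" where
  "structure_equations v \<omega> u h \<longleftrightarrow>
     D (v 0) u h = (al11 \<omega> u h + al22 \<omega> u h) *\<^sub>R v 0 u + th1 \<omega> u h *\<^sub>R v 1 u + th2 \<omega> u h *\<^sub>R v 2 u \<and>
     D (v 1) u h = be1 \<omega> u h *\<^sub>R v 0 u + (al22 \<omega> u h - al11 \<omega> u h) *\<^sub>R v 1 u
                   - al12 \<omega> u h *\<^sub>R v 3 u + th2 \<omega> u h *\<^sub>R v 4 u \<and>
     D (v 2) u h = be2 \<omega> u h *\<^sub>R v 0 u + (al11 \<omega> u h - al22 \<omega> u h) *\<^sub>R v 2 u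
                   - al21 \<omega> u h *\<^sub>R v 3 u + th1 \<omega> u h *\<^sub>R v 4 u \<and>
     D (v 3) u h = (2 * be3 \<omega> u h) *\<^sub>R v 0 u - (2 * al21 \<omega> u h) *\<^sub>R v 1 u
                   - (2 * al12 \<omega> u h) *\<^sub>R v 2 u \<and>
     D (v 4) u h = be2 \<omega> u h *\<^sub>R v 1 u + be1 \<omega> u h *\<^sub>R v 2 u - be3 \<omega> u h *\<^sub>R v 3 u
                   - (al11 \<omega> u h + al22 \<omega> u h) *\<^sub>R v 4 u"

definition adapted1 ::
  "'m surface \<Rightarrow> (real^2) set \<Rightarrow> (real^2 \<Rightarrow> 'm) \<Rightarrow> (5 \<Rightarrow> real^2 \<Rightarrow> V) \<Rightarrow> frame_forms \<Rightarrow> bool" where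
  "adapted1 M U \<phi> v \<omega> \<longleftrightarrow> patch M U \<phi> \<and> (\<forall>i. smooth_on U (v i)) \<and>
     (\<forall>u\<in>U. hyperbolic_frame (\<lambda>i. v i u) \<and> imm M (\<phi> u) = proj_pt (v 0 u) \<and>
        (\<forall>h. structure_equations v \<omega> u h) \<and> (\<exists>h k. wedge (th1 \<omega>) (th2 \<omega>) u h k \<noteq> 0))"

record lambda_coeffs =
  lam11 :: "real^2 \<Rightarrow> real"  lam12 :: "real^2 \<Rightarrow> real"  lam22 :: "real^2 \<Rightarrow> real"

text \<open>Every 1-adapted frame has such coefficients, and they are unique.\<close>

definition has_lambda :: "(real^2) set \<Rightarrow> frame_forms \<Rightarrow> lambda_coeffs \<Rightarrow> bool" where
  "has_lambda U \<omega> l \<longleftrightarrow> (\<forall>u\<in>U. \<forall>h.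
     al12 \<omega> u h = lam11 l u * th1 \<omega> u h + lam12 l u * th2 \<omega> u h \<and>
     al21 \<omega> u h = lam12 l u * th1 \<omega> u h + lam22 l u * th2 \<omega> u h)"

definition central_tangent_sphere :: "'m surface \<Rightarrow> 'm \<Rightarrow> V set set" where
  "central_tangent_sphere M p = (THE \<Sigma>. \<exists>U \<phi> v \<omega> l. \<exists>u\<in>U.
     adapted1 M U \<phi> v \<omega> \<and> has_lambda U \<omega> l \<and> \<phi> u = p \<and>
     \<Sigma> = quadric_sphere (v 3 u + (2 * lam12 l u) *\<^sub>R v 0 u))"

definition two_generic :: "'m surface \<Rightarrow> bool" where
  "two_generic M \<longleftrightarrow> hyperbolic_surface M \<and>
     (\<forall>p \<in> topspace (manifold M). \<exists>U \<phi> v \<omega> l. \<exists>u\<in>U.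
        adapted1 M U \<phi> v \<omega> \<and> has_lambda U \<omega> l \<and> \<phi> u = p \<and> lam11 l u * lam22 l u \<noteq> 0)"

definition singly_ruled :: "'m surface \<Rightarrow> bool" where
  "singly_ruled M \<longleftrightarrow> hyperbolic_surface M \<and>
     (\<forall>p \<in> topspace (manifold M). \<exists>U \<phi> v \<omega> l. \<exists>u\<in>U.
        adapted1 M U \<phi> v \<omega> \<and> has_lambda U \<omega> l \<and> \<phi> u = p \<and> (lam11 l u = 0) \<noteq> (lam22 l u = 0))"

text \<open>Interchanging \<open>v\<^sub>1\<close> and \<open>v\<^sub>2\<close> interchanges \<open>\<lambda>\<^sub>1\<^sub>1\<close> and \<open>\<lambda>\<^sub>2\<^sub>2\<close>, so that frames labelled as
  below exist on every singly-ruled surface.\<close>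

definition adapted3 ::
  "'m surface \<Rightarrow> (real^2) set \<Rightarrow> (real^2 \<Rightarrow> 'm) \<Rightarrow> (5 \<Rightarrow> real^2 \<Rightarrow> V) \<Rightarrow> frame_forms \<Rightarrow> lambda_coeffs
     \<Rightarrow> bool" where
  "adapted3 M U \<phi> v \<omega> l \<longleftrightarrow> adapted1 M U \<phi> v \<omega> \<and> has_lambda U \<omega> l \<and>
     (\<forall>u\<in>U. lam12 l u = 0 \<and> (\<forall>h. be3 \<omega> u h = 0)) \<and>
     (two_generic M \<or>
      singly_ruled M \<and>
      (\<forall>u\<in>U. lam11 l u \<noteq> 0 \<and> lam22 l u = 0 \<and>
         (\<forall>h. D (lam11 l) u h + lam11 l u * (3 * al11 \<omega> u h - al22 \<omega> u h) = 0)))"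

definition is_conjugate_point :: "'m surface \<Rightarrow> 'm \<Rightarrow> V set \<Rightarrow> bool" where
  "is_conjugate_point M p q \<longleftrightarrow> (\<exists>U \<phi> v \<omega> l. \<exists>u\<in>U.
     adapted3 M U \<phi> v \<omega> l \<and> \<phi> u = p \<and> q = proj_pt (v 4 u))"

text \<open>The conjugate manifold, parametrized by the given surface.\<close>

definition conjugate_manifold :: "'m surface \<Rightarrow> 'm surface" where
  "conjugate_manifold M = M\<lparr>imm := (\<lambda>p. THE q. is_conjugate_point M p q)\<rparr>"

definition conjugate_dim_eq :: "'m surface \<Rightarrow> nat \<Rightarrow> bool" where
  "conjugate_dim_eq M r \<longleftrightarrow> (\<forall>p \<in> topspace (manifold M). has_rank_at (conjugate_manifold M) p r)"

text \<open>The conjugate of the conjugate manifold exists only if the latter is 2-generic or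
  singly-ruled.\<close>

definition double_conjugate_eq :: "'m surface \<Rightarrow> bool" where
  "double_conjugate_eq M \<longleftrightarrow>
     (two_generic (conjugate_manifold M) \<or> singly_ruled (conjugate_manifold M)) \<and>
     (\<forall>p \<in> topspace (manifold M). is_conjugate_point (conjugate_manifold M) p (imm M p))"

definition central_spheres_agree :: "'m surface \<Rightarrow> bool" where
  "central_spheres_agree M \<longleftrightarrow> (\<forall>p \<in> topspace (manifold M).
     central_tangent_sphere M p = central_tangent_sphere (conjugate_manifold M) p)"

definition normalized3 ::
  "'m surface \<Rightarrow> (real^2) set \<Rightarrow> (real^2 \<Rightarrow> 'm) \<Rightarrow> (5 \<Rightarrow> real^2 \<Rightarrow> V) \<Rightarrow> frame_forms \<Rightarrow> lambda_coeffs
     \<Rightarrow> (real^2 \<Rightarrow> real) \<Rightarrow> bool" where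
  "normalized3 M U \<phi> v \<omega> l \<epsilon> \<longleftrightarrow> two_generic M \<and> adapted3 M U \<phi> v \<omega> l \<and>
     (\<forall>u\<in>U. lam11 l u * lam22 l u \<noteq> 0 \<and> \<epsilon> u = sgn (lam11 l u * lam22 l u) \<and>
        lam11 l u = 1 \<and> lam22 l u = \<epsilon> u)"

definition tau_vanishes :: "'m surface \<Rightarrow> bool" where
  "tau_vanishes M \<longleftrightarrow> (\<forall>p \<in> topspace (manifold M). \<exists>U \<phi> v \<omega> l \<epsilon> \<tau> b12 b21. \<exists>u\<in>U.
     normalized3 M U \<phi> v \<omega> l \<epsilon> \<and> \<phi> u = p \<and>
     (\<forall>u\<in>U. \<forall>h. be1 \<omega> u h = \<tau> u * th1 \<omega> u h + b12 u * th2 \<omega> u h \<and>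
                 be2 \<omega> u h = b21 u * th1 \<omega> u h + \<epsilon> u * \<tau> u * th2 \<omega> u h) \<and>
     \<tau> u = 0)"

end

theory Submission
  imports Defs
begin

text \<open>The vector \<open>v\<^sub>3 + 2 \<lambda>\<^sub>1\<^sub>2 v\<^sub>0\<close> is, up to a factor, the only normal vector of the
  surface whose second fundamental form has no trace with respect to the conformal structure, so that
  the central tangent sphere is well defined. For a 3-adapted frame on a 2-generic surface the
  derivatives of this vector span \<open>v\<^sub>1, v\<^sub>2\<close>, hence \<open>[v\<^sub>4]\<close> is the second null line
  orthogonal to the vector and its derivatives, and the conjugate point is well defined, too.

  If \<open>v\<close> is a normalized 3-adapted frame of \<open>M\<close>, then \<open>(v\<^sub>4, v\<^sub>1, v\<^sub>2, v\<^sub>3, v\<^sub>0)\<close> is a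
  1-adapted frame of \<open>M'\<close> with \<open>\<theta>\<^sub>1' = \<beta>\<^sub>2\<close>, \<open>\<theta>\<^sub>2' = \<beta>\<^sub>1\<close>, \<open>\<alpha>\<^sub>1\<^sub>2' = \<alpha>\<^sub>1\<^sub>2\<close>,
  \<open>\<alpha>\<^sub>2\<^sub>1' = \<alpha>\<^sub>2\<^sub>1\<close> and \<open>\<beta>\<^sub>3' = 0\<close>. Comparing coefficients shows that \<open>\<lambda>\<^sub>1\<^sub>2'\<close> vanishes exactly
  where \<open>\<tau>\<close> does, and the two central spheres \<open>[v\<^sub>3]\<close> and \<open>[v\<^sub>3 + 2 \<lambda>\<^sub>1\<^sub>2' v\<^sub>4]\<close> agree exactly
  where \<open>\<lambda>\<^sub>1\<^sub>2'\<close> vanishes. In that case the frame is 3-adapted for \<open>M'\<close>, with conjugate point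
  \<open>[v\<^sub>0]\<close>. Conversely, if \<open>[v\<^sub>0]\<close> is conjugate to \<open>[v\<^sub>4]\<close>, then the central sphere of
  \<open>M'\<close> is orthogonal to \<open>v\<^sub>0\<close>, \<open>v\<^sub>4\<close> and the tangent plane of \<open>M'\<close>, so it is \<open>[v\<^sub>3]\<close>.\<close>

section \<open>Smooth maps\<close>

lemma D_eqI: "(f has_derivative f') (at u) \<Longrightarrow> D f u = f'"
  by (simp add: frechet_derivative_at[symmetric])

lemma D_works: "f differentiable (at u) \<Longrightarrow> (f has_derivative D f u) (at u)"
  by (simp add: frechet_derivative_works[symmetric])

text \<open>\<open>frechet_derivative\<close> is a choice among the derivatives at the point.
  Functions that agree near the point have the same derivatives there, so the choices coincide, even
  where there is no derivative at all.\<close>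

lemma D_cong_open:
  assumes "open U" "u \<in> U" "\<And>w. w \<in> U \<Longrightarrow> f w = g w"
  shows "D f u = D g u"
proof -
  have "(f has_derivative f') (at u) \<longleftrightarrow> (g has_derivative f') (at u)" for f'
    using assms has_derivative_transform_within_open[of f f' u UNIV U g]
      has_derivative_transform_within_open[of g f' u UNIV U f] by auto
  then show ?thesis by (simp add: frechet_derivative_def)
qed

lemma Ck_on_subset: "Ck_on k f U \<Longrightarrow> W \<subseteq> U \<Longrightarrow> Ck_on k f W"
  by (induction k arbitrary: f) (auto intro: continuous_on_subset)

lemma Ck_on_cong:
  assumes "open U" "\<And>w. w \<in> U \<Longrightarrow> f w = g w" "Ck_on k f U"
  shows "Ck_on k g U"
  using assms(2,3)
proof (induction k arbitrary: f g)
  case 0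
  then show ?case by (metis Ck_on.simps(1) continuous_on_cong)
next
  case (Suc k)
  have "g differentiable at u" if "u \<in> U" for u
    using Suc.prems assms(1) that differentiable_transform_within
    by (metis Ck_on.simps(2) differentiable_def has_derivative_transform_within_open)
  moreover have "Ck_on k (\<lambda>u. D g u h) U" for h
  proof (rule Suc.IH)
    show "D f w h = D g w h" if "w \<in> U" for w
      using D_cong_open[OF assms(1) that, of f g] Suc.prems by auto
  qed (use Suc.prems in auto)
  ultimately show ?case by simp
qed

text \<open>Differentiability gives continuity of \<open>f\<close> itself, and the higher orders
  follow by induction on the directional derivatives. In product rules this supplies the
  undifferentiated factors.\<close>

lemma Ck_on_Suc_D: "Ck_on (Suc k) f U \<Longrightarrow> Ck_on k f U"
proof (induction k arbitrary: f)
  case 0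
  then show ?case
    by (auto intro!: continuous_at_imp_continuous_on differentiable_imp_continuous_within)
next
  case (Suc k)
  then show ?case by (metis Ck_on.simps(2))
qed

lemma smooth_on_subset: "smooth_on U f \<Longrightarrow> W \<subseteq> U \<Longrightarrow> smooth_on W f"
  by (auto simp: smooth_on_def intro: Ck_on_subset)

lemma smooth_on_cong:
  "open U \<Longrightarrow> (\<And>w. w \<in> U \<Longrightarrow> f w = g w) \<Longrightarrow> smooth_on U f \<Longrightarrow> smooth_on U g"
  unfolding smooth_on_def using Ck_on_cong by blast

lemma smooth_on_imp_continuous_on: "smooth_on U f \<Longrightarrow> continuous_on U f"
  unfolding smooth_on_def by (metis Ck_on.simps(1))

lemma smooth_on_imp_differentiable: "smooth_on U f \<Longrightarrow> u \<in> U \<Longrightarrow> f differentiable at u"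
  unfolding smooth_on_def by (metis Ck_on.simps(2))

lemma smooth_on_has_derivative: "smooth_on U f \<Longrightarrow> u \<in> U \<Longrightarrow> (f has_derivative D f u) (at u)"
  by (simp add: D_works smooth_on_imp_differentiable)

lemma smooth_on_D: "smooth_on U f \<Longrightarrow> smooth_on U (\<lambda>u. D f u h)"
  unfolding smooth_on_def by (metis Ck_on.simps(2))

lemma linear_D: "smooth_on U f \<Longrightarrow> u \<in> U \<Longrightarrow> linear (D f u)"
  by (simp add: linear_frechet_derivative smooth_on_imp_differentiable)

section \<open>Closure properties of smooth maps\<close>

lemma Ck_on_const: "Ck_on k (\<lambda>u. c) U"
  by (induction k arbitrary: c) auto

lemma smooth_on_const [intro!]: "smooth_on U (\<lambda>u. c)"
  by (simp add: smooth_on_def Ck_on_const)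

lemma Ck_on_bounded_linear:
  assumes "open U" "bounded_linear L" "Ck_on k f U"
  shows "Ck_on k (\<lambda>u. L (f u)) U"
  using assms(3)
proof (induction k arbitrary: f)
  case 0
  then show ?case using assms(2) by (simp add: bounded_linear.continuous_on)
next
  case (Suc k)
  have d: "((\<lambda>u. L (f u)) has_derivative (\<lambda>h. L (D f u h))) (at u)" if "u \<in> U" for u
    using Suc.prems that by (auto intro!: bounded_linear.has_derivative[OF assms(2)] D_works)
  show ?case unfolding Ck_on.simps
  proof (intro conjI ballI allI)
    fix h show "Ck_on k (\<lambda>u. D (\<lambda>u. L (f u)) u h) U"
      by (rule Ck_on_cong[OF assms(1) _ Suc.IH[of "\<lambda>u. D f u h"]])
        (use Suc.prems in \<open>auto simp: D_eqI[OF d]\<close>)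
  qed (use d differentiable_def in blast)
qed

lemma Ck_on_add:
  assumes "open U" "Ck_on k f U" "Ck_on k g U"
  shows "Ck_on k (\<lambda>u. f u + g u) U"
  using assms(2,3)
proof (induction k arbitrary: f g)
  case 0
  then show ?case by (simp add: continuous_on_add)
next
  case (Suc k)
  have d: "((\<lambda>u. f u + g u) has_derivative (\<lambda>h. D f u h + D g u h)) (at u)" if "u \<in> U" for u
    using Suc.prems that by (auto intro!: has_derivative_add D_works)
  show ?case unfolding Ck_on.simps
  proof (intro conjI ballI allI)
    fix h show "Ck_on k (\<lambda>u. D (\<lambda>u. f u + g u) u h) U"
      by (rule Ck_on_cong[OF assms(1) _ Suc.IH[of "\<lambda>u. D f u h" "\<lambda>u. D g u h"]])
        (use Suc.prems in \<open>auto simp: D_eqI[OF d]\<close>)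
  qed (use d differentiable_def in blast)
qed

text \<open>By the Leibniz rule the derivative is a sum of two terms of the same shape, which is why
  the induction generalizes over both arguments. The instances are products, scalar multiples and
  \<open>qform\<close>.\<close>

lemma Ck_on_bounded_bilinear:
  assumes "open U" "bounded_bilinear B" "Ck_on k f U" "Ck_on k g U"
  shows "Ck_on k (\<lambda>u. B (f u) (g u)) U"
  using assms(3,4)
proof (induction k arbitrary: f g)
  case 0
  then show ?case using assms(2) by (simp add: bounded_bilinear.continuous_on)
next
  case (Suc k)
  have d: "((\<lambda>u. B (f u) (g u)) has_derivative (\<lambda>h. B (f u) (D g u h) + B (D f u h) (g u))) (at u)"
    if "u \<in> U" for u
    using Suc.prems that by (auto intro!: bounded_bilinear.FDERIV[OF assms(2)] D_works)
  show ?case unfolding Ck_on.simps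
  proof (intro conjI ballI allI)
    fix h
    have "Ck_on k (\<lambda>u. B (f u) (D g u h) + B (D f u h) (g u)) U"
      using Suc Ck_on_Suc_D[OF Suc.prems(1)] Ck_on_Suc_D[OF Suc.prems(2)]
      by (intro Ck_on_add[OF assms(1)] Suc.IH) auto
    then show "Ck_on k (\<lambda>u. D (\<lambda>u. B (f u) (g u)) u h) U"
      by (rule Ck_on_cong[OF assms(1), rotated]) (auto simp: D_eqI[OF d])
  qed (use d differentiable_def in blast)
qed

lemma smooth_on_add:
  "open U \<Longrightarrow> smooth_on U f \<Longrightarrow> smooth_on U g \<Longrightarrow> smooth_on U (\<lambda>u. f u + g u)"
  by (simp add: smooth_on_def Ck_on_add)

lemma smooth_on_bounded_linear:
  "bounded_linear L \<Longrightarrow> open U \<Longrightarrow> smooth_on U f \<Longrightarrow> smooth_on U (\<lambda>u. L (f u))"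
  by (simp add: smooth_on_def Ck_on_bounded_linear)

lemma smooth_on_bounded_bilinear:
  "bounded_bilinear B \<Longrightarrow> open U \<Longrightarrow> smooth_on U f \<Longrightarrow> smooth_on U g \<Longrightarrow>
   smooth_on U (\<lambda>u. B (f u) (g u))"
  by (simp add: smooth_on_def Ck_on_bounded_bilinear)

lemmas smooth_on_uminus = smooth_on_bounded_linear[OF bounded_linear_minus[OF bounded_linear_ident]]
lemmas smooth_on_mult = smooth_on_bounded_bilinear[OF bounded_bilinear_mult]
lemmas smooth_on_scaleR = smooth_on_bounded_bilinear[OF bounded_bilinear_scaleR]

lemma smooth_on_diff:
  "open U \<Longrightarrow> smooth_on U f \<Longrightarrow> smooth_on U g \<Longrightarrow> smooth_on U (\<lambda>u. f u - g u)"
  using smooth_on_add[OF _ _ smooth_on_uminus, of U f g] by simp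

text \<open>The derivative of 1/f is a product of Df and two factors 1/f, so the induction
  hypothesis for the same \<open>f\<close> covers it.\<close>

lemma Ck_on_inverse:
  fixes f :: "'a::real_normed_vector \<Rightarrow> real"
  assumes "open U" "\<And>u. u \<in> U \<Longrightarrow> f u \<noteq> 0" "Ck_on k f U"
  shows "Ck_on k (\<lambda>u. inverse (f u)) U"
  using assms(3)
proof (induction k)
  case 0
  then show ?case using assms(2) by (simp add: continuous_on_inverse)
next
  case (Suc k)
  have d: "((\<lambda>u. inverse (f u)) has_derivative
      (\<lambda>h. - (inverse (f u) * D f u h * inverse (f u)))) (at u)" if "u \<in> U" for u
    using Suc.prems that assms(2) by (intro Deriv.has_derivative_inverse D_works) auto
  show ?case unfolding Ck_on.simps
  proof (intro conjI ballI allI)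
    fix h
    have "Ck_on k (\<lambda>u. - (inverse (f u) * D f u h * inverse (f u))) U"
      using Suc Ck_on_Suc_D[OF Suc.prems]
      by (intro Ck_on_bounded_linear[OF assms(1) bounded_linear_minus[OF bounded_linear_ident]]
          Ck_on_bounded_bilinear[OF assms(1) bounded_bilinear_mult]) auto
    then show "Ck_on k (\<lambda>u. D (\<lambda>u. inverse (f u)) u h) U"
      by (rule Ck_on_cong[OF assms(1), rotated]) (auto simp: D_eqI[OF d])
  qed (use d differentiable_def in blast)
qed

lemma smooth_on_inverse:
  fixes f :: "'a::real_normed_vector \<Rightarrow> real"
  shows "open U \<Longrightarrow> (\<And>u. u \<in> U \<Longrightarrow> f u \<noteq> 0) \<Longrightarrow> smooth_on U f \<Longrightarrow> smooth_on U (\<lambda>u. inverse (f u))"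
  by (simp add: smooth_on_def Ck_on_inverse)

lemma smooth_on_divide:
  fixes f g :: "'a::real_normed_vector \<Rightarrow> real"
  shows "open U \<Longrightarrow> smooth_on U f \<Longrightarrow> (\<And>u. u \<in> U \<Longrightarrow> g u \<noteq> 0) \<Longrightarrow> smooth_on U g \<Longrightarrow>
    smooth_on U (\<lambda>u. f u / g u)"
  using smooth_on_mult[OF _ _ smooth_on_inverse, of U f g] by (simp add: divide_inverse)

lemma Ck_on_sqrt:
  fixes f :: "'a::real_normed_vector \<Rightarrow> real"
  assumes "open U" "\<And>u. u \<in> U \<Longrightarrow> f u > 0" "Ck_on k f U"
  shows "Ck_on k (\<lambda>u. sqrt (f u)) U"
  using assms(3)
proof (induction k)
  case 0
  then show ?case by (simp add: continuous_on_real_sqrt)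
next
  case (Suc k)
  have d: "((\<lambda>u. sqrt (f u)) has_derivative (\<lambda>h. D f u h * (inverse (sqrt (f u)) / 2))) (at u)"
    if "u \<in> U" for u
    using Suc.prems that assms(2)[OF that]
      has_derivative_real_sqrt[OF assms(2)[OF that] D_works[of f u]] by auto
  show ?case unfolding Ck_on.simps
  proof (intro conjI ballI allI)
    fix h
    have "Ck_on k (\<lambda>u. D f u h * (inverse (sqrt (f u)) / 2)) U"
      unfolding divide_inverse
      using Suc Ck_on_Suc_D[OF Suc.prems] assms
      by (intro Ck_on_bounded_bilinear[OF assms(1) bounded_bilinear_mult] Ck_on_const Ck_on_inverse)
        (auto simp: less_imp_neq[symmetric])
    then show "Ck_on k (\<lambda>u. D (\<lambda>u. sqrt (f u)) u h) U"
      by (rule Ck_on_cong[OF assms(1), rotated]) (auto simp: D_eqI[OF d])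
  qed (use d differentiable_def in blast)
qed

lemma smooth_on_sqrt:
  fixes f :: "'a::real_normed_vector \<Rightarrow> real"
  shows "open U \<Longrightarrow> (\<And>u. u \<in> U \<Longrightarrow> f u > 0) \<Longrightarrow> smooth_on U f \<Longrightarrow> smooth_on U (\<lambda>u. sqrt (f u))"
  by (simp add: smooth_on_def Ck_on_sqrt)

lemma Ck_on_sum:
  assumes "open U" "finite I" "\<And>i. i \<in> I \<Longrightarrow> Ck_on k (f i) U"
  shows "Ck_on k (\<lambda>u. \<Sum>i\<in>I. f i u) U"
  using assms(2,3) by (induction I) (auto intro!: Ck_on_add[OF assms(1)] simp: Ck_on_const)

lemma Ck_on_compose:
  fixes f :: "'b::euclidean_space \<Rightarrow> 'c::real_normed_vector"
    and \<psi> :: "'a::real_normed_vector \<Rightarrow> 'b"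
  assumes "open W" "open U" "\<psi> ` W \<subseteq> U" "smooth_on W \<psi>" "Ck_on k f U"
  shows "Ck_on k (\<lambda>u. f (\<psi> u)) W"
  using assms(5)
proof (induction k arbitrary: f)
  case 0
  then show ?case
    using assms(3) smooth_on_imp_continuous_on[OF assms(4)]
    by (auto intro!: continuous_on_compose2[of U f])
next
  case (Suc k)
  have d: "((\<lambda>u. f (\<psi> u)) has_derivative (\<lambda>h. D f (\<psi> u) (D \<psi> u h))) (at u)" if "u \<in> W" for u
  proof -
    have "(f has_derivative D f (\<psi> u)) (at (\<psi> u))"
      using Suc.prems that assms(3) by (auto intro!: D_works)
    from diff_chain_at[OF smooth_on_has_derivative[OF assms(4) that] this]
    show ?thesis by (simp add: o_def)
  qed
  \<comment> \<open>In the chain rule the direction \<open>D \<psi> u h\<close> varies with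
    \<open>u\<close>. Expanding it in the basis leaves derivatives of \<open>f\<close> in fixed
    directions, composed with \<psi>, to which the induction hypothesis applies.\<close>
  have e: "D f (\<psi> u) (D \<psi> u h) = (\<Sum>i\<in>Basis. (D \<psi> u h \<bullet> i) *\<^sub>R D f (\<psi> u) i)" if "u \<in> W" for u h
  proof -
    have "linear (D f (\<psi> u))"
      using Suc.prems that assms(3) by (auto intro!: linear_frechet_derivative)
    then have "D f (\<psi> u) (\<Sum>i\<in>Basis. (D \<psi> u h \<bullet> i) *\<^sub>R i) =
        (\<Sum>i\<in>Basis. (D \<psi> u h \<bullet> i) *\<^sub>R D f (\<psi> u) i)"
      by (simp add: linear_sum linear_cmul)
    then show ?thesis by (simp add: euclidean_representation)
  qed
  show ?case unfolding Ck_on.simps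
  proof (intro conjI ballI allI)
    fix h
    have "Ck_on k (\<lambda>u. D \<psi> u h) W"
      using smooth_on_D[OF assms(4), of h] by (simp add: smooth_on_def)
    then have "Ck_on k (\<lambda>u. \<Sum>i\<in>Basis. (D \<psi> u h \<bullet> i) *\<^sub>R D f (\<psi> u) i) W"
      using Suc.prems
      by (intro Ck_on_sum Ck_on_bounded_bilinear[OF assms(1) bounded_bilinear_scaleR]
          Ck_on_bounded_linear[OF assms(1) bounded_linear_inner_left] Suc.IH assms(1)) auto
    then show "Ck_on k (\<lambda>u. D (\<lambda>u. f (\<psi> u)) u h) W"
      by (rule Ck_on_cong[OF assms(1), rotated]) (auto simp: D_eqI[OF d] e)
  qed (use d differentiable_def in blast)
qed

lemma smooth_on_compose:
  fixes f :: "'b::euclidean_space \<Rightarrow> 'c::real_normed_vector"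
  shows "open W \<Longrightarrow> open U \<Longrightarrow> \<psi> ` W \<subseteq> U \<Longrightarrow> smooth_on W \<psi> \<Longrightarrow> smooth_on U f \<Longrightarrow>
    smooth_on W (\<lambda>u. f (\<psi> u))"
  using Ck_on_compose unfolding smooth_on_def by (metis smooth_on_def)

lemma D_compose:
  assumes "smooth_on W \<psi>" "smooth_on U f" "u \<in> W" "\<psi> u \<in> U"
  shows "D (\<lambda>u. f (\<psi> u)) u h = D f (\<psi> u) (D \<psi> u h)"
  using D_eqI[OF diff_chain_at[OF smooth_on_has_derivative[OF assms(1,3)]
      smooth_on_has_derivative[OF assms(2,4)]]]
  by (simp add: o_def)

lemma D_bounded_bilinear:
  assumes "bounded_bilinear B" "f differentiable at u" "g differentiable at u"
  shows "D (\<lambda>u. B (f u) (g u)) u h = B (f u) (D g u h) + B (D f u h) (g u)"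
  by (simp add: D_eqI[OF bounded_bilinear.FDERIV[OF assms(1) D_works[OF assms(2)] D_works[OF assms(3)]]])

lemmas D_scaleR = D_bounded_bilinear[OF bounded_bilinear_scaleR]

lemma D_add:
  "f differentiable at u \<Longrightarrow> g differentiable at u \<Longrightarrow> D (\<lambda>u. f u + g u) u h = D f u h + D g u h"
  by (simp add: D_eqI[OF has_derivative_add[OF D_works D_works]])

section \<open>Symmetry of second derivatives\<close>

text \<open>Schwarz's theorem. It takes the place of the equations d(dv) = 0: applied to
  \<open>v 0\<close> it yields the common coefficient \<open>lam12\<close>, applied to
  \<open>v 3\<close> the coefficient \<tau>.\<close>

lemma D_sym_real:
  fixes f :: "'a::real_normed_vector \<Rightarrow> real"
  assumes U: "open U" "u \<in> U" and f: "smooth_on U f"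
  shows "D (\<lambda>w. D f w h) u k = D (\<lambda>w. D f w k) u h"
proof -
  define A where "A h k w = D (\<lambda>w. D f w h) w k" for h k w
  have contA: "isCont (A h k) u" for h k
    unfolding A_def using smooth_on_imp_continuous_on[OF smooth_on_D[OF smooth_on_D[OF f]]] U
    by (metis continuous_on_eq_continuous_at)
  have line: "((\<lambda>t. g (a + t *\<^sub>R v)) has_real_derivative D g (a + x *\<^sub>R v) v) (at x)"
    if "smooth_on U g" "a + x *\<^sub>R v \<in> U" for g :: "'a \<Rightarrow> real" and a v x
  proof -
    have g: "(g has_derivative D g (a + x *\<^sub>R v)) (at (a + x *\<^sub>R v))"
      using smooth_on_has_derivative[OF that] .
    have l: "((\<lambda>t. a + t *\<^sub>R v) has_derivative (\<lambda>t. t *\<^sub>R v)) (at x)"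
      by (auto intro!: derivative_eq_intros)
    have "D g (a + x *\<^sub>R v) (t *\<^sub>R v) = D g (a + x *\<^sub>R v) v * t" for t
      using linear_cmul[OF linear_D[OF that], of t v] by simp
    with diff_chain_at[OF l g] show ?thesis
      by (simp add: has_field_derivative_def o_def)
  qed
  obtain r where r: "r > 0" "ball u r \<subseteq> U" using U open_contains_ball by blast
  \<comment> \<open>The parallelogram with sides \<open>s *\<^sub>R h\<close> and
    \<open>s *\<^sub>R k\<close> lies in the ball of radius \<open>s * N\<close>; the summand 1
    makes the estimate strict and keeps \<open>N\<close> positive if both vectors vanish.\<close>
  define N where "N = norm h + norm k + 1"
  have N: "N > 0" unfolding N_def by (smt (verit) norm_ge_zero)
  have inU: "u + x *\<^sub>R h + y *\<^sub>R k \<in> ball u (s * N)" if "0 \<le> x" "x \<le> s" "0 \<le> y" "y \<le> s" "s > 0" for x y s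
  proof -
    have "norm (x *\<^sub>R h + y *\<^sub>R k) \<le> x * norm h + y * norm k"
      using that norm_triangle_ineq[of "x *\<^sub>R h" "y *\<^sub>R k"] by simp
    also have "\<dots> \<le> s * norm h + s * norm k"
      using that by (intro add_mono mult_right_mono) auto
    also have "\<dots> < s * N" using that by (simp add: N_def algebra_simps)
    finally show ?thesis
      using norm_minus_cancel[of "x *\<^sub>R h + y *\<^sub>R k"] by (simp add: dist_norm)
  qed
  \<comment> \<open>The second difference is expressed by the mean value theorem, applied in both orders.\<close>
  have mvt: "\<exists>w\<in>ball u (s * N). f (u + s *\<^sub>R h + s *\<^sub>R k) - f (u + s *\<^sub>R h) - f (u + s *\<^sub>R k) + f u = s * s * A h k w"
    if s: "s > 0" "s * N < r" 
      and inU: "\<And>x y. 0 \<le> x \<Longrightarrow> x \<le> s \<Longrightarrow> 0 \<le> y \<Longrightarrow> y \<le> s \<Longrightarrow> u + x *\<^sub>R h + y *\<^sub>R k \<in> ball u (s * N)"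
    for s h k
  proof -
    have sub: "ball u (s * N) \<subseteq> U" using s r by auto
    have inU1: "u + x *\<^sub>R h + y *\<^sub>R k \<in> U" if "0 \<le> x" "x \<le> s" "0 \<le> y" "y \<le> s" for x y
      using inU[OF that] sub by auto
    define q where "q x = f (u + s *\<^sub>R k + x *\<^sub>R h) - f (u + x *\<^sub>R h)" for x
    have dq: "(q has_real_derivative (D f (u + s *\<^sub>R k + x *\<^sub>R h) h - D f (u + x *\<^sub>R h) h)) (at x)"
      if "0 \<le> x" "x \<le> s" for x
      unfolding q_def using inU1[of x s] inU1[of x 0] that s
      by (intro DERIV_diff line[OF f]) (auto simp: algebra_simps)
    from MVT2[OF s(1) dq] obtain x where x: "0 < x" "x < s"
      "q s - q 0 = s * (D f (u + s *\<^sub>R k + x *\<^sub>R h) h - D f (u + x *\<^sub>R h) h)" by auto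
    have dp: "((\<lambda>y. D f (u + x *\<^sub>R h + y *\<^sub>R k) h) has_real_derivative A h k (u + x *\<^sub>R h + y *\<^sub>R k)) (at y)"
      if "0 \<le> y" "y \<le> s" for y
      unfolding A_def using inU1[of x y] that x by (intro line smooth_on_D[OF f]) auto
    from MVT2[OF s(1) dp] obtain y where y: "0 < y" "y < s"
      "D f (u + x *\<^sub>R h + s *\<^sub>R k) h - D f (u + x *\<^sub>R h) h = s * A h k (u + x *\<^sub>R h + y *\<^sub>R k)" by auto
    have "q s - q 0 = s * s * A h k (u + x *\<^sub>R h + y *\<^sub>R k)"
      using x(3) y(3) by (simp add: algebra_simps)
    then show ?thesis using inU[of x y] x y by (intro bexI[of _ "u + x *\<^sub>R h + y *\<^sub>R k"]) (simp_all add: q_def algebra_simps)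
  qed
  have "\<bar>A h k u - A k h u\<bar> \<le> e" if "e > 0" for e
  proof -
    from contA[of h k] that obtain d1 where d1: "d1 > 0" "\<And>w. dist w u < d1 \<Longrightarrow> \<bar>A h k w - A h k u\<bar> < e/2"
      unfolding continuous_at_eps_delta dist_real_def by (metis half_gt_zero)
    from contA[of k h] that obtain d2 where d2: "d2 > 0" "\<And>w. dist w u < d2 \<Longrightarrow> \<bar>A k h w - A k h u\<bar> < e/2"
      unfolding continuous_at_eps_delta dist_real_def by (metis half_gt_zero)
    define m where "m = min r (min d1 d2)"
    define s where "s = m / 2 / N"
    have m: "m > 0" using r d1 d2 by (auto simp: m_def)
    have s: "s > 0" "s * N < m" using m N by (auto simp: s_def field_simps)
    then have sr: "s * N < r" "s * N < d1" "s * N < d2" by (auto simp: m_def)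
    have i1: "u + x *\<^sub>R h + y *\<^sub>R k \<in> ball u (s * N)" if "0 \<le> x" "x \<le> s" "0 \<le> y" "y \<le> s" for x y
      using inU[OF that s(1)] .
    have i2: "u + x *\<^sub>R k + y *\<^sub>R h \<in> ball u (s * N)" if "0 \<le> x" "x \<le> s" "0 \<le> y" "y \<le> s" for x y
      using i1[of y x] that by (simp add: add.assoc add.commute[of "x *\<^sub>R k"])
    obtain w1 where w1: "w1 \<in> ball u (s * N)"
      "f (u + s *\<^sub>R h + s *\<^sub>R k) - f (u + s *\<^sub>R h) - f (u + s *\<^sub>R k) + f u = s * s * A h k w1"
      using mvt[OF s(1) sr(1) i1] by auto
    obtain w2 where w2: "w2 \<in> ball u (s * N)"
      "f (u + s *\<^sub>R k + s *\<^sub>R h) - f (u + s *\<^sub>R k) - f (u + s *\<^sub>R h) + f u = s * s * A k h w2"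
      using mvt[OF s(1) sr(1) i2] by auto
    \<comment> \<open>The two second differences are the same number, so the mixed derivatives
      coincide at points \<open>w1\<close> and \<open>w2\<close> near \<open>u\<close>; continuity
      carries this to \<open>u\<close> up to \<open>e\<close>.\<close>
    have "s * s * A h k w1 = s * s * A k h w2"
      using w1(2) w2(2) by (simp add: algebra_simps)
    then have "A h k w1 = A k h w2" using s by simp
    moreover have "\<bar>A h k w1 - A h k u\<bar> < e/2" "\<bar>A k h w2 - A k h u\<bar> < e/2"
      using d1(2) d2(2) w1(1) w2(1) sr by (auto simp: dist_commute)
    ultimately show ?thesis by linarith
  qed
  then have "\<bar>A h k u - A k h u\<bar> \<le> 0" by (rule field_le_epsilon[of _ 0, simplified])
  then show ?thesis by (simp add: A_def)
qed

lemma D_sym: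
  fixes f :: "'a::real_normed_vector \<Rightarrow> 'b::euclidean_space"
  assumes U: "open U" "u \<in> U" and f: "smooth_on U f"
  shows "D (\<lambda>w. D f w h) u k = D (\<lambda>w. D f w k) u h"
proof (rule euclidean_eqI)
  fix i :: 'b
  have inner: "D (\<lambda>w. g w \<bullet> i) w h = D g w h \<bullet> i" if "smooth_on U g" "w \<in> U" for g :: "'a \<Rightarrow> 'b" and w h
    by (simp add: D_eqI[OF bounded_linear.has_derivative[OF bounded_linear_inner_left
          smooth_on_has_derivative[OF that]]])
  have "D (\<lambda>w. D f w h) u k \<bullet> i = D (\<lambda>w. D (\<lambda>x. f x \<bullet> i) w h) u k" for h k
    using D_cong_open[OF U, of "\<lambda>w. D (\<lambda>x. f x \<bullet> i) w h" "\<lambda>w. D f w h \<bullet> i"]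
    by (simp add: inner f smooth_on_D U)
  then show "D (\<lambda>w. D f w h) u k \<bullet> i = D (\<lambda>w. D f w k) u h \<bullet> i"
    using D_sym_real[OF U smooth_on_bounded_linear[OF bounded_linear_inner_left U(1) f]] by simp
qed

text \<open>Serves the dual fields of a coframe, which vary with the point. Expanding the field in
  the basis reduces the claim to fixed directions.\<close>

lemma smooth_on_D_apply:
  fixes X :: "'a::euclidean_space \<Rightarrow> 'a"
  assumes "open U" "smooth_on U f" "smooth_on U X"
  shows "smooth_on U (\<lambda>u. D f u (X u))"
proof (rule smooth_on_cong[OF assms(1)])
  show "smooth_on U (\<lambda>u. \<Sum>i\<in>Basis. (X u \<bullet> i) *\<^sub>R D f u i)"
    unfolding smooth_on_def
  proof (intro allI Ck_on_sum assms(1) finite_Basis)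
    fix k i show "Ck_on k (\<lambda>u. (X u \<bullet> i) *\<^sub>R D f u i) U"
      using smooth_on_scaleR[OF assms(1) smooth_on_bounded_linear[OF bounded_linear_inner_left assms(1,3)]
          smooth_on_D[OF assms(2)]]
      by (simp add: smooth_on_def)
  qed
next
  fix w assume "w \<in> U"
  then have "D f w (\<Sum>i\<in>Basis. (X w \<bullet> i) *\<^sub>R i) = (\<Sum>i\<in>Basis. (X w \<bullet> i) *\<^sub>R D f w i)"
    using linear_D[OF assms(2)] by (simp add: linear_sum linear_cmul)
  then show "(\<Sum>i\<in>Basis. (X w \<bullet> i) *\<^sub>R D f w i) = D f w (X w)"
    by (simp add: euclidean_representation)
qed

section \<open>Hyperbolic frames\<close>

lemma UNIV_5: "(UNIV :: 5 set) = {0, 1, 2, 3, 4}"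
  by (rule sym, rule card_subset_eq) auto

lemma forall_5: "(\<forall>i::5. P i) \<longleftrightarrow> P 0 \<and> P 1 \<and> P 2 \<and> P 3 \<and> P 4"
proof -
  have "(\<forall>i::5. P i) \<longleftrightarrow> (\<forall>i\<in>UNIV. P i)" by simp
  then show ?thesis unfolding UNIV_5 by simp
qed

lemma sum_5: "sum f (UNIV :: 5 set) = f 0 + f 1 + f 2 + f 3 + f 4"
  unfolding UNIV_5 by (simp add: add.assoc)

lemma bounded_bilinear_qform: "bounded_bilinear qform"
  unfolding bilinear_conv_bounded_bilinear[symmetric] bilinear_def
  by (auto intro!: linearI simp: qform_def algebra_simps)

lemma qform_commute: "qform x y = qform y x"
  by (simp add: qform_def)

lemmas qform_bilinear =
  bounded_bilinear.add_left[OF bounded_bilinear_qform]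
  bounded_bilinear.add_right[OF bounded_bilinear_qform]
  bounded_bilinear.diff_left[OF bounded_bilinear_qform]
  bounded_bilinear.diff_right[OF bounded_bilinear_qform]
  bounded_bilinear.minus_left[OF bounded_bilinear_qform]
  bounded_bilinear.minus_right[OF bounded_bilinear_qform]
  bounded_bilinear.scaleR_left[OF bounded_bilinear_qform, simplified]
  bounded_bilinear.scaleR_right[OF bounded_bilinear_qform, simplified]
  bounded_bilinear.zero_left[OF bounded_bilinear_qform]
  bounded_bilinear.zero_right[OF bounded_bilinear_qform]

lemmas D_qform = D_bounded_bilinear[OF bounded_bilinear_qform]
lemmas smooth_on_qform = smooth_on_bounded_bilinear[OF bounded_bilinear_qform]

lemma qform_nondegenerate:
  assumes "\<And>y. qform x y = 0"
  shows "x = 0"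
proof -
  have "x $ 0 = 0" "x $ 1 = 0" "x $ 2 = 0" "x $ 3 = 0" "x $ 4 = 0"
    using assms[of "axis 4 1"] assms[of "axis 3 1"] assms[of "axis 2 1"] assms[of "axis 1 1"]
      assms[of "axis 0 1"] by (auto simp: qform_def axis_def)
  then show ?thesis by (simp add: vec_eq_iff forall_5)
qed

lemma linear_qform_left: "linear (\<lambda>x. qform x y)"
  by (intro linearI) (auto simp: qform_bilinear)

lemma hyperbolic_frame_products:
  assumes "hyperbolic_frame v"
  shows "qform (v 0) (v 0) = 0" "qform (v 0) (v 1) = 0" "qform (v 0) (v 2) = 0" "qform (v 0) (v 3) = 0"
    "qform (v 0) (v 4) = -1" "qform (v 1) (v 0) = 0" "qform (v 1) (v 1) = 0" "qform (v 1) (v 2) = 1"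
    "qform (v 1) (v 3) = 0" "qform (v 1) (v 4) = 0" "qform (v 2) (v 0) = 0" "qform (v 2) (v 1) = 1"
    "qform (v 2) (v 2) = 0" "qform (v 2) (v 3) = 0" "qform (v 2) (v 4) = 0" "qform (v 3) (v 0) = 0"
    "qform (v 3) (v 1) = 0" "qform (v 3) (v 2) = 0" "qform (v 3) (v 3) = -2" "qform (v 3) (v 4) = 0"
    "qform (v 4) (v 0) = -1" "qform (v 4) (v 1) = 0" "qform (v 4) (v 2) = 0" "qform (v 4) (v 3) = 0"
    "qform (v 4) (v 4) = 0"
  using assms by (simp_all add: hyperbolic_frame_def doubleton_eq_iff)

text \<open>The difference is orthogonal to a spanning set, hence zero as the form is nondegenerate.
  Products with a frame thus serve as coordinates, and vector identities are checked by
  pairing.\<close>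

lemma frame_ext:
  assumes "hyperbolic_frame v"
    and "qform x (v 0) = qform y (v 0)" "qform x (v 1) = qform y (v 1)" "qform x (v 2) = qform y (v 2)"
      "qform x (v 3) = qform y (v 3)" "qform x (v 4) = qform y (v 4)"
  shows "x = y"
proof -
  have "qform (x - y) w = 0" for w
  proof -
    have "w \<in> span (range v)" using assms(1) by (simp add: hyperbolic_frame_def)
    then show ?thesis
    proof (induction rule: span_induct_alt)
      case (step c b z)
      then obtain i where "b = v i" by auto
      moreover have "\<forall>i. qform x (v i) = qform y (v i)" using assms by (simp add: forall_5)
      ultimately show ?case using step by (simp add: qform_bilinear)
    qed (simp add: qform_bilinear)
  qed
  then have "x - y = 0" by (rule qform_nondegenerate)
  then show ?thesis by simp
qed

text \<open>The Gram matrix is invertible: pairing a vanishing combination with the frame reads off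
  each coefficient up to a nonzero factor. Five independent vectors then span
  \<open>V\<close>.\<close>

lemma hyperbolic_frameI:
  assumes "qform (v 0) (v 0) = 0" "qform (v 0) (v 1) = 0" "qform (v 0) (v 2) = 0" "qform (v 0) (v 3) = 0"
    "qform (v 0) (v 4) = -1" "qform (v 1) (v 1) = 0" "qform (v 1) (v 2) = 1"
    "qform (v 1) (v 3) = 0" "qform (v 1) (v 4) = 0"
    "qform (v 2) (v 2) = 0" "qform (v 2) (v 3) = 0" "qform (v 2) (v 4) = 0"
    "qform (v 3) (v 3) = -2" "qform (v 3) (v 4) = 0" "qform (v 4) (v 4) = 0"
  shows "hyperbolic_frame v"
proof -
  have sym: "qform (v 1) (v 0) = 0" "qform (v 2) (v 0) = 0" "qform (v 2) (v 1) = 1" "qform (v 3) (v 0) = 0"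
    "qform (v 3) (v 1) = 0" "qform (v 3) (v 2) = 0" "qform (v 4) (v 0) = -1" "qform (v 4) (v 1) = 0"
    "qform (v 4) (v 2) = 0" "qform (v 4) (v 3) = 0"
    using assms by (simp_all add: qform_commute)
  have gram: "\<forall>i j. qform (v i) (v j) =
        (if {i, j} = {0, 4} then -1 else if {i, j} = {1, 2} then 1
         else if i = 3 \<and> j = 3 then -2 else 0)"
    by (simp add: forall_5 doubleton_eq_iff assms sym)
  have inj: "inj v"
  proof (rule injI)
    fix i j assume "v i = v j"
    then have "\<forall>k. qform (v i) (v k) = qform (v j) (v k)" by simp
    \<comment> \<open>The rows of the Gram matrix are pairwise different; the two facts about
      \<open>UNIV_5\<close> enumerate the values of \<open>i\<close> and \<open>j\<close>.\<close>
    then show "i = j" using spec[OF UNIV_5[THEN equalityD1, unfolded subset_iff], of i]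
        spec[OF UNIV_5[THEN equalityD1, unfolded subset_iff], of j]
      by (auto simp: forall_5 assms sym)
  qed
  have indep: "independent (range v)"
  proof (rule independent_if_scalars_zero)
    fix f x assume s: "(\<Sum>x\<in>range v. f x *\<^sub>R x) = 0" and x: "x \<in> range v"
    have "(\<Sum>x\<in>range v. f x *\<^sub>R x) = (\<Sum>i\<in>UNIV. f (v i) *\<^sub>R v i)"
      by (subst sum.reindex[OF inj]) simp
    also have "\<dots> = f (v 0) *\<^sub>R v 0 + f (v 1) *\<^sub>R v 1 + f (v 2) *\<^sub>R v 2 + f (v 3) *\<^sub>R v 3 + f (v 4) *\<^sub>R v 4"
      by (rule sum_5)
    finally have "qform (f (v 0) *\<^sub>R v 0 + f (v 1) *\<^sub>R v 1 + f (v 2) *\<^sub>R v 2 + f (v 3) *\<^sub>R v 3 + f (v 4) *\<^sub>R v 4) (v j) = 0" for j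
      using s by (simp add: qform_bilinear)
    from this[of 0] this[of 1] this[of 2] this[of 3] this[of 4]
    have "\<forall>i. f (v i) = 0" by (simp add: forall_5 qform_bilinear assms sym)
    then show "f x = 0" using x by auto
  qed simp
  have "span (range v) = UNIV"
    using card_eq_dim[of "range v" UNIV] indep card_image[OF inj]
    by (auto simp: dim_UNIV)
  then show ?thesis using inj indep gram by (simp add: hyperbolic_frame_def)
qed

lemma R2_expand: "x = (x $ 1) *\<^sub>R axis 1 1 + (x $ 2) *\<^sub>R (axis 2 1 :: real^2)"
  by (simp add: vec_eq_iff forall_2 axis_def)

text \<open>Cramer's rule with the determinant \<open>W\<close> as denominator, which keeps the dual
  fields smooth. For the coframe \<open>th1\<close>, \<open>th2\<close> of a moving frame the fields
  span the two null directions.\<close>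

lemma dual_coframe:
  fixes f g :: oneform
  assumes U: "open U" and sm: "\<And>h. smooth_on U (\<lambda>u. f u h)" "\<And>h. smooth_on U (\<lambda>u. g u h)"
    and lin: "\<And>u. u \<in> U \<Longrightarrow> linear (f u)" "\<And>u. u \<in> U \<Longrightarrow> linear (g u)"
    and w: "\<And>u. u \<in> U \<Longrightarrow> \<exists>h k. wedge f g u h k \<noteq> 0"
  obtains X Y where "smooth_on U X" "smooth_on U Y"
    "\<And>u. u \<in> U \<Longrightarrow> f u (X u) = 1" "\<And>u. u \<in> U \<Longrightarrow> g u (X u) = 0"
    "\<And>u. u \<in> U \<Longrightarrow> f u (Y u) = 0" "\<And>u. u \<in> U \<Longrightarrow> g u (Y u) = 1"
    "\<And>u x. u \<in> U \<Longrightarrow> x = f u x *\<^sub>R X u + g u x *\<^sub>R Y u"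
proof -
  define a b where "a = (axis 1 1 :: real^2)" and "b = (axis 2 1 :: real^2)"
  define W where "W u = f u a * g u b - f u b * g u a" for u
  define X where "X u = (g u b / W u) *\<^sub>R a - (g u a / W u) *\<^sub>R b" for u
  define Y where "Y u = (f u a / W u) *\<^sub>R b - (f u b / W u) *\<^sub>R a" for u
  have ex: "f u x = x $ 1 * f u a + x $ 2 * f u b" "g u x = x $ 1 * g u a + x $ 2 * g u b"
    if "u \<in> U" for u x
    using arg_cong[OF R2_expand, of "f u" x] arg_cong[OF R2_expand, of "g u" x] lin[OF that]
    by (simp_all add: linear_add linear_scale flip: a_def b_def)
  have W: "W u \<noteq> 0" if u: "u \<in> U" for u
  proof
    assume "W u = 0"
    obtain h k where "wedge f g u h k \<noteq> 0" using w[OF u] by blast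
    \<comment> \<open>The wedge is the determinant of \<open>h\<close> and \<open>k\<close> times
      \<open>W\<close>, so one nonzero value of it makes \<open>W\<close> nonzero.\<close>
    moreover have "wedge f g u h k = (h $ 1 * k $ 2 - h $ 2 * k $ 1) * W u"
      unfolding wedge_def W_def ex[OF u, of h] ex[OF u, of k] by (simp add: algebra_simps)
    ultimately show False using \<open>W u = 0\<close> by simp
  qed
  have smW: "smooth_on U W"
    unfolding W_def by (intro smooth_on_diff smooth_on_mult U sm)
  have sc: "smooth_on U (\<lambda>u. (p u / W u) *\<^sub>R c)" if "smooth_on U p" for p and c :: "real^2"
    using that W by (intro smooth_on_scaleR smooth_on_divide U smW smooth_on_const)
  show thesis
  proof
    show "smooth_on U X" "smooth_on U Y"
      unfolding X_def Y_def by (intro smooth_on_diff sc sm U)+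
    fix u assume u: "u \<in> U"
    have X: "f u (X u) = (g u b * f u a - g u a * f u b) / W u" "g u (X u) = 0"
      "f u (Y u) = 0" "g u (Y u) = (f u a * g u b - f u b * g u a) / W u"
      unfolding X_def Y_def using lin[OF u]
      by (simp_all add: linear_diff linear_scale diff_divide_distrib mult.commute)
    then show "f u (X u) = 1" "g u (X u) = 0" "f u (Y u) = 0" "g u (Y u) = 1"
      using W[OF u] by (simp_all add: W_def mult.commute)
    fix x
    have "f u x *\<^sub>R X u + g u x *\<^sub>R Y u =
        ((f u x * g u b - g u x * f u b) / W u) *\<^sub>R a + ((g u x * f u a - f u x * g u a) / W u) *\<^sub>R b"
      by (simp add: X_def Y_def algebra_simps diff_divide_distrib)
    also have "f u x * g u b - g u x * f u b = x $ 1 * W u"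
      unfolding ex[OF u, of x] by (simp add: W_def algebra_simps)
    also have "g u x * f u a - f u x * g u a = x $ 2 * W u"
      unfolding ex[OF u, of x] by (simp add: W_def algebra_simps)
    finally show "x = f u x *\<^sub>R X u + g u x *\<^sub>R Y u"
      using W[OF u] R2_expand[of x] by (simp add: a_def b_def)
  qed
qed

section \<open>Moving frames\<close>

text \<open>The structure equations solved for the forms: the coefficients at \<open>v 0\<close>,
  \<open>v 1\<close>, \<open>v 2\<close>, \<open>v 3\<close>, \<open>v 4\<close> are the products
  with \<open>v 4\<close>, \<open>v 2\<close>, \<open>v 1\<close>, \<open>v 3\<close>,
  \<open>v 0\<close>, divided by -1, 1, 1, -2, -1.\<close>

definition structure_forms :: "(5 \<Rightarrow> real^2 \<Rightarrow> V) \<Rightarrow> frame_forms" where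
  "structure_forms v = \<lparr>
     th1 = \<lambda>u h. qform (D (v 0) u h) (v 2 u),
     th2 = \<lambda>u h. qform (D (v 0) u h) (v 1 u),
     al11 = \<lambda>u h. - (qform (D (v 0) u h) (v 4 u) + qform (D (v 1) u h) (v 2 u)) / 2,
     al12 = \<lambda>u h. qform (D (v 1) u h) (v 3 u) / 2,
     al21 = \<lambda>u h. qform (D (v 2) u h) (v 3 u) / 2,
     al22 = \<lambda>u h. (qform (D (v 1) u h) (v 2 u) - qform (D (v 0) u h) (v 4 u)) / 2,
     be1 = \<lambda>u h. - qform (D (v 1) u h) (v 4 u),
     be2 = \<lambda>u h. - qform (D (v 2) u h) (v 4 u),
     be3 = \<lambda>u h. - qform (D (v 3) u h) (v 4 u) / 2\<rparr>"

text \<open>A 1-adapted frame, detached from the surface and from its forms. The constant Gram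
  matrix already yields the structure equations except for one condition, that the derivative of
  \<open>v 0\<close> has no component along \<open>v 3\<close>.\<close>

definition moving_frame :: "(real^2) set \<Rightarrow> (5 \<Rightarrow> real^2 \<Rightarrow> V) \<Rightarrow> bool" where
  "moving_frame U v \<longleftrightarrow> open U \<and> (\<forall>i. smooth_on U (v i)) \<and> (\<forall>u\<in>U. hyperbolic_frame (\<lambda>i. v i u)
     \<and> (\<forall>h. qform (D (v 0) u h) (v 3 u) = 0)
     \<and> (\<exists>h k. wedge (th1 (structure_forms v)) (th2 (structure_forms v)) u h k \<noteq> 0))"

lemma moving_frame_products:
  assumes "moving_frame U v" "u \<in> U"
  shows "qform (v 0 u) (v 0 u) = 0" "qform (v 0 u) (v 1 u) = 0" "qform (v 0 u) (v 2 u) = 0" "qform (v 0 u) (v 3 u) = 0"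
    "qform (v 0 u) (v 4 u) = -1" "qform (v 1 u) (v 0 u) = 0" "qform (v 1 u) (v 1 u) = 0" "qform (v 1 u) (v 2 u) = 1"
    "qform (v 1 u) (v 3 u) = 0" "qform (v 1 u) (v 4 u) = 0" "qform (v 2 u) (v 0 u) = 0" "qform (v 2 u) (v 1 u) = 1"
    "qform (v 2 u) (v 2 u) = 0" "qform (v 2 u) (v 3 u) = 0" "qform (v 2 u) (v 4 u) = 0" "qform (v 3 u) (v 0 u) = 0"
    "qform (v 3 u) (v 1 u) = 0" "qform (v 3 u) (v 2 u) = 0" "qform (v 3 u) (v 3 u) = -2" "qform (v 3 u) (v 4 u) = 0"
    "qform (v 4 u) (v 0 u) = -1" "qform (v 4 u) (v 1 u) = 0" "qform (v 4 u) (v 2 u) = 0" "qform (v 4 u) (v 3 u) = 0"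
    "qform (v 4 u) (v 4 u) = 0"
  using hyperbolic_frame_products[of "\<lambda>i. v i u"] assms by (auto simp: moving_frame_def)

lemma D_qform_const:
  assumes U: "open U" "u \<in> U" and sm: "smooth_on U f" "smooth_on U g"
    and c: "\<And>w. w \<in> U \<Longrightarrow> qform (f w) (g w) = c"
  shows "qform (D f u h) (g u) = - qform (f u) (D g u h)"
proof -
  have "D (\<lambda>w. qform (f w) (g w)) u h = D (\<lambda>w. c) u h"
    using D_cong_open[OF U, of "\<lambda>w. qform (f w) (g w)" "\<lambda>w. c"] c by simp
  then show ?thesis
    using D_qform[of f u g h] sm U by (simp add: smooth_on_imp_differentiable)
qed

lemma moving_frame_compat:
  assumes "moving_frame U v" "u \<in> U"
  shows "qform (D (v i) u h) (v j u) = - qform (v i u) (D (v j) u h)"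
proof (rule D_qform_const[where U = U])
  show "qform (v i w) (v j w) = (if {i, j} = {0, 4} then -1 else if {i, j} = {1, 2} then 1
         else if i = 3 \<and> j = 3 then -2 else 0)" if "w \<in> U" for w
    using assms(1) that unfolding moving_frame_def hyperbolic_frame_def by blast
qed (use assms in \<open>auto simp: moving_frame_def\<close>)

text \<open>Differentiating the constant products makes the matrix of the <dv_i, v_j> skew, with ten
  entries above the diagonal. One of them, <dv_0, v_3>, vanishes, and the other nine are given by
  the nine structure forms.\<close>

lemma moving_frame_structure_equations:
  assumes "moving_frame U v" "u \<in> U"
  shows "structure_equations v (structure_forms v) u h"
proof -
  have fr: "hyperbolic_frame (\<lambda>i. v i u)" and t: "qform (D (v 0) u h) (v 3 u) = 0"
    using assms by (auto simp: moving_frame_def)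
  have c: "qform (D (v i) u h) (v j u) = - qform (D (v j) u h) (v i u)" for i j
    using moving_frame_compat[OF assms, of i h j] qform_commute[of "v i u" "D (v j) u h"] by simp
  have d: "qform (D (v i) u h) (v i u) = 0" for i using c[of i i] by simp
  have al: "al11 (structure_forms v) u h + al22 (structure_forms v) u h = - qform (D (v 0) u h) (v 4 u)"
      "al22 (structure_forms v) u h - al11 (structure_forms v) u h = qform (D (v 1) u h) (v 2 u)"
      "al11 (structure_forms v) u h - al22 (structure_forms v) u h = - qform (D (v 1) u h) (v 2 u)"
    by (simp_all add: structure_forms_def field_simps)
  note forms = structure_forms_def[of v, THEN arg_cong[where f = th1]]
    structure_forms_def[of v, THEN arg_cong[where f = th2]]
    structure_forms_def[of v, THEN arg_cong[where f = al12]]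
    structure_forms_def[of v, THEN arg_cong[where f = al21]]
    structure_forms_def[of v, THEN arg_cong[where f = be1]]
    structure_forms_def[of v, THEN arg_cong[where f = be2]]
    structure_forms_def[of v, THEN arg_cong[where f = be3]]
  show ?thesis
    unfolding structure_equations_def al forms frame_forms.simps
    by (intro conjI; rule frame_ext[OF fr])
      (simp_all add: qform_bilinear moving_frame_products[OF assms] t d c[of 1 0] c[of 2 0] c[of 2 1]
        c[of 3 0] c[of 3 1] c[of 3 2] c[of 4 0] c[of 4 1] c[of 4 2] c[of 4 3])
qed

lemma structure_equations_forms:
  assumes fr: "hyperbolic_frame (\<lambda>i. v i u)" and s: "structure_equations v \<omega> u h"
  shows "th1 \<omega> u h = th1 (structure_forms v) u h" "th2 \<omega> u h = th2 (structure_forms v) u h"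
    "al11 \<omega> u h = al11 (structure_forms v) u h" "al12 \<omega> u h = al12 (structure_forms v) u h"
    "al21 \<omega> u h = al21 (structure_forms v) u h" "al22 \<omega> u h = al22 (structure_forms v) u h"
    "be1 \<omega> u h = be1 (structure_forms v) u h" "be2 \<omega> u h = be2 (structure_forms v) u h"
    "be3 \<omega> u h = be3 (structure_forms v) u h" "qform (D (v 0) u h) (v 3 u) = 0"
proof -
  note p = hyperbolic_frame_products[OF fr]
  show "th1 \<omega> u h = th1 (structure_forms v) u h" "th2 \<omega> u h = th2 (structure_forms v) u h"
    "al11 \<omega> u h = al11 (structure_forms v) u h" "al12 \<omega> u h = al12 (structure_forms v) u h"
    "al21 \<omega> u h = al21 (structure_forms v) u h" "al22 \<omega> u h = al22 (structure_forms v) u h"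
    "be1 \<omega> u h = be1 (structure_forms v) u h" "be2 \<omega> u h = be2 (structure_forms v) u h"
    "be3 \<omega> u h = be3 (structure_forms v) u h" "qform (D (v 0) u h) (v 3 u) = 0"
    using s unfolding structure_equations_def by (auto simp: structure_forms_def qform_bilinear p)
qed

lemma structure_equations_wedge:
  assumes "hyperbolic_frame (\<lambda>i. v i u)" "\<And>h. structure_equations v \<omega> u h"
  shows "wedge (th1 \<omega>) (th2 \<omega>) u = wedge (th1 (structure_forms v)) (th2 (structure_forms v)) u"
  using structure_equations_forms(1,2)[OF assms] by (simp add: wedge_def fun_eq_iff)

text \<open>The equations determine the forms from the frame, so nondegeneracy of the coframe can be
  stated with \<open>structure_forms v\<close>, and \<open>moving_frame\<close> carries all
  conditions on the frame itself.\<close>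

lemma adapted1_iff:
  "adapted1 M U \<phi> v \<omega> \<longleftrightarrow> patch M U \<phi> \<and> moving_frame U v \<and> (\<forall>u\<in>U. imm M (\<phi> u) = proj_pt (v 0 u)) \<and>
     (\<forall>u\<in>U. \<forall>h. structure_equations v \<omega> u h)" (is "?L \<longleftrightarrow> ?R")
proof
  assume ?L
  then have eq: "hyperbolic_frame (\<lambda>i. v i u)" "\<And>h. structure_equations v \<omega> u h"
      "\<exists>h k. wedge (th1 \<omega>) (th2 \<omega>) u h k \<noteq> 0" if "u \<in> U" for u
    using that unfolding adapted1_def by blast+
  have "moving_frame U v"
    unfolding moving_frame_def
  proof (intro conjI ballI)
    fix u assume "u \<in> U"
    note eq = eq[OF this]
    show "\<exists>h k. wedge (th1 (structure_forms v)) (th2 (structure_forms v)) u h k \<noteq> 0"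
      using eq(3) structure_equations_wedge[OF eq(1,2)] by simp
    show "\<forall>h. qform (D (v 0) u h) (v 3 u) = 0"
      using structure_equations_forms(10)[OF eq(1,2)] by blast
  qed (use \<open>?L\<close> in \<open>auto simp: adapted1_def patch_def\<close>)
  then show ?R using \<open>?L\<close> unfolding adapted1_def by blast
next
  assume ?R
  then have eq: "hyperbolic_frame (\<lambda>i. v i u)" "\<And>h. structure_equations v \<omega> u h"
      "\<exists>h k. wedge (th1 (structure_forms v)) (th2 (structure_forms v)) u h k \<noteq> 0" if "u \<in> U" for u
    using that unfolding moving_frame_def by blast+
  show ?L
    unfolding adapted1_def
  proof (intro conjI ballI)
    fix u assume "u \<in> U"
    note eq = eq[OF this]
    show "\<exists>h k. wedge (th1 \<omega>) (th2 \<omega>) u h k \<noteq> 0"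
      using eq(3) structure_equations_wedge[OF eq(1,2)] by simp
  qed (use \<open>?R\<close> in \<open>auto simp: moving_frame_def\<close>)
qed

lemma adapted1_structure_forms:
  assumes "adapted1 M U \<phi> v \<omega>" "u \<in> U"
  shows "th1 \<omega> u h = th1 (structure_forms v) u h" "th2 \<omega> u h = th2 (structure_forms v) u h"
    "al11 \<omega> u h = al11 (structure_forms v) u h" "al12 \<omega> u h = al12 (structure_forms v) u h"
    "al21 \<omega> u h = al21 (structure_forms v) u h" "al22 \<omega> u h = al22 (structure_forms v) u h"
    "be1 \<omega> u h = be1 (structure_forms v) u h" "be2 \<omega> u h = be2 (structure_forms v) u h"
    "be3 \<omega> u h = be3 (structure_forms v) u h"
proof -
  have "hyperbolic_frame (\<lambda>i. v i u)" "structure_equations v \<omega> u h"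
    using assms unfolding adapted1_def by blast+
  note f = structure_equations_forms[OF this]
  show "th1 \<omega> u h = th1 (structure_forms v) u h" "th2 \<omega> u h = th2 (structure_forms v) u h"
    "al11 \<omega> u h = al11 (structure_forms v) u h" "al12 \<omega> u h = al12 (structure_forms v) u h"
    "al21 \<omega> u h = al21 (structure_forms v) u h" "al22 \<omega> u h = al22 (structure_forms v) u h"
    "be1 \<omega> u h = be1 (structure_forms v) u h" "be2 \<omega> u h = be2 (structure_forms v) u h"
    "be3 \<omega> u h = be3 (structure_forms v) u h"
    using f(1-9) .
qed

lemma has_lambda_structure_forms:
  assumes "adapted1 M U \<phi> v \<omega>"
  shows "has_lambda U \<omega> l \<longleftrightarrow> has_lambda U (structure_forms v) l"
  unfolding has_lambda_def
  by (intro ball_cong allI refl) (simp add: adapted1_structure_forms[OF assms])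

lemma adapted1I:
  assumes "patch M U \<phi>" "moving_frame U v" "\<And>u. u \<in> U \<Longrightarrow> imm M (\<phi> u) = proj_pt (v 0 u)"
  shows "adapted1 M U \<phi> v (structure_forms v)"
  using assms moving_frame_structure_equations by (auto simp: adapted1_iff)

lemma moving_frame_D:
  assumes "moving_frame U v" "u \<in> U"
  defines "\<omega> \<equiv> structure_forms v"
  shows "D (v 0) u h = (al11 \<omega> u h + al22 \<omega> u h) *\<^sub>R v 0 u + th1 \<omega> u h *\<^sub>R v 1 u + th2 \<omega> u h *\<^sub>R v 2 u"
    "D (v 1) u h = be1 \<omega> u h *\<^sub>R v 0 u + (al22 \<omega> u h - al11 \<omega> u h) *\<^sub>R v 1 u
                   - al12 \<omega> u h *\<^sub>R v 3 u + th2 \<omega> u h *\<^sub>R v 4 u"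
    "D (v 2) u h = be2 \<omega> u h *\<^sub>R v 0 u + (al11 \<omega> u h - al22 \<omega> u h) *\<^sub>R v 2 u
                   - al21 \<omega> u h *\<^sub>R v 3 u + th1 \<omega> u h *\<^sub>R v 4 u"
    "D (v 3) u h = (2 * be3 \<omega> u h) *\<^sub>R v 0 u - (2 * al21 \<omega> u h) *\<^sub>R v 1 u
                   - (2 * al12 \<omega> u h) *\<^sub>R v 2 u"
    "D (v 4) u h = be2 \<omega> u h *\<^sub>R v 1 u + be1 \<omega> u h *\<^sub>R v 2 u - be3 \<omega> u h *\<^sub>R v 3 u
                   - (al11 \<omega> u h + al22 \<omega> u h) *\<^sub>R v 4 u"
  using moving_frame_structure_equations[OF assms(1,2), of h] unfolding structure_equations_def \<omega>_def
  by auto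

lemma moving_frame_th:
  assumes "moving_frame U v"
  shows "smooth_on U (\<lambda>u. th1 (structure_forms v) u h)" "smooth_on U (\<lambda>u. th2 (structure_forms v) u h)"
    "u \<in> U \<Longrightarrow> linear (th1 (structure_forms v) u)" "u \<in> U \<Longrightarrow> linear (th2 (structure_forms v) u)"
  using assms unfolding moving_frame_def structure_forms_def
  by (auto intro!: smooth_on_qform smooth_on_D linear_compose[OF linear_D linear_qform_left, unfolded o_def])

lemma moving_frame_dual:
  assumes "moving_frame U v"
  defines "\<omega> \<equiv> structure_forms v"
  obtains X Y where "smooth_on U X" "smooth_on U Y"
    "\<And>u. u \<in> U \<Longrightarrow> th1 \<omega> u (X u) = 1" "\<And>u. u \<in> U \<Longrightarrow> th2 \<omega> u (X u) = 0"
    "\<And>u. u \<in> U \<Longrightarrow> th1 \<omega> u (Y u) = 0" "\<And>u. u \<in> U \<Longrightarrow> th2 \<omega> u (Y u) = 1"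
    "\<And>u x. u \<in> U \<Longrightarrow> x = th1 \<omega> u x *\<^sub>R X u + th2 \<omega> u x *\<^sub>R Y u"
  by (rule dual_coframe[of U "th1 \<omega>" "th2 \<omega>"])
    (use moving_frame_th[OF assms(1)] assms(1) in \<open>auto simp: \<omega>_def moving_frame_def\<close>)

lemma moving_frame_dual_at:
  assumes "moving_frame U v" "u \<in> U"
  defines "\<omega> \<equiv> structure_forms v"
  obtains X Y where "th1 \<omega> u X = 1" "th2 \<omega> u X = 0" "th1 \<omega> u Y = 0" "th2 \<omega> u Y = 1"
    "\<And>x. x = th1 \<omega> u x *\<^sub>R X + th2 \<omega> u x *\<^sub>R Y"
proof -
  from assms(1) show thesis
  proof (rule moving_frame_dual)
    fix X Y assume "\<And>u. u \<in> U \<Longrightarrow> th1 (structure_forms v) u (X u) = 1"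
      "\<And>u. u \<in> U \<Longrightarrow> th2 (structure_forms v) u (X u) = 0"
      "\<And>u. u \<in> U \<Longrightarrow> th1 (structure_forms v) u (Y u) = 0"
      "\<And>u. u \<in> U \<Longrightarrow> th2 (structure_forms v) u (Y u) = 1"
      "\<And>u x. u \<in> U \<Longrightarrow> x = th1 (structure_forms v) u x *\<^sub>R X u + th2 (structure_forms v) u x *\<^sub>R Y u"
    note this[OF assms(2), folded \<omega>_def]
    then show thesis by (rule that)
  qed
qed

text \<open>Cartan's lemma. Differentiating <dv_0, v_3> = 0 once more, symmetry of second
  derivatives makes <dv_0(h), dv_3(k)> symmetric in h and k. On the dual fields this reads
  \<open>al21\<close> at \<open>X\<close> = \<open>al12\<close> at \<open>Y\<close>, the common
  coefficient \<open>lam12\<close>.\<close>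

lemma moving_frame_has_lambda:
  assumes mf: "moving_frame U v"
  obtains l where "has_lambda U (structure_forms v) l"
proof -
  define \<omega> where "\<omega> = structure_forms v"
  obtain X Y where X: "\<And>u. u \<in> U \<Longrightarrow> th1 \<omega> u (X u) = 1" "\<And>u. u \<in> U \<Longrightarrow> th2 \<omega> u (X u) = 0"
    "\<And>u. u \<in> U \<Longrightarrow> th1 \<omega> u (Y u) = 0" "\<And>u. u \<in> U \<Longrightarrow> th2 \<omega> u (Y u) = 1"
    "\<And>u x. u \<in> U \<Longrightarrow> x = th1 \<omega> u x *\<^sub>R X u + th2 \<omega> u x *\<^sub>R Y u"
    using moving_frame_dual[OF mf] unfolding \<omega>_def by metis
  have U: "open U" and sm: "smooth_on U (v i)" for i using mf by (auto simp: moving_frame_def)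
  define l where "l = \<lparr>lam11 = \<lambda>u. al12 \<omega> u (X u), lam12 = \<lambda>u. al12 \<omega> u (Y u), lam22 = \<lambda>u. al21 \<omega> u (Y u)\<rparr>"
  have "al12 \<omega> u h = lam11 l u * th1 \<omega> u h + lam12 l u * th2 \<omega> u h \<and>
     al21 \<omega> u h = lam12 l u * th1 \<omega> u h + lam22 l u * th2 \<omega> u h" if u: "u \<in> U" for u h
  proof -
    have lin: "linear (al12 \<omega> u)" "linear (al21 \<omega> u)"
      unfolding \<omega>_def structure_forms_def using u
      by (auto intro!: linear_compose[OF linear_compose[OF linear_D[OF sm] linear_qform_left]
            linear_compose_scale_right[of _ "1/2", OF linear_id], unfolded o_def, simplified])
    have "qform (D (v 0) u h) (D (v 3) u k) = - qform (D (\<lambda>w. D (v 0) w h) u k) (v 3 u)" for h k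
    proof -
      have "qform (D (\<lambda>w. D (v 0) w h) u k) (v 3 u) = - qform (D (v 0) u h) (D (v 3) u k)"
        using mf D_qform_const[where f = "\<lambda>w. D (v 0) w h" and g = "v 3" and c = 0,
            OF U u smooth_on_D[OF sm] sm]
        by (auto simp: moving_frame_def)
      then show ?thesis by simp
    qed
    then have "qform (D (v 0) u (X u)) (D (v 3) u (Y u)) = qform (D (v 0) u (Y u)) (D (v 3) u (X u))"
      using D_sym[OF U u sm] by metis
    then have sym: "al21 \<omega> u (X u) = al12 \<omega> u (Y u)"
      unfolding moving_frame_D[OF mf u]
      using X(1-4)[OF u] by (simp add: qform_bilinear moving_frame_products[OF mf u] flip: \<omega>_def)
    have "al12 \<omega> u h = th1 \<omega> u h * al12 \<omega> u (X u) + th2 \<omega> u h * al12 \<omega> u (Y u)"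
      "al21 \<omega> u h = th1 \<omega> u h * al21 \<omega> u (X u) + th2 \<omega> u h * al21 \<omega> u (Y u)"
      using arg_cong[OF X(5)[OF u, of h], of "al12 \<omega> u"] arg_cong[OF X(5)[OF u, of h], of "al21 \<omega> u"] lin
      by (simp_all add: linear_add linear_scale)
    then show ?thesis by (simp add: l_def sym mult.commute)
  qed
  then show thesis using that[of l] by (auto simp: has_lambda_def \<omega>_def)
qed

section \<open>Change of charts\<close>

text \<open>The map \<eta> is the inverse of \<psi> after \<phi>, restricted to where its values lie
  in the smaller set \<open>V\<close>. Surjectivity of its derivative is what preserves
  nondegenerate coframes and the range of derivatives under pullback.\<close>

lemma transition_map:
  assumes M: "smooth_2_manifold M" and p: "patch M U \<phi>" "patch M V \<psi>"
    and u: "u \<in> U" "v \<in> V" "\<phi> u = \<psi> v"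
  obtains W \<eta> where "open W" "u \<in> W" "W \<subseteq> U" "smooth_on W \<eta>" "\<eta> u = v"
    "\<And>w. w \<in> W \<Longrightarrow> \<eta> w \<in> V \<and> \<psi> (\<eta> w) = \<phi> w \<and> surj (D \<eta> w)"
proof -
  obtain U0 V0 where U0: "(U0, \<phi>) \<in> charts M" "U \<subseteq> U0" "open U" and V0: "(V0, \<psi>) \<in> charts M" "V \<subseteq> V0" "open V"
    using p by (auto simp: patch_def)
  have ch: "open A" "openin (manifold M) (\<theta> ` A)" "inj_on \<theta> A" "continuous_map (top_of_set A) (manifold M) \<theta>"
    if "(A, \<theta>) \<in> charts M" for A \<theta>
  proof -
    have a: "open A" "openin (manifold M) (\<theta> ` A)"
      "homeomorphic_map (top_of_set A) (subtopology (manifold M) (\<theta> ` A)) \<theta>"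
      using M that unfolding smooth_2_manifold_def by blast+
    then show "open A" "openin (manifold M) (\<theta> ` A)" "inj_on \<theta> A"
        "continuous_map (top_of_set A) (manifold M) \<theta>"
      using homeomorphic_imp_injective_map[OF a(3)] homeomorphic_imp_continuous_map[OF a(3)]
      by (auto simp: continuous_map_in_subtopology)
  qed
  have T: "\<forall>(A, \<theta>) \<in> charts M. \<forall>(B, \<zeta>) \<in> charts M. smooth_on {w \<in> A. \<theta> w \<in> \<zeta> ` B} (inv_into B \<zeta> \<circ> \<theta>)"
    using M unfolding smooth_2_manifold_def by (elim conjE)
  have tr: "smooth_on {w \<in> A. \<theta> w \<in> \<zeta> ` B} (inv_into B \<zeta> \<circ> \<theta>)"
    if "(A, \<theta>) \<in> charts M" "(B, \<zeta>) \<in> charts M" for A \<theta> B \<zeta>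
  proof -
    have "\<forall>(B, \<zeta>) \<in> charts M. smooth_on {w \<in> A. \<theta> w \<in> \<zeta> ` B} (inv_into B \<zeta> \<circ> \<theta>)"
      using bspec[OF T that(1)] by simp
    from bspec[OF this that(2)] show ?thesis by simp
  qed
  have op: "open {w \<in> A. \<theta> w \<in> \<zeta> ` B}" if "(A, \<theta>) \<in> charts M" "(B, \<zeta>) \<in> charts M" for A \<theta> B \<zeta>
    using openin_continuous_map_preimage[OF ch(4)[OF that(1)] ch(2)[OF that(2)]] ch(1)[OF that(1)]
    by (simp add: openin_open_eq)
  define S where "S = {w \<in> U0. \<phi> w \<in> \<psi> ` V0}"
  define S' where "S' = {w \<in> V0. \<psi> w \<in> \<phi> ` U0}"
  define \<eta> where "\<eta> = inv_into V0 \<psi> \<circ> \<phi>"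
  define \<eta>' where "\<eta>' = inv_into U0 \<phi> \<circ> \<psi>"
  define W where "W = (S \<inter> U) \<inter> \<eta> -` V"
  have S: "open S" "open S'" "smooth_on S \<eta>" "smooth_on S' \<eta>'"
    unfolding S_def S'_def \<eta>_def \<eta>'_def using op tr U0 V0 by blast+
  have inv: "\<psi> (\<eta> w) = \<phi> w" "\<eta> w \<in> S'" "\<eta>' (\<eta> w) = w" if "w \<in> S" for w
  proof -
    have w: "w \<in> U0" "\<phi> w \<in> \<psi> ` V0" using that by (auto simp: S_def)
    show 1: "\<psi> (\<eta> w) = \<phi> w" unfolding \<eta>_def using w by (simp add: f_inv_into_f)
    show "\<eta> w \<in> S'" using w 1 inv_into_into[OF w(2)] by (auto simp: S'_def \<eta>_def)
    show "\<eta>' (\<eta> w) = w" using w 1 ch(3)[OF U0(1)] by (simp add: \<eta>'_def)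
  qed
  show thesis
  proof
    have "open (S \<inter> U)" "continuous_on (S \<inter> U) \<eta>"
      using S U0 smooth_on_imp_continuous_on[OF S(3)] by (auto intro: continuous_on_subset)
    then show "open W" unfolding W_def using V0(3) continuous_open_preimage by blast
    show "smooth_on W \<eta>" by (rule smooth_on_subset[OF S(3)]) (auto simp: W_def)
    have uS: "u \<in> S" using u U0 V0 by (auto simp: S_def)
    show eta: "\<eta> u = v" unfolding \<eta>_def using u ch(3)[OF V0(1)] V0 by auto
    show "u \<in> W" using uS u eta by (auto simp: W_def)
    show "W \<subseteq> U" by (auto simp: W_def)
    fix w assume w: "w \<in> W"
    then have wS: "w \<in> S" by (auto simp: W_def)
    \<comment> \<open>Chain rule for the reverse transition \<eta>', a left inverse of \<eta>. The
      derivative of \<eta> is therefore injective, and surjective as an endomorphism of the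
      plane.\<close>
    have "D \<eta>' (\<eta> w) (D \<eta> w h) = h" for h
    proof -
      have "D (\<lambda>x. \<eta>' (\<eta> x)) w h = D \<eta>' (\<eta> w) (D \<eta> w h)"
        by (rule D_compose[OF S(3) S(4) wS inv(2)[OF wS]])
      moreover have "D (\<lambda>x. \<eta>' (\<eta> x)) w = D (\<lambda>x. x) w"
        by (rule D_cong_open[OF S(1) wS]) (simp add: inv)
      ultimately show ?thesis by simp
    qed
    then have "inj (D \<eta> w)" by (metis injI)
    then have "surj (D \<eta> w)"
      using linear_injective_imp_surjective linear_D[OF S(3) wS] by blast
    then show "\<eta> w \<in> V \<and> \<psi> (\<eta> w) = \<phi> w \<and> surj (D \<eta> w)" using w inv(1)[OF wS] by (auto simp: W_def)
  qed
qed

lemma moving_frame_subset: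
  "moving_frame U v \<Longrightarrow> W \<subseteq> U \<Longrightarrow> open W \<Longrightarrow> moving_frame W v"
  unfolding moving_frame_def using smooth_on_subset by blast

lemma has_lambda_subset: "has_lambda U \<omega> l \<Longrightarrow> W \<subseteq> U \<Longrightarrow> has_lambda W \<omega> l"
  unfolding has_lambda_def by blast

lemma structure_forms_pullback:
  assumes mf: "moving_frame U v" and s: "smooth_on W \<eta>" "w \<in> W" "\<eta> w \<in> U"
  defines "\<omega> \<equiv> structure_forms v" and "\<omega>' \<equiv> structure_forms (\<lambda>i w. v i (\<eta> w))"
  shows "th1 \<omega>' w h = th1 \<omega> (\<eta> w) (D \<eta> w h)" "th2 \<omega>' w h = th2 \<omega> (\<eta> w) (D \<eta> w h)"
    "al12 \<omega>' w h = al12 \<omega> (\<eta> w) (D \<eta> w h)" "al21 \<omega>' w h = al21 \<omega> (\<eta> w) (D \<eta> w h)"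
    "be3 \<omega>' w h = be3 \<omega> (\<eta> w) (D \<eta> w h)"
proof -
  have d: "D (\<lambda>w. v i (\<eta> w)) w h = D (v i) (\<eta> w) (D \<eta> w h)" for i
    using D_compose[OF s(1) _ s(2,3), of "v i"] mf by (auto simp: moving_frame_def)
  show "th1 \<omega>' w h = th1 \<omega> (\<eta> w) (D \<eta> w h)" "th2 \<omega>' w h = th2 \<omega> (\<eta> w) (D \<eta> w h)"
    "al12 \<omega>' w h = al12 \<omega> (\<eta> w) (D \<eta> w h)" "al21 \<omega>' w h = al21 \<omega> (\<eta> w) (D \<eta> w h)"
    "be3 \<omega>' w h = be3 \<omega> (\<eta> w) (D \<eta> w h)"
    by (simp_all add: \<omega>_def \<omega>'_def structure_forms_def d)
qed

lemma moving_frame_pullback: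
  assumes mf: "moving_frame U v" and W: "open W" and s: "smooth_on W \<eta>"
    and \<eta>: "\<And>w. w \<in> W \<Longrightarrow> \<eta> w \<in> U" "\<And>w. w \<in> W \<Longrightarrow> surj (D \<eta> w)"
  shows "moving_frame W (\<lambda>i w. v i (\<eta> w))"
  unfolding moving_frame_def
proof (intro conjI allI ballI)
  fix i show "smooth_on W (\<lambda>w. v i (\<eta> w))"
    using smooth_on_compose[where f = "v i" and \<psi> = \<eta> and W = W and U = U] mf W s \<eta>
    by (auto simp: moving_frame_def)
next
  fix w assume w: "w \<in> W"
  show "hyperbolic_frame (\<lambda>i. v i (\<eta> w))" using mf \<eta>[OF w] by (auto simp: moving_frame_def)
  fix h
  have "D (\<lambda>w. v 0 (\<eta> w)) w h = D (v 0) (\<eta> w) (D \<eta> w h)"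
    using D_compose[OF s _ w, of U "v 0"] mf \<eta>[OF w] by (auto simp: moving_frame_def)
  then show "qform (D (\<lambda>w. v 0 (\<eta> w)) w h) (v 3 (\<eta> w)) = 0"
    using mf \<eta>[OF w] by (auto simp: moving_frame_def)
next
  fix w assume w: "w \<in> W"
  obtain h k where "wedge (th1 (structure_forms v)) (th2 (structure_forms v)) (\<eta> w) h k \<noteq> 0"
    using mf \<eta>(1)[OF w] unfolding moving_frame_def by blast
  moreover obtain h' k' where "h = D \<eta> w h'" "k = D \<eta> w k'" using \<eta>(2)[OF w] by (metis surjD)
  ultimately have "wedge (th1 (structure_forms (\<lambda>i w. v i (\<eta> w)))) (th2 (structure_forms (\<lambda>i w. v i (\<eta> w)))) w h' k' \<noteq> 0"
    by (simp add: wedge_def structure_forms_pullback[OF mf s w \<eta>(1)[OF w]])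
  then show "\<exists>h k. wedge (th1 (structure_forms (\<lambda>i w. v i (\<eta> w)))) (th2 (structure_forms (\<lambda>i w. v i (\<eta> w)))) w h k \<noteq> 0"
    by blast
qed (use W in auto)

lemma has_lambda_pullback:
  assumes mf: "moving_frame U v" and s: "smooth_on W \<eta>"
    and \<eta>: "\<And>w. w \<in> W \<Longrightarrow> \<eta> w \<in> U" and l: "has_lambda U (structure_forms v) l"
  shows "has_lambda W (structure_forms (\<lambda>i w. v i (\<eta> w)))
    \<lparr>lam11 = \<lambda>w. lam11 l (\<eta> w), lam12 = \<lambda>w. lam12 l (\<eta> w), lam22 = \<lambda>w. lam22 l (\<eta> w)\<rparr>"
  unfolding has_lambda_def
proof (intro ballI allI)
  fix w h assume w: "w \<in> W"
  show "al12 (structure_forms (\<lambda>i w. v i (\<eta> w))) w h =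
        lam11 \<lparr>lam11 = \<lambda>w. lam11 l (\<eta> w), lam12 = \<lambda>w. lam12 l (\<eta> w), lam22 = \<lambda>w. lam22 l (\<eta> w)\<rparr> w
          * th1 (structure_forms (\<lambda>i w. v i (\<eta> w))) w h +
        lam12 \<lparr>lam11 = \<lambda>w. lam11 l (\<eta> w), lam12 = \<lambda>w. lam12 l (\<eta> w), lam22 = \<lambda>w. lam22 l (\<eta> w)\<rparr> w
          * th2 (structure_forms (\<lambda>i w. v i (\<eta> w))) w h \<and>
      al21 (structure_forms (\<lambda>i w. v i (\<eta> w))) w h =
        lam12 \<lparr>lam11 = \<lambda>w. lam11 l (\<eta> w), lam12 = \<lambda>w. lam12 l (\<eta> w), lam22 = \<lambda>w. lam22 l (\<eta> w)\<rparr> w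
          * th1 (structure_forms (\<lambda>i w. v i (\<eta> w))) w h +
        lam22 \<lparr>lam11 = \<lambda>w. lam11 l (\<eta> w), lam12 = \<lambda>w. lam12 l (\<eta> w), lam22 = \<lambda>w. lam22 l (\<eta> w)\<rparr> w
          * th2 (structure_forms (\<lambda>i w. v i (\<eta> w))) w h"
    unfolding structure_forms_pullback[OF mf s w \<eta>[OF w]]
    using l \<eta>[OF w] unfolding has_lambda_def by simp
qed

section \<open>Invariance of the central sphere and of the conjugate point\<close>

lemma proj_pt_scaleR: "c \<noteq> 0 \<Longrightarrow> proj_pt (c *\<^sub>R x) = proj_pt x"
proof -
  assume "c \<noteq> 0"
  then have "x = inverse c *\<^sub>R (c *\<^sub>R x)" by simp
  then have "x \<in> span {c *\<^sub>R x}" by (metis span_scale span_base singletonI)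
  moreover have "c *\<^sub>R x \<in> span {x}" by (simp add: span_scale span_base)
  ultimately show ?thesis by (simp add: proj_pt_def span_eq)
qed

lemma proj_pt_eqD: "proj_pt x = proj_pt y \<Longrightarrow> \<exists>c. x = c *\<^sub>R y"
  using span_base[of x "{x}"] by (auto simp: proj_pt_def span_singleton)

lemma quadric_sphere_scaleR: "c \<noteq> 0 \<Longrightarrow> quadric_sphere (c *\<^sub>R x) = quadric_sphere x"
  by (simp add: quadric_sphere_def qform_bilinear)

text \<open>The vector \<open>v' 3\<close> is orthogonal to \<open>v' 0\<close> and its derivatives,
  hence to \<open>v 0\<close>, \<open>v 1\<close>, \<open>v 2\<close>, whose orthogonal complement
  is spanned by \<open>v 0\<close> and \<open>v 3\<close>. The normalization <v_3, v_3> = -2 of both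
  frames leaves a sign for \<open>s\<close>.\<close>

lemma moving_frame_compare:
  assumes mf: "moving_frame W v" "moving_frame W v'"
    and pt: "\<And>w. w \<in> W \<Longrightarrow> proj_pt (v' 0 w) = proj_pt (v 0 w)"
  obtains a s f where "smooth_on W a" "smooth_on W s" "smooth_on W f"
    "\<And>w. w \<in> W \<Longrightarrow> a w \<noteq> 0" "\<And>w. w \<in> W \<Longrightarrow> s w * s w = 1"
    "\<And>w. w \<in> W \<Longrightarrow> v' 0 w = a w *\<^sub>R v 0 w"
    "\<And>w. w \<in> W \<Longrightarrow> v' 3 w = s w *\<^sub>R v 3 w + f w *\<^sub>R v 0 w"
    "\<And>w h. w \<in> W \<Longrightarrow> D (v' 0) w h = a w *\<^sub>R D (v 0) w h + D a w h *\<^sub>R v 0 w"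
proof -
  \<comment> \<open>Defining the coefficients as pairings with \<open>v\<close> makes them smooth
    from the start; that they are the right ones is shown afterwards.\<close>
  define a s f where "a w = - qform (v' 0 w) (v 4 w)" and "s w = - qform (v' 3 w) (v 3 w) / 2"
    and "f w = - qform (v' 3 w) (v 4 w)" for w
  have W: "open W" and sm: "smooth_on W (v i)" "smooth_on W (v' i)" for i
    using mf by (auto simp: moving_frame_def)
  have sma: "smooth_on W a" "smooth_on W f"
    unfolding a_def f_def by (intro smooth_on_uminus smooth_on_qform W sm)+
  have sms: "smooth_on W s"
    unfolding s_def using smooth_on_mult[OF W smooth_on_const[of W "-1/2"] smooth_on_qform[OF W sm(2) sm(1)], of 3 3]
    by simp
  have v0: "v' 0 w = a w *\<^sub>R v 0 w" and a: "a w \<noteq> 0" if w: "w \<in> W" for w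
  proof -
    obtain c where c: "v' 0 w = c *\<^sub>R v 0 w" using proj_pt_eqD[OF pt[OF w]] by blast
    then show eq: "v' 0 w = a w *\<^sub>R v 0 w"
      by (simp add: a_def qform_bilinear moving_frame_products[OF mf(1) w])
    show "a w \<noteq> 0"
      using moving_frame_products(5)[OF mf(2) w] eq by (auto simp: qform_bilinear)
  qed
  have D0: "D (v' 0) w h = a w *\<^sub>R D (v 0) w h + D a w h *\<^sub>R v 0 w" if w: "w \<in> W" for w h
    using D_cong_open[OF W w v0] D_scaleR[of a w "v 0" h] w
    by (simp add: smooth_on_imp_differentiable[OF sma(1)] smooth_on_imp_differentiable[OF sm(1)])
  have v3: "v' 3 w = s w *\<^sub>R v 3 w + f w *\<^sub>R v 0 w" and s: "s w * s w = 1" if w: "w \<in> W" for w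
  proof -
    note p = moving_frame_products[OF mf(1) w] moving_frame_products[OF mf(2) w]
    have fr: "hyperbolic_frame (\<lambda>i. v i w)" using mf(1) w by (simp add: moving_frame_def)
    have 0: "qform (v' 3 w) (v 0 w) = 0"
      using p v0[OF w] a[OF w] by (auto simp: qform_bilinear)
    have D: "qform (v' 3 w) (D (v 0) w h) = 0" for h
    proof -
      have "qform (D (v' 0) w h) (v' 3 w) = 0" using mf(2) w by (auto simp: moving_frame_def)
      then have "qform (v' 3 w) (a w *\<^sub>R D (v 0) w h + D a w h *\<^sub>R v 0 w) = 0"
        unfolding D0[OF w, of h] by (simp only: qform_commute)
      then show ?thesis using a[OF w] 0 by (simp add: qform_bilinear)
    qed
    obtain X Y where X: "th1 (structure_forms v) w X = 1" "th2 (structure_forms v) w X = 0"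
        "th1 (structure_forms v) w Y = 0" "th2 (structure_forms v) w Y = 1"
      by (rule moving_frame_dual_at[OF mf(1) w])
    have 12: "qform (v' 3 w) (v 1 w) = 0" "qform (v' 3 w) (v 2 w) = 0"
      using D[of X] D[of Y] X 0 by (simp_all add: moving_frame_D[OF mf(1) w] qform_bilinear)
    show eq: "v' 3 w = s w *\<^sub>R v 3 w + f w *\<^sub>R v 0 w"
      by (rule frame_ext[OF fr]) (simp_all add: 0 12 s_def f_def p qform_bilinear)
    have "qform (v' 3 w) (v' 3 w) = -2" by (rule moving_frame_products(19)[OF mf(2) w])
    then show "s w * s w = 1" unfolding eq by (simp add: qform_bilinear p)
  qed
  show thesis using that[OF sma(1) sms sma(2) a s v0 v3 D0] .
qed

text \<open>On the pair of null directions <dv_3, dv_0> has the value -2 \<open>lam12\<close>.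
  Adding \<open>f\<close> times \<open>v 0\<close> to \<open>v 3\<close> adds a multiple of the
  conformal metric, and the summand with \<open>lam12\<close> in the central vector compensates
  exactly for this shift.\<close>

lemma central_sphere_vector_unique:
  assumes mf: "moving_frame W v" "moving_frame W v'"
    and l: "has_lambda W (structure_forms v) l" "has_lambda W (structure_forms v') l'"
    and pt: "\<And>w. w \<in> W \<Longrightarrow> proj_pt (v' 0 w) = proj_pt (v 0 w)" and u: "u \<in> W"
  obtains s where "s * s = 1"
    "v' 3 u + (2 * lam12 l' u) *\<^sub>R v' 0 u = s *\<^sub>R (v 3 u + (2 * lam12 l u) *\<^sub>R v 0 u)"
proof (rule moving_frame_compare[OF mf pt])
  fix a s f
  assume sm: "smooth_on W a" "smooth_on W s" "smooth_on W f"
    and a: "\<And>w. w \<in> W \<Longrightarrow> a w \<noteq> 0" and s: "\<And>w. w \<in> W \<Longrightarrow> s w * s w = 1"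
    and v0: "\<And>w. w \<in> W \<Longrightarrow> v' 0 w = a w *\<^sub>R v 0 w"
    and v3: "\<And>w. w \<in> W \<Longrightarrow> v' 3 w = s w *\<^sub>R v 3 w + f w *\<^sub>R v 0 w"
    and D0: "\<And>w h. w \<in> W \<Longrightarrow> D (v' 0) w h = a w *\<^sub>R D (v 0) w h + D a w h *\<^sub>R v 0 w"
  have W: "open W" and smv: "smooth_on W (v i)" for i using mf by (auto simp: moving_frame_def)
  define \<omega> \<omega>' where "\<omega> = structure_forms v" and "\<omega>' = structure_forms v'"
  obtain X Y where X: "th1 \<omega> u X = 1" "th2 \<omega> u X = 0" "th1 \<omega> u Y = 0" "th2 \<omega> u Y = 1"
    unfolding \<omega>_def by (rule moving_frame_dual_at[OF mf(1) u])
  note diff = smooth_on_imp_differentiable[OF _ u]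
  note p = moving_frame_products[OF mf(1) u] and p' = moving_frame_products[OF mf(2) u]
  have lam: "al12 \<omega> u h = lam11 l u * th1 \<omega> u h + lam12 l u * th2 \<omega> u h"
      "al21 \<omega> u h = lam12 l u * th1 \<omega> u h + lam22 l u * th2 \<omega> u h" for h
    using l(1) u by (auto simp: has_lambda_def \<omega>_def)
  have lam': "al12 \<omega>' u h = lam11 l' u * th1 \<omega>' u h + lam12 l' u * th2 \<omega>' u h"
      "al21 \<omega>' u h = lam12 l' u * th1 \<omega>' u h + lam22 l' u * th2 \<omega>' u h" for h
    using l(2) u by (auto simp: has_lambda_def \<omega>'_def)
  have D3: "D (v' 3) u h = s u *\<^sub>R D (v 3) u h + D s u h *\<^sub>R v 3 u + (f u *\<^sub>R D (v 0) u h + D f u h *\<^sub>R v 0 u)" for h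
  proof -
    have "D (v' 3) u h = D (\<lambda>w. s w *\<^sub>R v 3 w + f w *\<^sub>R v 0 w) u h"
      using D_cong_open[OF W u v3] by simp
    also have "\<dots> = D (\<lambda>w. s w *\<^sub>R v 3 w) u h + D (\<lambda>w. f w *\<^sub>R v 0 w) u h"
      by (intro D_add diff[OF smooth_on_scaleR[OF W]] sm smv)
    finally show ?thesis
      by (simp add: D_scaleR[OF diff diff, OF sm(2) smv] D_scaleR[OF diff diff, OF sm(3) smv])
  qed
  \<comment> \<open>Evaluating the identities for the two quadratic forms on the null directions isolates \<open>\<lambda>\<^sub>1\<^sub>2\<close>.\<close>
  have Q: "qform (D (v' 0) u h) (D (v' 0) u k) = a u * a u * qform (D (v 0) u h) (D (v 0) u k)" for h k
    unfolding D0[OF u] moving_frame_D[OF mf(1) u] by (simp add: qform_bilinear p algebra_simps)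
  have Q': "th1 \<omega>' u h * th2 \<omega>' u k + th2 \<omega>' u h * th1 \<omega>' u k =
      a u * a u * (th1 \<omega> u h * th2 \<omega> u k + th2 \<omega> u h * th1 \<omega> u k)" for h k
    using Q[of h k] unfolding moving_frame_D[OF mf(1) u] moving_frame_D[OF mf(2) u] \<omega>_def \<omega>'_def
    by (simp add: qform_bilinear p p' algebra_simps)
  have P: "qform (D (v' 3) u h) (D (v' 0) u k) =
      s u * a u * qform (D (v 3) u h) (D (v 0) u k) + f u * a u * qform (D (v 0) u h) (D (v 0) u k)" for h k
    unfolding D0[OF u] D3 moving_frame_D[OF mf(1) u] by (simp add: qform_bilinear p algebra_simps)
  have P': "- 2 * (al21 \<omega>' u h * th2 \<omega>' u k + al12 \<omega>' u h * th1 \<omega>' u k) =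
      - 2 * s u * a u * (al21 \<omega> u h * th2 \<omega> u k + al12 \<omega> u h * th1 \<omega> u k)
      + f u * a u * (th1 \<omega> u h * th2 \<omega> u k + th2 \<omega> u h * th1 \<omega> u k)" for h k
    using P[of h k] unfolding moving_frame_D[OF mf(1) u] moving_frame_D[OF mf(2) u] \<omega>_def \<omega>'_def
    by (simp add: qform_bilinear p p' algebra_simps)
  define x1 x2 y1 y2 where "x1 = th1 \<omega>' u X" and "x2 = th2 \<omega>' u X" and "y1 = th1 \<omega>' u Y" and "y2 = th2 \<omega>' u Y"
  \<comment> \<open>Both metrics have the same null directions. As \<open>X\<close> and
    \<open>Y\<close> are independent null vectors, one of the forms \<open>th1 \<omega>'\<close>,
    \<open>th2 \<omega>'\<close> vanishes on \<open>X\<close> and the other on \<open>Y\<close>;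
    this removes \<open>lam11 l'\<close> and \<open>lam22 l'\<close> from the comparison.\<close>
  have eqs: "x1 * x2 = 0" "y1 * y2 = 0" "x1 * y2 + x2 * y1 = a u * a u"
    using Q'[of X X] Q'[of Y Y] Q'[of X Y] X by (auto simp: x1_def x2_def y1_def y2_def)
  have z: "x1 * y1 = 0" "x2 * y2 = 0"
    using eqs a[OF u] by (cases "x1 = 0"; cases "x2 = 0"; auto)+
  have "- 2 * ((lam12 l' u * x1 + lam22 l' u * x2) * y2 + (lam11 l' u * x1 + lam12 l' u * x2) * y1) =
      - 2 * s u * a u * lam12 l u + f u * a u"
    using P'[of X Y] unfolding lam lam' X x1_def[symmetric] x2_def[symmetric] y1_def[symmetric] y2_def[symmetric]
    by simp
  moreover have "(lam12 l' u * x1 + lam22 l' u * x2) * y2 + (lam11 l' u * x1 + lam12 l' u * x2) * y1 =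
      lam12 l' u * (x1 * y2 + x2 * y1) + lam22 l' u * (x2 * y2) + lam11 l' u * (x1 * y1)"
    by (simp add: algebra_simps)
  ultimately have "a u * (2 * lam12 l' u * a u + f u) = a u * (2 * s u * lam12 l u)"
    using eqs z by (simp add: algebra_simps)
  then have "2 * lam12 l' u * a u + f u = 2 * s u * lam12 l u" using a[OF u] by simp
  then have "v' 3 u + (2 * lam12 l' u) *\<^sub>R v' 0 u = s u *\<^sub>R v 3 u + (2 * s u * lam12 l u) *\<^sub>R v 0 u"
    using v0[OF u] v3[OF u] by (simp add: algebra_simps flip: scaleR_add_left)
  then show thesis using that[OF s[OF u]] by (simp add: algebra_simps)
qed

text \<open>Two frames around the same point may live in different charts; the second one is pulled
  back to the parameters of the first, so that they can be compared pointwise.\<close>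

lemma adapted1_common_chart:
  assumes M: "smooth_2_manifold M"
    and ad: "adapted1 M U \<phi> v \<omega>" "adapted1 M U' \<phi>' v' \<omega>'" and l: "has_lambda U' \<omega>' l'"
    and u: "u \<in> U" "u' \<in> U'" "\<phi> u = \<phi>' u'"
  obtains W \<eta> where "open W" "u \<in> W" "W \<subseteq> U" "\<eta> u = u'" "\<And>w. w \<in> W \<Longrightarrow> \<eta> w \<in> U' \<and> \<phi>' (\<eta> w) = \<phi> w"
    "moving_frame W v" "moving_frame W (\<lambda>i w. v' i (\<eta> w))"
    "\<And>w. w \<in> W \<Longrightarrow> proj_pt (v' 0 (\<eta> w)) = proj_pt (v 0 w)"
    "has_lambda W (structure_forms (\<lambda>i w. v' i (\<eta> w)))
      \<lparr>lam11 = \<lambda>w. lam11 l' (\<eta> w), lam12 = \<lambda>w. lam12 l' (\<eta> w), lam22 = \<lambda>w. lam22 l' (\<eta> w)\<rparr>"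
    "\<And>w h. w \<in> W \<Longrightarrow> be3 (structure_forms (\<lambda>i w. v' i (\<eta> w))) w h = be3 \<omega>' (\<eta> w) (D \<eta> w h)"
proof -
  have p: "patch M U \<phi>" "patch M U' \<phi>'" and mf: "moving_frame U v" "moving_frame U' v'"
    and pt: "\<And>u. u \<in> U \<Longrightarrow> imm M (\<phi> u) = proj_pt (v 0 u)" "\<And>u. u \<in> U' \<Longrightarrow> imm M (\<phi>' u) = proj_pt (v' 0 u)"
    using ad by (auto simp: adapted1_iff)
  show thesis
  proof (rule transition_map[OF M p u])
    fix W \<eta>
    assume W: "open W" "u \<in> W" "W \<subseteq> U" "smooth_on W \<eta>" "\<eta> u = u'"
    and \<eta>: "\<And>w. w \<in> W \<Longrightarrow> \<eta> w \<in> U' \<and> \<phi>' (\<eta> w) = \<phi> w \<and> surj (D \<eta> w)"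
    show thesis
  proof
    show "moving_frame W v" using moving_frame_subset[OF mf(1) W(3,1)] .
    show "moving_frame W (\<lambda>i w. v' i (\<eta> w))" using moving_frame_pullback[OF mf(2) W(1,4)] \<eta> by blast
    show "proj_pt (v' 0 (\<eta> w)) = proj_pt (v 0 w)" if "w \<in> W" for w
      using pt(1)[of w] pt(2)[of "\<eta> w"] \<eta>[OF that] W(3) that by auto
    show "has_lambda W (structure_forms (\<lambda>i w. v' i (\<eta> w)))
      \<lparr>lam11 = \<lambda>w. lam11 l' (\<eta> w), lam12 = \<lambda>w. lam12 l' (\<eta> w), lam22 = \<lambda>w. lam22 l' (\<eta> w)\<rparr>"
      using has_lambda_pullback[OF mf(2) W(4)] l \<eta> has_lambda_structure_forms[OF ad(2)] by blast
    show "be3 (structure_forms (\<lambda>i w. v' i (\<eta> w))) w h = be3 \<omega>' (\<eta> w) (D \<eta> w h)" if "w \<in> W" for w h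
      using structure_forms_pullback(5)[OF mf(2) W(4) that] \<eta>[OF that] adapted1_structure_forms(9)[OF ad(2)]
      by simp
  qed (use W \<eta> in auto)
  qed
qed

text \<open>On a common chart the central vectors of two frames differ by a sign, which a sphere
  does not see, so any frame evaluates the definite description.\<close>

lemma central_tangent_sphere_eq:
  assumes M: "smooth_2_manifold M" and ad: "adapted1 M U \<phi> v \<omega>" and l: "has_lambda U \<omega> l" and u: "u \<in> U"
  shows "central_tangent_sphere M (\<phi> u) = quadric_sphere (v 3 u + (2 * lam12 l u) *\<^sub>R v 0 u)"
  unfolding central_tangent_sphere_def
proof (rule the_equality)
  fix \<Sigma>
  assume "\<exists>U' \<phi>' v' \<omega>' l'. \<exists>u'\<in>U'. adapted1 M U' \<phi>' v' \<omega>' \<and> has_lambda U' \<omega>' l' \<and> \<phi>' u' = \<phi> u \<and>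
     \<Sigma> = quadric_sphere (v' 3 u' + (2 * lam12 l' u') *\<^sub>R v' 0 u')"
  then obtain U' \<phi>' v' \<omega>' l' u' where u': "u' \<in> U'" "adapted1 M U' \<phi>' v' \<omega>'" "has_lambda U' \<omega>' l'" "\<phi> u = \<phi>' u'"
    and \<Sigma>: "\<Sigma> = quadric_sphere (v' 3 u' + (2 * lam12 l' u') *\<^sub>R v' 0 u')" by metis
  show "\<Sigma> = quadric_sphere (v 3 u + (2 * lam12 l u) *\<^sub>R v 0 u)"
  proof (rule adapted1_common_chart[OF M ad u'(2,3) u u'(1,4)])
    fix W \<eta>
    assume W0: "open W" and W: "u \<in> W" "W \<subseteq> U" "\<eta> u = u'"
    and \<eta>: "\<And>w. w \<in> W \<Longrightarrow> \<eta> w \<in> U' \<and> \<phi>' (\<eta> w) = \<phi> w"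
    and mf: "moving_frame W v" "moving_frame W (\<lambda>i w. v' i (\<eta> w))"
    and pt: "\<And>w. w \<in> W \<Longrightarrow> proj_pt (v' 0 (\<eta> w)) = proj_pt (v 0 w)"
    and lW': "has_lambda W (structure_forms (\<lambda>i w. v' i (\<eta> w)))
      \<lparr>lam11 = \<lambda>w. lam11 l' (\<eta> w), lam12 = \<lambda>w. lam12 l' (\<eta> w), lam22 = \<lambda>w. lam22 l' (\<eta> w)\<rparr>"
    and b: "\<And>w h. w \<in> W \<Longrightarrow> be3 (structure_forms (\<lambda>i w. v' i (\<eta> w))) w h = be3 \<omega>' (\<eta> w) (D \<eta> w h)"
  have lW: "has_lambda W (structure_forms v) l"
    using l has_lambda_structure_forms[OF ad] has_lambda_subset W(2) by blast
  have "\<exists>s. s * s = 1 \<and> v' 3 u' + (2 * lam12 l' u') *\<^sub>R v' 0 u' = s *\<^sub>R (v 3 u + (2 * lam12 l u) *\<^sub>R v 0 u)"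
    by (rule central_sphere_vector_unique[OF mf lW lW' pt W(1)]) (use W(3) in auto)
  then obtain s where "s * s = 1"
    "v' 3 u' + (2 * lam12 l' u') *\<^sub>R v' 0 u' = s *\<^sub>R (v 3 u + (2 * lam12 l u) *\<^sub>R v 0 u)"
    by blast
  then show ?thesis
    unfolding \<Sigma> using quadric_sphere_scaleR[of s] by (metis mult_zero_left zero_neq_one)
  qed
qed (use ad l u in blast)

text \<open>With \<open>lam12\<close> zero on all of \<open>W\<close>, \<open>v' 3\<close> is a
  multiple of \<open>v 3\<close> near \<open>u\<close>, so the relation may be differentiated. Then
  \<open>v' 4\<close> is orthogonal to \<open>v 3\<close> and its derivatives, which span
  \<open>v 1\<close> and \<open>v 2\<close> because \<open>lam11\<close> and \<open>lam22\<close>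
  are nonzero.\<close>

lemma conjugate_point_unique:
  assumes mf: "moving_frame W v" "moving_frame W v'"
    and l: "has_lambda W (structure_forms v) l" "has_lambda W (structure_forms v') l'"
    and pt: "\<And>w. w \<in> W \<Longrightarrow> proj_pt (v' 0 w) = proj_pt (v 0 w)"
    and ad: "\<And>w. w \<in> W \<Longrightarrow> lam12 l w = 0" "\<And>w. w \<in> W \<Longrightarrow> lam12 l' w = 0"
      "\<And>h. be3 (structure_forms v) u h = 0" "\<And>h. be3 (structure_forms v') u h = 0"
    and u: "u \<in> W" and gen: "lam11 l u \<noteq> 0" "lam22 l u \<noteq> 0"
  shows "proj_pt (v' 4 u) = proj_pt (v 4 u)"
proof -
  define s where "s w = - qform (v' 3 w) (v 3 w) / 2" for w
  have W: "open W" and sm: "smooth_on W (v i)" "smooth_on W (v' i)" for i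
    using mf by (auto simp: moving_frame_def)
  have sms: "smooth_on W s"
    unfolding s_def using smooth_on_mult[OF W smooth_on_const[of W "-1/2"] smooth_on_qform[OF W sm(2) sm(1)], of 3 3]
    by simp
  have v3: "v' 3 w = s w *\<^sub>R v 3 w" and s: "s w \<noteq> 0" if w: "w \<in> W" for w
  proof -
    obtain c where c: "c * c = 1" "v' 3 w = c *\<^sub>R v 3 w"
      using central_sphere_vector_unique[OF mf l pt w] ad(1,2)[OF w] by auto
    then have "s w = c" by (simp add: s_def qform_bilinear moving_frame_products[OF mf(1) w])
    then show "v' 3 w = s w *\<^sub>R v 3 w" "s w \<noteq> 0" using c by auto
  qed
  obtain a where a: "a \<noteq> 0" "v' 0 u = a *\<^sub>R v 0 u"
    using moving_frame_compare[OF mf pt] u by metis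
  define \<omega> where "\<omega> = structure_forms v"
  obtain X Y where X: "th1 \<omega> u X = 1" "th2 \<omega> u X = 0" "th1 \<omega> u Y = 0" "th2 \<omega> u Y = 1"
    unfolding \<omega>_def by (rule moving_frame_dual_at[OF mf(1) u])
  have lam: "al12 \<omega> u h = lam11 l u * th1 \<omega> u h" "al21 \<omega> u h = lam22 l u * th2 \<omega> u h" for h
    using l(1) u ad(1)[OF u] by (auto simp: has_lambda_def \<omega>_def)
  note p = moving_frame_products[OF mf(1) u] and p' = moving_frame_products[OF mf(2) u]
  have D3: "D (v' 3) u h = s u *\<^sub>R D (v 3) u h + D s u h *\<^sub>R v 3 u" for h
    using D_cong_open[OF W u v3] D_scaleR[of s u "v 3" h]
    by (simp add: smooth_on_imp_differentiable[OF _ u] sm sms)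
  have v34: "qform (v 3 u) (v' 4 u) = 0"
    using p'(20) s[OF u] unfolding v3[OF u] by (simp add: qform_bilinear)
  have "qform (D (v' 3) u h) (v' 4 u) = 0" for h
    using ad(4)[of h] by (simp add: structure_forms_def)
  then have D3': "qform (D (v 3) u h) (v' 4 u) = 0" for h
    using s[OF u] by (simp add: D3 qform_bilinear v34)
  have "lam22 l u * th2 \<omega> u h * qform (v 1 u) (v' 4 u) + lam11 l u * th1 \<omega> u h * qform (v 2 u) (v' 4 u) = 0" for h
    using D3'[of h] ad(3)[of h] unfolding moving_frame_D(4)[OF mf(1) u] lam[unfolded \<omega>_def]
    by (simp add: qform_bilinear \<omega>_def)
  from this[of X] this[of Y] have v12: "qform (v 1 u) (v' 4 u) = 0" "qform (v 2 u) (v' 4 u) = 0"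
    using X gen by auto
  define c0 c4 where "c0 = - qform (v' 4 u) (v 4 u)" and "c4 = - qform (v' 4 u) (v 0 u)"
  have fr: "hyperbolic_frame (\<lambda>i. v i u)" using mf(1) u by (simp add: moving_frame_def)
  have eq: "v' 4 u = c0 *\<^sub>R v 0 u + c4 *\<^sub>R v 4 u"
    by (rule frame_ext[OF fr])
      (use v34 v12 in \<open>simp_all add: qform_bilinear p c0_def c4_def qform_commute[of "v' 4 u"]\<close>)
  \<comment> \<open>The plane of \<open>v 0\<close> and \<open>v 4\<close> has only these two null
    lines, and the product -1 with \<open>v' 0\<close> excludes the first.\<close>
  have "c4 \<noteq> 0" using p'(21) a by (auto simp: c4_def qform_bilinear)
  moreover have "c0 * c4 = 0" using p'(25) unfolding eq by (simp add: qform_bilinear p)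
  ultimately show ?thesis using eq by (simp add: proj_pt_scaleR)
qed

lemma is_conjugate_point_eq:
  assumes M: "smooth_2_manifold M" and ad: "adapted3 M U \<phi> v \<omega> l" and u: "u \<in> U"
    and gen: "lam11 l u \<noteq> 0" "lam22 l u \<noteq> 0" and q: "is_conjugate_point M (\<phi> u) q"
  shows "q = proj_pt (v 4 u)"
proof -
  obtain U' \<phi>' v' \<omega>' l' u' where u': "u' \<in> U'" "\<phi> u = \<phi>' u'" and ad': "adapted3 M U' \<phi>' v' \<omega>' l'" and q: "q = proj_pt (v' 4 u')"
    using q unfolding is_conjugate_point_def by metis
  have a1: "adapted1 M U \<phi> v \<omega>" "adapted1 M U' \<phi>' v' \<omega>'" and l: "has_lambda U \<omega> l" "has_lambda U' \<omega>' l'"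
    and z: "\<And>u. u \<in> U \<Longrightarrow> lam12 l u = 0 \<and> (\<forall>h. be3 \<omega> u h = 0)"
    and z': "\<And>u. u \<in> U' \<Longrightarrow> lam12 l' u = 0 \<and> (\<forall>h. be3 \<omega>' u h = 0)"
    using ad ad' unfolding adapted3_def by blast+
  show ?thesis
  proof (rule adapted1_common_chart[OF M a1 l(2) u u'])
    fix W \<eta>
    assume W0: "open W" and W: "u \<in> W" "W \<subseteq> U" "\<eta> u = u'"
    and \<eta>: "\<And>w. w \<in> W \<Longrightarrow> \<eta> w \<in> U' \<and> \<phi>' (\<eta> w) = \<phi> w"
    and mf: "moving_frame W v" "moving_frame W (\<lambda>i w. v' i (\<eta> w))"
    and pt: "\<And>w. w \<in> W \<Longrightarrow> proj_pt (v' 0 (\<eta> w)) = proj_pt (v 0 w)"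
    and lW': "has_lambda W (structure_forms (\<lambda>i w. v' i (\<eta> w)))
      \<lparr>lam11 = \<lambda>w. lam11 l' (\<eta> w), lam12 = \<lambda>w. lam12 l' (\<eta> w), lam22 = \<lambda>w. lam22 l' (\<eta> w)\<rparr>"
    and b: "\<And>w h. w \<in> W \<Longrightarrow> be3 (structure_forms (\<lambda>i w. v' i (\<eta> w))) w h = be3 \<omega>' (\<eta> w) (D \<eta> w h)"
  have lW: "has_lambda W (structure_forms v) l"
    using l has_lambda_structure_forms[OF a1(1)] has_lambda_subset W(2) by blast
  have "proj_pt (v' 4 (\<eta> u)) = proj_pt (v 4 u)"
  proof (rule conjugate_point_unique[OF mf lW lW'])
    show "be3 (structure_forms v) u h = 0" for h
      using z[OF u] adapted1_structure_forms(9)[OF a1(1) u] by simp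
    show "be3 (structure_forms (\<lambda>i w. v' i (\<eta> w))) u h = 0" for h
      using b[OF W(1)] z' u' W(3) by simp
  qed (use W pt z z' \<eta> gen in auto)
  then show ?thesis using q W(3) by simp
  qed
qed

section \<open>Normalized frames\<close>

text \<open>The changes of frame used for normalizing: scalings by \<open>a\<close> and
  \<open>b\<close>, and shifts of \<open>v 1\<close>, \<open>v 2\<close>, \<open>v 3\<close> along
  \<open>v 0\<close>. The last vector is dictated by the required products.\<close>

lemma hyperbolic_frame_change:
  assumes "hyperbolic_frame v" "a \<noteq> 0" "b \<noteq> 0"
  shows "hyperbolic_frame (\<lambda>i::5. if i = 0 then a *\<^sub>R v 0 else if i = 1 then b *\<^sub>R v 1 + c *\<^sub>R v 0
    else if i = 2 then inverse b *\<^sub>R v 2 + e *\<^sub>R v 0 else if i = 3 then v 3 + f *\<^sub>R v 0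
    else inverse a *\<^sub>R (v 4 + (e * b) *\<^sub>R v 1 + (c * inverse b) *\<^sub>R v 2 - (f / 2) *\<^sub>R v 3 + (e * c - f * f / 4) *\<^sub>R v 0))"
  by (rule hyperbolic_frameI)
    (use assms(2,3) in \<open>simp_all add: qform_bilinear hyperbolic_frame_products[OF assms(1)] field_simps\<close>)

lemma has_lambda_smooth:
  assumes mf: "moving_frame U v" and l: "has_lambda U (structure_forms v) l"
  shows "smooth_on U (lam11 l)" "smooth_on U (lam12 l)" "smooth_on U (lam22 l)"
proof -
  define \<omega> where "\<omega> = structure_forms v"
  have U: "open U" and sm: "smooth_on U (v i)" for i using mf by (auto simp: moving_frame_def)
  have al: "smooth_on U (\<lambda>u. al12 \<omega> u (X u))" "smooth_on U (\<lambda>u. al21 \<omega> u (X u))" if "smooth_on U X" for X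
    using smooth_on_divide[OF U smooth_on_qform[OF U smooth_on_D_apply[OF U sm that] sm] _ smooth_on_const[of U 2]]
    by (simp_all add: \<omega>_def structure_forms_def)
  have "smooth_on U (lam11 l) \<and> smooth_on U (lam12 l) \<and> smooth_on U (lam22 l)"
  proof (rule moving_frame_dual[OF mf])
    fix X Y
    assume sX: "smooth_on U X" and sY: "smooth_on U Y" and
      "\<And>u. u \<in> U \<Longrightarrow> th1 (structure_forms v) u (X u) = 1"
      "\<And>u. u \<in> U \<Longrightarrow> th2 (structure_forms v) u (X u) = 0"
      "\<And>u. u \<in> U \<Longrightarrow> th1 (structure_forms v) u (Y u) = 0"
      "\<And>u. u \<in> U \<Longrightarrow> th2 (structure_forms v) u (Y u) = 1"
    then have "al12 \<omega> u (X u) = lam11 l u" "al12 \<omega> u (Y u) = lam12 l u" "al21 \<omega> u (Y u) = lam22 l u"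
      if "u \<in> U" for u
      using l that by (auto simp: has_lambda_def \<omega>_def)
    then show ?thesis
      using smooth_on_cong[OF U _ al(1)[OF sX], of "lam11 l"] smooth_on_cong[OF U _ al(1)[OF sY], of "lam12 l"]
        smooth_on_cong[OF U _ al(2)[OF sY], of "lam22 l"] by blast
  qed
  then show "smooth_on U (lam11 l)" "smooth_on U (lam12 l)" "smooth_on U (lam22 l)" by auto
qed

lemma open_Collect_pos:
  fixes f :: "'a::topological_space \<Rightarrow> real"
  assumes "open U" "continuous_on U f"
  shows "open {w \<in> U. f w > 0}"
proof -
  have "open (U \<inter> f -` {0<..})"
    by (intro continuous_open_preimage assms open_greaterThan)
  moreover have "U \<inter> f -` {0<..} = {w \<in> U. f w > 0}" by auto
  ultimately show ?thesis by simp
qed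

text \<open>Three independent corrections: \<open>f\<close> replaces \<open>v 3\<close> by the
  central vector \<open>z\<close>, which kills \<open>lam12\<close>; the scalings \<open>a\<close>
  and \<open>b\<close> bring \<open>lam11\<close> and \<open>lam22\<close> to 1 and \<epsilon>; the
  shifts \<open>c\<close> and \<open>e\<close> remove \<open>be3\<close>.\<close>

lemma moving_frame_normalize:
  assumes mf: "moving_frame U v" and l: "has_lambda U (structure_forms v) l"
    and u: "u \<in> U" and gen: "lam11 l u * lam22 l u \<noteq> 0"
  shows "\<exists>W v' l'. u \<in> W \<and> W \<subseteq> U \<and> moving_frame W v' \<and> has_lambda W (structure_forms v') l' \<and>
    (\<forall>w\<in>W. proj_pt (v' 0 w) = proj_pt (v 0 w) \<and> lam11 l' w = 1 \<and> lam12 l' w = 0 \<and>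
       lam22 l' w = sgn (lam11 l u * lam22 l u) \<and> (\<forall>h. be3 (structure_forms v') w h = 0))"
proof (rule moving_frame_dual[OF mf])
  fix X Y
  define \<omega> where "\<omega> = structure_forms v"
  assume sX: "smooth_on U X" and sY: "smooth_on U Y"
    and "\<And>w. w \<in> U \<Longrightarrow> th1 (structure_forms v) w (X w) = 1"
      "\<And>w. w \<in> U \<Longrightarrow> th2 (structure_forms v) w (X w) = 0"
      "\<And>w. w \<in> U \<Longrightarrow> th1 (structure_forms v) w (Y w) = 0"
      "\<And>w. w \<in> U \<Longrightarrow> th2 (structure_forms v) w (Y w) = 1"
    and XY: "\<And>w x. w \<in> U \<Longrightarrow> x = th1 (structure_forms v) w x *\<^sub>R X w + th2 (structure_forms v) w x *\<^sub>R Y w"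
  then have X: "th1 \<omega> w (X w) = 1" "th2 \<omega> w (X w) = 0" "th1 \<omega> w (Y w) = 0" "th2 \<omega> w (Y w) = 1" if "w \<in> U" for w
    using that by (auto simp: \<omega>_def)
  have U: "open U" and sm: "smooth_on U (v i)" for i using mf by (auto simp: moving_frame_def)
  note sl = has_lambda_smooth[OF mf l]
  define l1 l2 where "l1 = lam11 l" and "l2 = lam22 l"
  define \<epsilon> where "\<epsilon> = sgn (l1 u * l2 u)"
  \<comment> \<open>On \<open>W\<close> both coefficients keep the sign they have at
    \<open>u\<close>, so that \<epsilon> is constant and the roots below are smooth.\<close>
  define W where "W = {w \<in> U. l1 w * l1 u > 0} \<inter> {w \<in> U. l2 w * l2 u > 0}"
  define z where "z w = v 3 w + (2 * lam12 l w) *\<^sub>R v 0 w" for w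
  \<comment> \<open>The component of dz along \<open>v 0\<close>, which the shifts \<open>c\<close>
    and \<open>e\<close> have to absorb.\<close>
  define g where "g w h = - qform (D z w h) (v 4 w)" for w h
  \<comment> \<open>The change of frame turns \<open>l1\<close> into \<open>b^2 l1 / a\<close> and
    \<open>l2\<close> into \<open>l2 / (a b^2)\<close>. Setting these equal to 1 and \<epsilon>
    gives \<open>a^2 = \<epsilon> l1 l2\<close> and \<open>b^2 = a / l1\<close>; giving
    \<open>a\<close> the sign of \<open>l1\<close> makes the second root real.\<close>
  define a where "a w = sgn (l1 u) * sqrt (\<epsilon> * (l1 w * l2 w))" for w
  define b where "b w = sqrt (a w / l1 w)" for w
  \<comment> \<open>The values of \<open>c\<close> and \<open>e\<close> make
    \<open>D z w (Y w)\<close> a multiple of \<open>v' 1 w\<close> and \<open>D z w (X w)\<close> a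
    multiple of \<open>v' 2 w\<close>.\<close>
  define c where "c w = - b w * g w (Y w) / (2 * l2 w)" for w
  define e where "e w = - g w (X w) / (2 * l1 w * b w)" for w
  define f where "f w = 2 * lam12 l w" for w
  define v' where "v' i w = (if i = 0 then a w *\<^sub>R v 0 w else if i = 1 then b w *\<^sub>R v 1 w + c w *\<^sub>R v 0 w
    else if i = 2 then inverse (b w) *\<^sub>R v 2 w + e w *\<^sub>R v 0 w else if i = 3 then v 3 w + f w *\<^sub>R v 0 w
    else inverse (a w) *\<^sub>R (v 4 w + (e w * b w) *\<^sub>R v 1 w + (c w * inverse (b w)) *\<^sub>R v 2 w - (f w / 2) *\<^sub>R v 3 w
      + (e w * c w - f w * f w / 4) *\<^sub>R v 0 w))" for i :: 5 and w
  have sl': "smooth_on U l1" "smooth_on U l2" using sl by (simp_all add: l1_def l2_def)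
  have gu: "l1 u \<noteq> 0" "l2 u \<noteq> 0" using gen by (auto simp: l1_def l2_def)
  have W: "open W" "W \<subseteq> U" "u \<in> W"
  proof -
    have "open {w \<in> U. l1 w * l1 u > 0}" "open {w \<in> U. l2 w * l2 u > 0}"
      by (intro open_Collect_pos U continuous_on_mult_right smooth_on_imp_continuous_on sl')+
    then show "open W" by (auto simp: W_def)
    show "W \<subseteq> U" by (auto simp: W_def)
    show "u \<in> W" using u gu by (auto simp: W_def zero_less_mult_iff)
  qed
  have pos: "l1 w \<noteq> 0" "l2 w \<noteq> 0" "\<epsilon> * (l1 w * l2 w) > 0" "a w / l1 w > 0" "a w \<noteq> 0" "b w > 0"
    "b w * b w * l1 w = a w" "\<epsilon> * a w * (b w * b w) = l2 w" if w: "w \<in> W" for w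
  proof -
    have 1: "l1 w * l1 u > 0" "l2 w * l2 u > 0" using w by (auto simp: W_def)
    then show n: "l1 w \<noteq> 0" "l2 w \<noteq> 0" by auto
    show p: "\<epsilon> * (l1 w * l2 w) > 0"
      using 1 unfolding \<epsilon>_def by (auto simp: sgn_mult zero_less_mult_iff sgn_if mult_less_0_iff)
    show q: "a w / l1 w > 0"
      using p 1(1) unfolding a_def by (auto simp: zero_less_divide_iff zero_less_mult_iff sgn_if split: if_splits)
    show "a w \<noteq> 0" using q by auto
    show "b w > 0" using q by (simp add: b_def)
    have bb: "b w * b w = a w / l1 w" by (simp only: b_def real_sqrt_mult_self abs_of_pos[OF q])
    then show "b w * b w * l1 w = a w" using n by simp
    have "sgn (l1 u) * sgn (l1 u) = 1" using gu by (simp add: sgn_if)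
    moreover have "sqrt (\<epsilon> * (l1 w * l2 w)) * sqrt (\<epsilon> * (l1 w * l2 w)) = \<epsilon> * (l1 w * l2 w)"
      by (simp only: real_sqrt_mult_self abs_of_pos[OF p])
    moreover have "a w * a w = (sgn (l1 u) * sgn (l1 u)) * (sqrt (\<epsilon> * (l1 w * l2 w)) * sqrt (\<epsilon> * (l1 w * l2 w)))"
      by (simp only: a_def mult_ac)
    ultimately have aa: "a w * a w = \<epsilon> * (l1 w * l2 w)" by simp
    have ee: "\<epsilon> * \<epsilon> = 1" using gu by (simp add: \<epsilon>_def sgn_if)
    have "\<epsilon> * a w * (b w * b w) = \<epsilon> * (a w * a w) / l1 w" by (simp add: bb)
    also have "\<dots> = (\<epsilon> * \<epsilon>) * l2 w" using n by (simp add: aa)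
    finally show "\<epsilon> * a w * (b w * b w) = l2 w" by (simp add: ee)
  qed
  have smz: "smooth_on U z" unfolding z_def by (intro smooth_on_add smooth_on_scaleR smooth_on_mult U sm sl smooth_on_const)
  have WS: "smooth_on W (v i)" "smooth_on W l1" "smooth_on W l2" "smooth_on W f" for i
    using smooth_on_subset[OF _ W(2)] sm sl' smooth_on_mult[OF U smooth_on_const[of U 2] sl(2)] by (auto simp: f_def[abs_def])
  have sma: "smooth_on W a" unfolding a_def
    by (intro smooth_on_mult smooth_on_sqrt W WS smooth_on_const pos)
  have smb: "smooth_on W b" unfolding b_def
    by (intro smooth_on_divide smooth_on_sqrt W WS sma pos)
  have smg: "smooth_on W (\<lambda>w. g w (X w))" "smooth_on W (\<lambda>w. g w (Y w))"
    unfolding g_def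
    by (rule smooth_on_subset[OF _ W(2)], intro smooth_on_uminus smooth_on_qform smooth_on_D_apply U smz sX sY sm)+
  have b0: "b w \<noteq> 0" if "w \<in> W" for w using pos(6)[OF that] by simp
  have smc: "smooth_on W c" unfolding c_def
    by (intro smooth_on_divide smooth_on_mult smooth_on_uminus smg W smb WS smooth_on_const) (use pos in auto)
  have sme: "smooth_on W e" unfolding e_def
    by (intro smooth_on_divide smooth_on_mult smooth_on_uminus smg W smb WS smooth_on_const) (use pos b0 in auto)
  have smi: "smooth_on W (\<lambda>w. inverse (a w))" "smooth_on W (\<lambda>w. inverse (b w))"
    by (intro smooth_on_inverse W sma smb pos b0; assumption)+
  have smv': "smooth_on W (v' i)" for i
  proof -
    have "\<forall>i. smooth_on W (v' i)"
      unfolding forall_5 v'_def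
      by (simp; intro conjI smooth_on_add smooth_on_diff smooth_on_scaleR smooth_on_mult smooth_on_divide smi sma smb smc sme WS W smooth_on_const) auto
    then show ?thesis by blast
  qed
  have fr: "hyperbolic_frame (\<lambda>i. v' i w)" if w: "w \<in> W" for w
    unfolding v'_def
    using hyperbolic_frame_change[of "\<lambda>i. v i w" "a w" "b w" "c w" "e w" "f w"] pos(5)[OF w] b0[OF w] mf W(2) w
    by (auto simp: moving_frame_def)
  \<comment> \<open>The term \<open>2 * lam12 l w\<close> times the derivative of \<open>v 0\<close>
    cancels the \<open>lam12\<close> parts of the derivative of \<open>v 3\<close>.\<close>
  have Dz: "D z w h = g w h *\<^sub>R v 0 w - (2 * l2 w * th2 \<omega> w h) *\<^sub>R v 1 w - (2 * l1 w * th1 \<omega> w h) *\<^sub>R v 2 w"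
    if w: "w \<in> U" for w h
  proof -
    note p = moving_frame_products[OF mf w]
    have fw: "hyperbolic_frame (\<lambda>i. v i w)" using mf w by (simp add: moving_frame_def)
    have sf: "smooth_on U (\<lambda>w. 2 * lam12 l w)" by (intro smooth_on_mult U sl smooth_on_const)
    have lam: "al12 \<omega> w h = lam11 l w * th1 \<omega> w h + lam12 l w * th2 \<omega> w h"
      "al21 \<omega> w h = lam12 l w * th1 \<omega> w h + lam22 l w * th2 \<omega> w h"
      using l w by (auto simp: has_lambda_def \<omega>_def)
    have "D z w h = D (v 3) w h + ((2 * lam12 l w) *\<^sub>R D (v 0) w h + D (\<lambda>w. 2 * lam12 l w) w h *\<^sub>R v 0 w)"
      unfolding z_def
      by (subst D_add) (simp_all add: smooth_on_imp_differentiable[OF _ w] sm smooth_on_scaleR[OF U sf sm]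
          D_scaleR[OF smooth_on_imp_differentiable[OF sf w] smooth_on_imp_differentiable[OF sm w]])
    then have eq: "D z w h = D (v 3) w h + (2 * lam12 l w) *\<^sub>R D (v 0) w h + D (\<lambda>w. 2 * lam12 l w) w h *\<^sub>R v 0 w"
      by simp
    have "qform (D z w h) (v 0 w) = 0" "qform (D z w h) (v 1 w) = - 2 * l1 w * th1 \<omega> w h"
      "qform (D z w h) (v 2 w) = - 2 * l2 w * th2 \<omega> w h" "qform (D z w h) (v 3 w) = 0"
      unfolding eq moving_frame_D[OF mf w]
      by (simp_all add: qform_bilinear p lam[unfolded \<omega>_def] l1_def l2_def \<omega>_def algebra_simps)
    then show ?thesis
      by (intro frame_ext[OF fw]) (simp_all add: qform_bilinear p g_def)
  qed
  have v'i: "v' 0 w = a w *\<^sub>R v 0 w" "v' 1 w = b w *\<^sub>R v 1 w + c w *\<^sub>R v 0 w"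
      "v' 2 w = inverse (b w) *\<^sub>R v 2 w + e w *\<^sub>R v 0 w" "v' 3 w = z w" for w
    by (simp_all add: v'_def z_def f_def)
  have v3: "v' 3 = z" using v'i(4) by blast
  have DzX: "D z w (X w) = (- 2 * l1 w * b w) *\<^sub>R v' 2 w" "D z w (Y w) = (- (2 * l2 w / b w)) *\<^sub>R v' 1 w" if w: "w \<in> W" for w
  proof -
    have wU: "w \<in> U" using w W by auto
    note fw = pos(1,2)[OF w] b0[OF w]
    show "D z w (X w) = (- 2 * l1 w * b w) *\<^sub>R v' 2 w"
      using fw unfolding Dz[OF wU] X[OF wU] v'i e_def by (simp add: algebra_simps)
    show "D z w (Y w) = (- (2 * l2 w / b w)) *\<^sub>R v' 1 w"
      using fw unfolding Dz[OF wU] X[OF wU] v'i c_def by (simp add: algebra_simps)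
  qed
  have th': "th1 (structure_forms v') w h = a w * inverse (b w) * th1 \<omega> w h"
    "th2 (structure_forms v') w h = a w * b w * th2 \<omega> w h" 
    "qform (D (v' 0) w h) (v' 3 w) = 0" if w: "w \<in> W" for w h
  proof -
    have wU: "w \<in> U" using w W by auto
    have "v' 0 = (\<lambda>w. a w *\<^sub>R v 0 w)" using v'i(1) by blast
    then have D0: "D (v' 0) w h = a w *\<^sub>R D (v 0) w h + D a w h *\<^sub>R v 0 w"
      using D_scaleR[of a w "v 0" h] by (simp add: smooth_on_imp_differentiable[OF _ w] sma WS)
    note s = qform_bilinear moving_frame_products[OF mf wU]
    show "th1 (structure_forms v') w h = a w * inverse (b w) * th1 \<omega> w h"
      "th2 (structure_forms v') w h = a w * b w * th2 \<omega> w h"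
      unfolding structure_forms_def[of v'] frame_forms.simps D0 moving_frame_D[OF mf wU] v'i
      by (simp_all add: s \<omega>_def)
    show "qform (D (v' 0) w h) (v' 3 w) = 0"
      unfolding D0 moving_frame_D[OF mf wU] v'i z_def by (simp add: s)
  qed
  have mf': "moving_frame W v'"
    unfolding moving_frame_def
  proof (intro conjI ballI allI W smv' fr)
    fix w assume w: "w \<in> W"
    then have wU: "w \<in> U" using W by auto
    have "wedge (th1 (structure_forms v')) (th2 (structure_forms v')) w (X w) (Y w) = a w * a w"
      using pos(5)[OF w] b0[OF w] by (simp add: wedge_def th'[OF w] X[OF wU])
    then show "\<exists>h k. wedge (th1 (structure_forms v')) (th2 (structure_forms v')) w h k \<noteq> 0"
      using pos(5)[OF w] by (metis mult_eq_0_iff)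
  qed (use th' in auto)
  have al': "al12 (structure_forms v') w h = b w * l1 w * th1 \<omega> w h"
    "al21 (structure_forms v') w h = inverse (b w) * l2 w * th2 \<omega> w h" if w: "w \<in> W" for w h
  proof -
    have wU: "w \<in> U" using w W by auto
    note s = qform_bilinear moving_frame_products[OF mf wU]
    \<comment> \<open>Moving the derivative to \<open>v' 3\<close>, which is \<open>z\<close>,
      avoids the derivatives of \<open>b\<close>, \<open>c\<close> and \<open>e\<close>.\<close>
    have "qform (D (v' 1) w h) (v' 3 w) = - qform (v' 1 w) (D z w h)"
      "qform (D (v' 2) w h) (v' 3 w) = - qform (v' 2 w) (D z w h)"
      using moving_frame_compat[OF mf' w, of 1 h 3] moving_frame_compat[OF mf' w, of 2 h 3] by (simp_all only: v3)
    then show "al12 (structure_forms v') w h = b w * l1 w * th1 \<omega> w h"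
      "al21 (structure_forms v') w h = inverse (b w) * l2 w * th2 \<omega> w h"
      unfolding structure_forms_def[of v'] frame_forms.simps Dz[OF wU] v'i(2,3)
      by (simp_all add: s)
  qed
  define l' where "l' = \<lparr>lam11 = \<lambda>w::real^2. 1, lam12 = \<lambda>w::real^2. 0, lam22 = \<lambda>w::real^2. \<epsilon>\<rparr>"
  have hl: "has_lambda W (structure_forms v') l'"
    unfolding has_lambda_def
  proof (intro ballI allI)
    fix w h assume w: "w \<in> W"
    have 1: "b w * l1 w = a w * inverse (b w)" "inverse (b w) * l2 w = \<epsilon> * (a w * b w)"
      using pos(7,8)[OF w] b0[OF w] by (auto simp: field_simps)
    show "al12 (structure_forms v') w h = lam11 l' w * th1 (structure_forms v') w h + lam12 l' w * th2 (structure_forms v') w h \<and>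
      al21 (structure_forms v') w h = lam12 l' w * th1 (structure_forms v') w h + lam22 l' w * th2 (structure_forms v') w h"
      unfolding al'[OF w] th'[OF w] 1 by (simp add: l'_def)
  qed
  have be3': "be3 (structure_forms v') w h = 0" if w: "w \<in> W" for w h
  proof -
    have wU: "w \<in> U" using w W by auto
    \<comment> \<open>By linearity every derivative of \<open>z\<close> is a combination of
      \<open>v' 1\<close> and \<open>v' 2\<close>, both orthogonal to \<open>v' 4\<close>.\<close>
    have "D z w h = D z w (th1 \<omega> w h *\<^sub>R X w + th2 \<omega> w h *\<^sub>R Y w)" using XY[OF wU, of h] by (simp add: \<omega>_def)
    also have "\<dots> = th1 \<omega> w h *\<^sub>R D z w (X w) + th2 \<omega> w h *\<^sub>R D z w (Y w)"
      using linear_D[OF smz wU] by (simp add: linear_add linear_scale)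
    finally have "qform (D (v' 3) w h) (v' 4 w) = 0"
      unfolding v3 DzX[OF w] by (simp add: qform_bilinear moving_frame_products[OF mf' w])
    then show ?thesis by (simp add: structure_forms_def)
  qed
  show ?thesis
  proof (intro exI conjI ballI allI)
    show "lam22 l' w = sgn (lam11 l u * lam22 l u)" "lam11 l' w = 1" "lam12 l' w = 0" for w
      by (simp_all add: l'_def \<epsilon>_def l1_def l2_def)
    show "proj_pt (v' 0 w) = proj_pt (v 0 w)" if "w \<in> W" for w
      using pos(5)[OF that] by (simp add: v'i proj_pt_scaleR)
  qed (use W mf' hl be3' in auto)
qed

lemma normalized3_exists:
  assumes M: "two_generic M" and p: "p \<in> topspace (manifold M)"
  shows "\<exists>U \<phi> v \<omega> l \<epsilon>. \<exists>u\<in>U. normalized3 M U \<phi> v \<omega> l \<epsilon> \<and> \<phi> u = p"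
proof -
  obtain U \<phi> v \<omega> l u where u: "u \<in> U" "\<phi> u = p" and ad: "adapted1 M U \<phi> v \<omega>" and l: "has_lambda U \<omega> l"
    and gen: "lam11 l u * lam22 l u \<noteq> 0"
    using M p unfolding two_generic_def by blast
  have mf: "moving_frame U v" and pa: "patch M U \<phi>" and im: "\<And>w. w \<in> U \<Longrightarrow> imm M (\<phi> w) = proj_pt (v 0 w)"
    using ad by (auto simp: adapted1_iff)
  obtain W v' l' where W: "u \<in> W" "W \<subseteq> U" and mf': "moving_frame W v'" and l': "has_lambda W (structure_forms v') l'"
    and n: "\<forall>w\<in>W. proj_pt (v' 0 w) = proj_pt (v 0 w) \<and> lam11 l' w = 1 \<and> lam12 l' w = 0 \<and>
       lam22 l' w = sgn (lam11 l u * lam22 l u) \<and> (\<forall>h. be3 (structure_forms v') w h = 0)"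
    using moving_frame_normalize[OF mf _ u(1) gen] l has_lambda_structure_forms[OF ad] by blast
  have "open W" using mf' by (simp add: moving_frame_def)
  then have "patch M W \<phi>" using pa W(2) unfolding patch_def by blast
  then have "adapted1 M W \<phi> v' (structure_forms v')"
    using mf' im n W(2) by (intro adapted1I) auto
  then have "normalized3 M W \<phi> v' (structure_forms v') l' (\<lambda>w. sgn (lam11 l u * lam22 l u))"
    using M l' n gen by (auto simp: normalized3_def adapted3_def sgn_mult sgn_eq_0_iff)
  then show ?thesis using u W by blast
qed

section \<open>The conjugate manifold\<close>

text \<open>In the coframe the metric is twice the product of \<open>th1\<close> and
  \<open>th2\<close>, so a vector is null exactly if one of the two forms vanishes on it; the two
  kernels are spanned by \<open>Y\<close> and \<open>X\<close>.\<close>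

lemma card_null_lines_moving_frame:
  assumes mf: "moving_frame U v" and u: "u \<in> U"
  shows "card (null_lines (v 0) u) = 2"
proof (rule moving_frame_dual_at[OF mf u])
  fix X Y
  define \<omega> where "\<omega> = structure_forms v"
  assume "th1 (structure_forms v) u X = 1" "th2 (structure_forms v) u X = 0"
    "th1 (structure_forms v) u Y = 0" "th2 (structure_forms v) u Y = 1"
    and "\<And>x. x = th1 (structure_forms v) u x *\<^sub>R X + th2 (structure_forms v) u x *\<^sub>R Y"
  then have X: "th1 \<omega> u X = 1" "th2 \<omega> u X = 0" "th1 \<omega> u Y = 0" "th2 \<omega> u Y = 1"
    and ex: "\<And>x. x = th1 \<omega> u x *\<^sub>R X + th2 \<omega> u x *\<^sub>R Y" by (simp_all add: \<omega>_def)
  have lin: "linear (th1 \<omega> u)" "linear (th2 \<omega> u)" using moving_frame_th(3,4)[OF mf u] by (simp_all add: \<omega>_def)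
  have q: "qform (D (v 0) u h) (D (v 0) u h) = 2 * (th1 \<omega> u h * th2 \<omega> u h)" for h
    unfolding moving_frame_D[OF mf u] by (simp add: qform_bilinear moving_frame_products[OF mf u] \<omega>_def)
  have span1: "span {c *\<^sub>R x} = span {x}" if "c \<noteq> 0" for c and x :: "real^2"
    using that by (simp add: span_eq span_scale span_base)
      (metis divideR_right singletonI span_base span_scale)
  have nz: "X \<noteq> 0" "Y \<noteq> 0" using X lin by (auto simp: linear_0)
  have "null_lines (v 0) u = {span {X}, span {Y}}"
  proof (intro equalityI subsetI)
    fix L assume "L \<in> null_lines (v 0) u"
    then obtain h where h: "L = span {h}" "h \<noteq> 0" "th1 \<omega> u h = 0 \<or> th2 \<omega> u h = 0"
      by (auto simp: null_lines_def q)
    from h(3) show "L \<in> {span {X}, span {Y}}"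
    proof
      assume 0: "th1 \<omega> u h = 0"
      then have "h = th2 \<omega> u h *\<^sub>R Y" using ex[of h] by simp
      then show ?thesis using span1[of "th2 \<omega> u h" Y] h by (metis insertCI scaleR_zero_left)
    next
      assume 0: "th2 \<omega> u h = 0"
      then have "h = th1 \<omega> u h *\<^sub>R X" using ex[of h] by simp
      then show ?thesis using span1[of "th1 \<omega> u h" X] h by (metis insertCI scaleR_zero_left)
    qed
  next
    fix L assume "L \<in> {span {X}, span {Y}}"
    then show "L \<in> null_lines (v 0) u" using nz X by (auto simp: null_lines_def q)
  qed
  moreover have "span {X} \<noteq> span {Y}"
  proof
    assume "span {X} = span {Y}"
    then have "X \<in> span {Y}" using span_base[of X "{X}"] by simp
    then obtain k where "X = k *\<^sub>R Y" by (auto simp: span_singleton)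
    then have "th1 \<omega> u X = k * th1 \<omega> u Y" using lin by (simp add: linear_scale)
    then show False using X by simp
  qed
  ultimately show ?thesis by simp
qed

lemma conjugate_manifold_simps [simp]:
  "manifold (conjugate_manifold M) = manifold M" "charts (conjugate_manifold M) = charts M"
  "patch (conjugate_manifold M) = patch M"
  "smooth_2_manifold (conjugate_manifold M) = smooth_2_manifold M"
  by (simp_all add: conjugate_manifold_def patch_def[abs_def] smooth_2_manifold_def)

lemma patch_image_topspace:
  assumes "smooth_2_manifold M" "patch M U \<phi>" "u \<in> U"
  shows "\<phi> u \<in> topspace (manifold M)"
proof -
  obtain U0 where U0: "(U0, \<phi>) \<in> charts M" "U \<subseteq> U0" using assms by (auto simp: patch_def)
  have "(\<Union>(U, \<phi>) \<in> charts M. \<phi> ` U) = topspace (manifold M)"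
    using assms(1) by (simp add: smooth_2_manifold_def)
  then show ?thesis using U0 assms(3) by blast
qed

lemma normalized3D:
  assumes "normalized3 M U \<phi> v \<omega> l \<epsilon>"
  shows "adapted3 M U \<phi> v \<omega> l" "adapted1 M U \<phi> v \<omega>" "patch M U \<phi>" "moving_frame U v"
    "has_lambda U (structure_forms v) l" "has_lambda U \<omega> l"
    "\<And>u. u \<in> U \<Longrightarrow> imm M (\<phi> u) = proj_pt (v 0 u)"
    "\<And>u. u \<in> U \<Longrightarrow> lam11 l u = 1" "\<And>u. u \<in> U \<Longrightarrow> lam12 l u = 0"
    "\<And>u. u \<in> U \<Longrightarrow> lam22 l u = \<epsilon> u" "\<And>u. u \<in> U \<Longrightarrow> \<epsilon> u \<noteq> 0"
    "\<And>u h. u \<in> U \<Longrightarrow> be3 (structure_forms v) u h = 0"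
proof -
  show a3: "adapted3 M U \<phi> v \<omega> l" and n: "\<And>u. u \<in> U \<Longrightarrow> lam11 l u = 1" "\<And>u. u \<in> U \<Longrightarrow> lam22 l u = \<epsilon> u"
    using assms unfolding normalized3_def by blast+
  show "\<epsilon> u \<noteq> 0" if "u \<in> U" for u
  proof -
    have "lam11 l u * lam22 l u \<noteq> 0" "\<epsilon> u = sgn (lam11 l u * lam22 l u)"
      using assms that unfolding normalized3_def by blast+
    then show ?thesis by (metis sgn_eq_0_iff)
  qed
  show a1: "adapted1 M U \<phi> v \<omega>" and l: "has_lambda U \<omega> l" and "\<And>u. u \<in> U \<Longrightarrow> lam12 l u = 0"
    using a3 unfolding adapted3_def by blast+
  show "patch M U \<phi>" "moving_frame U v" "\<And>u. u \<in> U \<Longrightarrow> imm M (\<phi> u) = proj_pt (v 0 u)"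
    using a1 unfolding adapted1_iff by blast+
  show "has_lambda U (structure_forms v) l"
    using l has_lambda_structure_forms[OF a1, of l] by simp
  show "be3 (structure_forms v) u h = 0" if "u \<in> U" for u h
  proof -
    have "be3 \<omega> u h = 0" using a3 that unfolding adapted3_def by blast
    then show ?thesis by (simp add: adapted1_structure_forms(9)[OF a1 that])
  qed
qed

text \<open>A normalized frame has \<open>lam11\<close> = 1 and \<open>lam22\<close> = \<epsilon>,
  both nonzero, so it is a reference frame for the uniqueness of the conjugate point.\<close>

lemma imm_conjugate_manifold:
  assumes M: "smooth_2_manifold M" and n: "normalized3 M U \<phi> v \<omega> l \<epsilon>" and u: "u \<in> U"
  shows "imm (conjugate_manifold M) (\<phi> u) = proj_pt (v 4 u)"
proof -
  have "(THE q. is_conjugate_point M (\<phi> u) q) = proj_pt (v 4 u)"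
  proof (rule the_equality)
    show "is_conjugate_point M (\<phi> u) (proj_pt (v 4 u))"
      using normalized3D(1)[OF n] u unfolding is_conjugate_point_def by blast
    show "q = proj_pt (v 4 u)" if "is_conjugate_point M (\<phi> u) q" for q
      using is_conjugate_point_eq[OF M normalized3D(1)[OF n] u _ _ that] normalized3D(8,10,11)[OF n u] by simp
  qed
  then show ?thesis by (simp add: conjugate_manifold_def)
qed

text \<open>Because \<open>be3\<close> vanishes, the derivative of \<open>v 4\<close> modulo
  \<open>v 4\<close> has the coordinates \<open>be2\<close> and \<open>be1\<close>. If these were
  dependent, \<open>[v 4]\<close> would have rank at most 1.\<close>

lemma conjugate_wedge:
  assumes M: "smooth_2_manifold M" and rk: "conjugate_dim_eq M 2"
    and n: "normalized3 M U \<phi> v \<omega> l \<epsilon>" and u: "u \<in> U"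
  defines "\<sigma> \<equiv> structure_forms v"
  shows "\<exists>h k. wedge (be1 \<sigma>) (be2 \<sigma>) u h k \<noteq> 0"
proof (rule ccontr)
  assume "\<not> ?thesis"
  then have w0: "be1 \<sigma> u h * be2 \<sigma> u k = be1 \<sigma> u k * be2 \<sigma> u h" for h k
    by (simp add: wedge_def)
  note mf = normalized3D(4)[OF n] and pa = normalized3D(3)[OF n]
  have "\<exists>y. \<forall>h. D (v 4) u h \<in> span {v 4 u, y}"
  proof -
    \<comment> \<open>By \<open>w0\<close> the pairs of values of \<open>be1\<close> and
      \<open>be2\<close> lie on one line, spanned by the pair at any \<open>h0\<close> where it is
      nonzero.\<close>
    obtain h0 where h0: "\<And>h. \<exists>c. be1 \<sigma> u h = c * be1 \<sigma> u h0 \<and> be2 \<sigma> u h = c * be2 \<sigma> u h0"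
    proof (cases "\<exists>h0. be1 \<sigma> u h0 \<noteq> 0 \<or> be2 \<sigma> u h0 \<noteq> 0")
      case True
      then obtain h0 where "be1 \<sigma> u h0 \<noteq> 0 \<or> be2 \<sigma> u h0 \<noteq> 0" by blast
      then have "\<exists>c. be1 \<sigma> u h = c * be1 \<sigma> u h0 \<and> be2 \<sigma> u h = c * be2 \<sigma> u h0" for h
      proof
        assume "be1 \<sigma> u h0 \<noteq> 0"
        then show ?thesis using w0[of h0 h] by (intro exI[of _ "be1 \<sigma> u h / be1 \<sigma> u h0"]) (auto simp: field_simps)
      next
        assume "be2 \<sigma> u h0 \<noteq> 0"
        then show ?thesis using w0[of h0 h] by (intro exI[of _ "be2 \<sigma> u h / be2 \<sigma> u h0"]) (auto simp: field_simps)
      qed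
      then show ?thesis by (rule that)
    next
      case False
      then show ?thesis using that[of 0] by simp
    qed
    define y where "y = be2 \<sigma> u h0 *\<^sub>R v 1 u + be1 \<sigma> u h0 *\<^sub>R v 2 u"
    have "D (v 4) u h \<in> span {v 4 u, y}" for h
    proof -
      obtain c where c: "be1 \<sigma> u h = c * be1 \<sigma> u h0" "be2 \<sigma> u h = c * be2 \<sigma> u h0" using h0 by blast
      have "D (v 4) u h = c *\<^sub>R y - (al11 \<sigma> u h + al22 \<sigma> u h) *\<^sub>R v 4 u"
        using moving_frame_D(5)[OF mf u, of h] normalized3D(12)[OF n u, of h]
        by (simp add: y_def c[unfolded \<sigma>_def] \<sigma>_def scaleR_add_right)
      then show ?thesis by (simp add: span_diff span_scale span_base)
    qed
    then show ?thesis by blast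
  qed
  then obtain y where y: "\<And>h. D (v 4) u h \<in> span {v 4 u, y}" by blast
  have "\<phi> u \<in> topspace (manifold M)" by (rule patch_image_topspace[OF M pa u])
  then obtain U' \<phi>' z u' where z: "u' \<in> U'" "local_lift (conjugate_manifold M) U' \<phi>' z" "\<phi>' u' = \<phi> u"
    "dim (span (insert (z u') (range (D z u')))) = 3"
    using rk unfolding conjugate_dim_eq_def has_rank_at_def by fastforce
  then have pa': "patch M U' \<phi>'" and smz: "smooth_on U' z"
    and im: "\<And>w. w \<in> U' \<Longrightarrow> imm (conjugate_manifold M) (\<phi>' w) = proj_pt (z w)"
    by (auto simp: local_lift_def)
  show False
  proof (rule transition_map[OF M pa pa' u z(1) z(3)[symmetric]])
    fix W \<eta>
    assume W: "open W" "u \<in> W" "W \<subseteq> U" "smooth_on W \<eta>" "\<eta> u = u'"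
      and \<eta>: "\<And>w. w \<in> W \<Longrightarrow> \<eta> w \<in> U' \<and> \<phi>' (\<eta> w) = \<phi> w \<and> surj (D \<eta> w)"
    \<comment> \<open>The lift \<open>z\<close> that witnesses the rank may belong to another chart.
      After the transition it is a multiple of \<open>v 4\<close>; pairing with \<open>v 0\<close>
      shows that the factor is smooth, so \<open>z\<close> and its derivatives stay in the plane of
      \<open>v 4 u\<close> and \<open>y\<close>.\<close>
    define c where "c w = - qform (z (\<eta> w)) (v 0 w)" for w
    have U': "open U'" using pa' by (simp add: patch_def)
    have smv: "smooth_on W (v i)" for i
      using mf smooth_on_subset[OF _ W(3)] by (auto simp: moving_frame_def)
    have smz': "smooth_on W (\<lambda>w. z (\<eta> w))"
      using smooth_on_compose[where f = z and \<psi> = \<eta>, OF W(1) U' _ W(4) smz] \<eta> by blast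
    have smc: "smooth_on W c" unfolding c_def by (intro smooth_on_uminus smooth_on_qform W smz' smv)
    have zc: "z (\<eta> w) = c w *\<^sub>R v 4 w" if w: "w \<in> W" for w
    proof -
      have wU: "w \<in> U" using w W by blast
      have "proj_pt (z (\<eta> w)) = proj_pt (v 4 w)"
        using imm_conjugate_manifold[OF M n wU] im[of "\<eta> w"] \<eta>[OF w] by simp
      then obtain k where k: "z (\<eta> w) = k *\<^sub>R v 4 w" using proj_pt_eqD by blast
      then show ?thesis by (simp add: c_def qform_bilinear moving_frame_products[OF mf wU])
    qed
    have "D z u' k \<in> span {v 4 u, y}" for k
    proof -
      obtain h where h: "k = D \<eta> u h" using \<eta>[OF W(2)] by (metis surjD)
      have "D z u' k = D (\<lambda>w. z (\<eta> w)) u h"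
        using D_compose[OF W(4) smz W(2), of h] \<eta>[OF W(2)] by (simp add: h W(5))
      also have "\<dots> = D (\<lambda>w. c w *\<^sub>R v 4 w) u h"
        using D_cong_open[OF W(1,2), of "\<lambda>w. z (\<eta> w)" "\<lambda>w. c w *\<^sub>R v 4 w"] zc by simp
      also have "\<dots> = c u *\<^sub>R D (v 4) u h + D c u h *\<^sub>R v 4 u"
        by (rule D_scaleR) (rule smooth_on_imp_differentiable[OF _ W(2)], rule smc smv)+
      finally show ?thesis using y[of h] by (simp add: span_add span_scale span_base)
    qed
    moreover have "z u' \<in> span {v 4 u, y}"
      using zc[OF W(2)] by (simp add: W(5) span_scale span_base)
    ultimately have "insert (z u') (range (D z u')) \<subseteq> span {v 4 u, y}" by auto
    then have "dim (insert (z u') (range (D z u'))) \<le> card {v 4 u, y}"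
      by (rule dim_le_card) simp
    also have "\<dots> \<le> 2" by (simp add: card_insert_if)
    finally show False using z(4) by (simp add: dim_span)
  qed
qed

section \<open>The conjugate frame as a moving frame of the conjugate surface\<close>

definition conjugate_frame :: "(5 \<Rightarrow> real^2 \<Rightarrow> V) \<Rightarrow> 5 \<Rightarrow> real^2 \<Rightarrow> V" where
  "conjugate_frame v i = v (if i = 0 then 4 else if i = 4 then 0 else i)"

lemma conjugate_frame_simps [simp]:
  "conjugate_frame v 0 = v 4" "conjugate_frame v 1 = v 1" "conjugate_frame v 2 = v 2"
  "conjugate_frame v 3 = v 3" "conjugate_frame v 4 = v 0"
  by (simp_all add: conjugate_frame_def)

text \<open>Exchanging \<open>v 0\<close> and \<open>v 4\<close> preserves the Gram matrix and
  exchanges \<open>th1\<close> with \<open>be2\<close> and \<open>th2\<close> with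
  \<open>be1\<close>. The new \<open>be3\<close> is zero because \<open>v\<close> is 1-adapted;
  dually, \<open>be3\<close> = 0 for \<open>v\<close> makes the conjugate frame 1-adapted.\<close>

lemma structure_forms_conjugate_frame:
  assumes mf: "moving_frame U v" and u: "u \<in> U"
  shows "th1 (structure_forms (conjugate_frame v)) u h = be2 (structure_forms v) u h"
    "th2 (structure_forms (conjugate_frame v)) u h = be1 (structure_forms v) u h"
    "al12 (structure_forms (conjugate_frame v)) u h = al12 (structure_forms v) u h"
    "al21 (structure_forms (conjugate_frame v)) u h = al21 (structure_forms v) u h"
    "be3 (structure_forms (conjugate_frame v)) u h = 0"
  unfolding structure_forms_def[of "conjugate_frame v"] frame_forms.simps conjugate_frame_simps
    moving_frame_D[OF mf u]
  by (simp_all add: qform_bilinear moving_frame_products[OF mf u])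

lemma moving_frame_conjugate_frame:
  assumes M: "smooth_2_manifold M" and rk: "conjugate_dim_eq M 2"
    and n: "normalized3 M U \<phi> v \<omega> l \<epsilon>"
  shows "moving_frame U (conjugate_frame v)"
  unfolding moving_frame_def
proof (intro conjI allI ballI)
  note mf = normalized3D(4)[OF n]
  show "open U" "smooth_on U (conjugate_frame v i)" for i
    using mf by (auto simp: moving_frame_def conjugate_frame_def)
  fix u assume u: "u \<in> U"
  note p = moving_frame_products[OF mf u]
  show "hyperbolic_frame (\<lambda>i. conjugate_frame v i u)"
    by (rule hyperbolic_frameI) (simp_all add: p)
  show "qform (D (conjugate_frame v 0) u h) (conjugate_frame v 3 u) = 0" for h
    unfolding conjugate_frame_simps moving_frame_D(5)[OF mf u]
    using normalized3D(12)[OF n u, of h] by (simp add: qform_bilinear p)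
  obtain h k where "wedge (be1 (structure_forms v)) (be2 (structure_forms v)) u h k \<noteq> 0"
    using conjugate_wedge[OF M rk n u] by blast
  \<comment> \<open>The new coframe is \<open>be2\<close>, \<open>be1\<close> in this order, so the
    two vectors change places.\<close>
  then have "wedge (th1 (structure_forms (conjugate_frame v))) (th2 (structure_forms (conjugate_frame v))) u k h \<noteq> 0"
    by (simp add: wedge_def structure_forms_conjugate_frame[OF mf u] mult.commute)
  then show "\<exists>h k. wedge (th1 (structure_forms (conjugate_frame v))) (th2 (structure_forms (conjugate_frame v))) u h k \<noteq> 0"
    by blast
qed

lemma adapted1_conjugate_frame:
  assumes M: "smooth_2_manifold M" and rk: "conjugate_dim_eq M 2"
    and n: "normalized3 M U \<phi> v \<omega> l \<epsilon>"
  shows "adapted1 (conjugate_manifold M) U \<phi> (conjugate_frame v) (structure_forms (conjugate_frame v))"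
  using normalized3D(3)[OF n] moving_frame_conjugate_frame[OF assms] imm_conjugate_manifold[OF M n]
  by (intro adapted1I) auto

text \<open>The lift \<open>v 4\<close> is the leading vector of the conjugate frame, so its null
  lines are counted as for any moving frame.\<close>

lemma hyperbolic_conjugate_manifold:
  assumes M: "smooth_2_manifold M" and gen: "two_generic M" and rk: "conjugate_dim_eq M 2"
  shows "hyperbolic_surface (conjugate_manifold M)"
  unfolding hyperbolic_surface_def surface_in_quadric_def
proof (intro conjI ballI)
  fix p assume "p \<in> topspace (manifold (conjugate_manifold M))"
  then have p: "p \<in> topspace (manifold M)" by simp
  show "has_rank_at (conjugate_manifold M) p 2" using rk p by (simp add: conjugate_dim_eq_def)
  obtain U \<phi> v \<omega> l \<epsilon> u where u: "u \<in> U" "\<phi> u = p" and n: "normalized3 M U \<phi> v \<omega> l \<epsilon>"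
    using normalized3_exists[OF gen p] by blast
  note mf = moving_frame_conjugate_frame[OF M rk n]
  have nz: "v 4 w \<noteq> 0" if "w \<in> U" for w
    using moving_frame_products(21)[OF normalized3D(4)[OF n] that] by (auto simp: qform_bilinear)
  have "imm (conjugate_manifold M) p = proj_pt (v 4 u)" using imm_conjugate_manifold[OF M n u(1)] u(2) by simp
  then show "imm (conjugate_manifold M) p \<in> quadric"
    using nz[OF u(1)] moving_frame_products(25)[OF normalized3D(4)[OF n] u(1)] by (auto simp: quadric_def)
  have "smooth_on U (v 4)" using normalized3D(4)[OF n] by (simp add: moving_frame_def)
  then have "local_lift (conjugate_manifold M) U \<phi> (v 4)"
    using normalized3D(3)[OF n] nz imm_conjugate_manifold[OF M n] by (simp add: local_lift_def)
  moreover have "card (null_lines (v 4) u) = 2" using card_null_lines_moving_frame[OF mf u(1)] by simp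
  ultimately show "\<exists>U \<phi> z. \<exists>u\<in>U. local_lift (conjugate_manifold M) U \<phi> z \<and> \<phi> u = p \<and> card (null_lines z u) = 2"
    using u by blast
qed (use M in simp)

section \<open>Central spheres and \<tau> in terms of the conjugate frame\<close>

text \<open>The point \<open>[v 0]\<close> separates the spheres: it lies on the first one, while
  its product with \<open>v 3 + (2 * c) *\<^sub>R v 4\<close> is -2c.\<close>

lemma quadric_sphere_eq_iff:
  assumes "hyperbolic_frame v"
  shows "quadric_sphere (v 3) = quadric_sphere (v 3 + (2 * c) *\<^sub>R v 4) \<longleftrightarrow> c = 0"
proof
  note p = hyperbolic_frame_products[OF assms]
  have nz: "v 0 \<noteq> 0" using p(5) by (auto simp: qform_bilinear)
  assume eq: "quadric_sphere (v 3) = quadric_sphere (v 3 + (2 * c) *\<^sub>R v 4)"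
  have "proj_pt (v 0) \<in> quadric_sphere (v 3)"
    using nz p by (auto simp: quadric_sphere_def proj_space_def quadric_def)
  then have "proj_pt (v 0) \<in> quadric_sphere (v 3 + (2 * c) *\<^sub>R v 4)" using eq by simp
  then obtain x where x: "proj_pt (v 0) = proj_pt x" "x \<noteq> 0" "qform (v 3 + (2 * c) *\<^sub>R v 4) x = 0"
    by (auto simp: quadric_sphere_def proj_space_def)
  obtain k where k: "x = k *\<^sub>R v 0" using proj_pt_eqD[OF x(1)[symmetric]] by blast
  then have "k \<noteq> 0" using x by auto
  then show "c = 0" using x(3) by (simp add: k qform_bilinear p)
qed simp

lemma central_spheres_agree_at:
  assumes M: "smooth_2_manifold M" and rk: "conjugate_dim_eq M 2"
    and n: "normalized3 M U \<phi> v \<omega> l \<epsilon>" and u: "u \<in> U"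
    and l': "has_lambda U (structure_forms (conjugate_frame v)) l'"
  shows "central_tangent_sphere M (\<phi> u) = central_tangent_sphere (conjugate_manifold M) (\<phi> u) \<longleftrightarrow> lam12 l' u = 0"
proof -
  have "central_tangent_sphere M (\<phi> u) = quadric_sphere (v 3 u)"
    using central_tangent_sphere_eq[OF M normalized3D(2,6)[OF n] u] normalized3D(9)[OF n u] by simp
  moreover have "central_tangent_sphere (conjugate_manifold M) (\<phi> u) = quadric_sphere (v 3 u + (2 * lam12 l' u) *\<^sub>R v 4 u)"
    using central_tangent_sphere_eq[OF _ adapted1_conjugate_frame[OF M rk n] l' u] M by simp
  moreover have "hyperbolic_frame (\<lambda>i. v i u)" using normalized3D(4)[OF n] u by (simp add: moving_frame_def)
  ultimately show ?thesis using quadric_sphere_eq_iff[of "\<lambda>i. v i u"] by simp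
qed

text \<open>Cartan's lemma again, now for <dv_3, v_4> = 0, which is \<open>be3\<close> = 0. The
  symmetric product <dv_3(h), dv_4(k)> on the dual fields relates \<open>be2\<close> at
  \<open>Y\<close> to \<epsilon> times \<open>be1\<close> at \<open>X\<close>.\<close>

lemma normalized3_tau:
  assumes n: "normalized3 M U \<phi> v \<omega> l \<epsilon>"
  obtains \<tau> b12 b21 where
    "\<And>u h. u \<in> U \<Longrightarrow> be1 \<omega> u h = \<tau> u * th1 \<omega> u h + b12 u * th2 \<omega> u h \<and>
      be2 \<omega> u h = b21 u * th1 \<omega> u h + \<epsilon> u * \<tau> u * th2 \<omega> u h"
proof (rule moving_frame_dual[OF normalized3D(4)[OF n]])
  fix X Y
  define \<sigma> where "\<sigma> = structure_forms v"
  note mf = normalized3D(4)[OF n]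
  have U: "open U" and sm: "smooth_on U (v i)" for i using mf by (auto simp: moving_frame_def)
  assume "\<And>u. u \<in> U \<Longrightarrow> th1 (structure_forms v) u (X u) = 1"
      "\<And>u. u \<in> U \<Longrightarrow> th2 (structure_forms v) u (X u) = 0"
      "\<And>u. u \<in> U \<Longrightarrow> th1 (structure_forms v) u (Y u) = 0"
      "\<And>u. u \<in> U \<Longrightarrow> th2 (structure_forms v) u (Y u) = 1"
    and XY: "\<And>u x. u \<in> U \<Longrightarrow> x = th1 (structure_forms v) u x *\<^sub>R X u + th2 (structure_forms v) u x *\<^sub>R Y u"
  then have X: "th1 \<sigma> u (X u) = 1" "th2 \<sigma> u (X u) = 0" "th1 \<sigma> u (Y u) = 0" "th2 \<sigma> u (Y u) = 1" if "u \<in> U" for u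
    using that by (auto simp: \<sigma>_def)
  have "be1 \<omega> u h = be1 \<sigma> u (X u) * th1 \<omega> u h + be1 \<sigma> u (Y u) * th2 \<omega> u h \<and>
      be2 \<omega> u h = be2 \<sigma> u (X u) * th1 \<omega> u h + \<epsilon> u * be1 \<sigma> u (X u) * th2 \<omega> u h" if u: "u \<in> U" for u h
  proof -
    have lin: "linear (be1 \<sigma> u)" "linear (be2 \<sigma> u)"
      unfolding \<sigma>_def structure_forms_def using u
      by (auto intro!: linear_compose_neg linear_compose[OF linear_D[OF sm] linear_qform_left, unfolded o_def])
    have lam: "al12 \<sigma> u h = th1 \<sigma> u h" "al21 \<sigma> u h = \<epsilon> u * th2 \<sigma> u h" for h
      using normalized3D(5)[OF n] normalized3D(8-10)[OF n u] u by (auto simp: has_lambda_def \<sigma>_def)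
    have "qform (D (v 3) w h) (v 4 w) = 0" if "w \<in> U" for w h
      using normalized3D(12)[OF n that, of h] by (simp add: structure_forms_def)
    then have "qform (D (\<lambda>w. D (v 3) w h) u k) (v 4 u) = - qform (D (v 3) u h) (D (v 4) u k)" for h k
      using D_qform_const[where f = "\<lambda>w. D (v 3) w h" and g = "v 4" and c = 0, OF U u smooth_on_D[OF sm] sm]
      by blast
    then have "qform (D (v 3) u (X u)) (D (v 4) u (Y u)) = qform (D (v 3) u (Y u)) (D (v 4) u (X u))"
      using D_sym[OF U u sm] by (metis minus_equation_iff)
    then have sym: "be2 \<sigma> u (Y u) = \<epsilon> u * be1 \<sigma> u (X u)"
      unfolding moving_frame_D[OF mf u]
      using X[OF u] normalized3D(12)[OF n u]
      by (simp add: qform_bilinear moving_frame_products[OF mf u] lam flip: \<sigma>_def)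
    have "be1 \<sigma> u h = th1 \<sigma> u h * be1 \<sigma> u (X u) + th2 \<sigma> u h * be1 \<sigma> u (Y u)"
      "be2 \<sigma> u h = th1 \<sigma> u h * be2 \<sigma> u (X u) + th2 \<sigma> u h * be2 \<sigma> u (Y u)"
      using arg_cong[OF XY[OF u, of h], of "be1 \<sigma> u"] arg_cong[OF XY[OF u, of h], of "be2 \<sigma> u"] lin
      by (simp_all add: linear_add linear_scale \<sigma>_def)
    then show ?thesis
      by (simp add: sym adapted1_structure_forms[OF normalized3D(2)[OF n] u] mult.commute flip: \<sigma>_def)
  qed
  then show thesis by (rule that)
qed

text \<open>In the coframe \<open>th1\<close>, \<epsilon> \<open>th2\<close> the forms
  \<open>be2\<close>, \<open>be1\<close> have the symmetric matrix with rows (b21, t) and (t,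
  \<epsilon> b12). The coefficients \<open>l'\<close> express the coframe by \<open>be2\<close>,
  \<open>be1\<close>, so they form the inverse matrix. A symmetric 2 x 2 matrix and its inverse are
  diagonal together, and then the diagonal entries are nonzero.\<close>

lemma tau_zero_iff:
  assumes n: "normalized3 M U \<phi> v \<omega> l \<epsilon>" and u: "u \<in> U"
    and be: "\<And>h. be1 \<omega> u h = t * th1 \<omega> u h + b12 * th2 \<omega> u h \<and>
      be2 \<omega> u h = b21 * th1 \<omega> u h + \<epsilon> u * t * th2 \<omega> u h"
    and l': "has_lambda U (structure_forms (conjugate_frame v)) l'"
  shows "lam12 l' u = 0 \<longleftrightarrow> t = 0" "t = 0 \<Longrightarrow> lam11 l' u * lam22 l' u \<noteq> 0"
proof -
  note mf = normalized3D(4)[OF n]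
  define \<sigma> where "\<sigma> = structure_forms v"
  obtain X Y where X: "th1 \<sigma> u X = 1" "th2 \<sigma> u X = 0" "th1 \<sigma> u Y = 0" "th2 \<sigma> u Y = 1"
    unfolding \<sigma>_def by (rule moving_frame_dual_at[OF mf u])
  have be': "be1 \<sigma> u h = t * th1 \<sigma> u h + b12 * th2 \<sigma> u h"
      "be2 \<sigma> u h = b21 * th1 \<sigma> u h + \<epsilon> u * t * th2 \<sigma> u h" for h
    using be[of h] by (simp_all add: adapted1_structure_forms[OF normalized3D(2)[OF n] u] \<sigma>_def)
  have lam: "al12 \<sigma> u h = th1 \<sigma> u h" "al21 \<sigma> u h = \<epsilon> u * th2 \<sigma> u h" for h
    using normalized3D(5)[OF n] normalized3D(8-10)[OF n u] u by (auto simp: has_lambda_def \<sigma>_def)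
  have e: "th1 \<sigma> u h = lam11 l' u * be2 \<sigma> u h + lam12 l' u * be1 \<sigma> u h"
    "\<epsilon> u * th2 \<sigma> u h = lam12 l' u * be2 \<sigma> u h + lam22 l' u * be1 \<sigma> u h" for h
    using l' u structure_forms_conjugate_frame[OF mf u, folded \<sigma>_def] lam by (auto simp: has_lambda_def)
  have eqs: "1 = lam11 l' u * b21 + lam12 l' u * t" "0 = lam12 l' u * b21 + lam22 l' u * t"
      "\<epsilon> u = lam12 l' u * (\<epsilon> u * t) + lam22 l' u * b12"
    using e(1)[of X] e(2)[of X] e(2)[of Y] by (simp_all add: be' X)
  have \<epsilon>: "\<epsilon> u \<noteq> 0" by (rule normalized3D(11)[OF n u])
  show "lam12 l' u = 0 \<longleftrightarrow> t = 0"
  proof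
    assume 0: "lam12 l' u = 0"
    then have "lam22 l' u \<noteq> 0" using eqs(3) \<epsilon> by auto
    then show "t = 0" using eqs(2) 0 by simp
  next
    assume 0: "t = 0"
    then have "b21 \<noteq> 0" using eqs(1) by auto
    then show "lam12 l' u = 0" using eqs(2) 0 by simp
  qed
  show "lam11 l' u * lam22 l' u \<noteq> 0" if 0: "t = 0"
    using eqs(1,3) 0 \<epsilon> by auto
qed

section \<open>The equivalences\<close>

text \<open>Two frames of the conjugate surface are compared: the conjugate frame of
  \<open>v\<close>, and a 3-adapted one whose last vector represents the original point. The
  comparison rests on \<open>lam12\<close> = 0 and this last vector, so a 2-generic and a
  singly-ruled conjugate surface are treated at once.\<close>

lemma double_conjugate_imp_central_spheres_agree:
  assumes M: "smooth_2_manifold M" and gen: "two_generic M" and rk: "conjugate_dim_eq M 2"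
    and dc: "double_conjugate_eq M"
  shows "central_spheres_agree M"
  unfolding central_spheres_agree_def
proof
  fix p assume p: "p \<in> topspace (manifold M)"
  obtain U \<phi> v \<omega> l \<epsilon> u where u: "u \<in> U" "\<phi> u = p" and n: "normalized3 M U \<phi> v \<omega> l \<epsilon>"
    using normalized3_exists[OF gen p] by blast
  note mf = normalized3D(4)[OF n]
  have "is_conjugate_point (conjugate_manifold M) p (imm M p)"
    using dc p by (simp add: double_conjugate_eq_def)
  then obtain U' \<phi>' v' \<omega>' l' u' where u': "u' \<in> U'" "\<phi>' u' = p"
    and ad: "adapted3 (conjugate_manifold M) U' \<phi>' v' \<omega>' l'" and im: "imm M p = proj_pt (v' 4 u')"
    unfolding is_conjugate_point_def by blast
  have a1: "adapted1 (conjugate_manifold M) U' \<phi>' v' \<omega>'" and l': "has_lambda U' \<omega>' l'" "lam12 l' u' = 0"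
    using ad u' unfolding adapted3_def by blast+
  have M': "smooth_2_manifold (conjugate_manifold M)" using M by simp
  note ac = adapted1_conjugate_frame[OF M rk n]
  have 1: "central_tangent_sphere M p = quadric_sphere (v 3 u)"
    using central_tangent_sphere_eq[OF M normalized3D(2,6)[OF n] u(1)] normalized3D(9)[OF n u(1)] u by simp
  have 2: "central_tangent_sphere (conjugate_manifold M) p = quadric_sphere (v' 3 u')"
    using central_tangent_sphere_eq[OF M' a1 l'(1) u'(1)] l' u' by simp
  have uu: "\<phi> u = \<phi>' u'" using u u' by simp
  have "quadric_sphere (v 3 u) = quadric_sphere (v' 3 u')"
  proof (rule adapted1_common_chart[OF M' ac a1 l'(1) u(1) u'(1) uu])
    fix W \<eta>
    assume W: "u \<in> W" "\<eta> u = u'" and mW: "moving_frame W (conjugate_frame v)" "moving_frame W (\<lambda>i w. v' i (\<eta> w))"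
      and pt: "\<And>w. w \<in> W \<Longrightarrow> proj_pt (v' 0 (\<eta> w)) = proj_pt (conjugate_frame v 0 w)"
    have "\<exists>s f. s * s = 1 \<and> v' 3 u' = s *\<^sub>R v 3 u + f *\<^sub>R v 4 u"
    proof (rule moving_frame_compare[OF mW pt])
      fix a s f :: "real^2 \<Rightarrow> real"
      assume "\<And>w. w \<in> W \<Longrightarrow> s w * s w = 1"
        "\<And>w. w \<in> W \<Longrightarrow> v' 3 (\<eta> w) = s w *\<^sub>R conjugate_frame v 3 w + f w *\<^sub>R conjugate_frame v 0 w"
      from this[OF W(1)] show ?thesis using W(2) by auto
    qed
    then obtain s f where s: "s * s = 1" and v3: "v' 3 u' = s *\<^sub>R v 3 u + f *\<^sub>R v 4 u" by blast
    have "proj_pt (v 0 u) = proj_pt (v' 4 u')" using normalized3D(7)[OF n u(1)] u im by simp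
    then obtain c where c: "v 0 u = c *\<^sub>R v' 4 u'" using proj_pt_eqD by blast
    have "qform (v' 3 u') (v' 4 u') = 0" using moving_frame_products(20)[OF mW(2) W(1)] W(2) by simp
    \<comment> \<open>As \<open>v 0\<close> is a multiple of \<open>v' 4\<close>, it is orthogonal
      to \<open>v' 3\<close>; the product -1 of \<open>v 4\<close> and \<open>v 0\<close> then
      leaves \<open>f\<close> = 0.\<close>
    then have "qform (s *\<^sub>R v 3 u + f *\<^sub>R v 4 u) (v 0 u) = 0" unfolding v3[symmetric] c by (simp add: qform_bilinear)
    then have "f = 0" by (simp add: qform_bilinear moving_frame_products[OF mf u(1)])
    moreover have "s \<noteq> 0" using s by auto
    ultimately show ?thesis using v3 by (simp add: quadric_sphere_scaleR)
  qed
  then show "central_tangent_sphere M p = central_tangent_sphere (conjugate_manifold M) p" using 1 2 by simp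
qed

text \<open>At each point both conditions amount to \<open>lam12 l' u = 0\<close> for the conjugate
  frame of a normalized frame.\<close>

lemma tau_vanishes_iff_central_spheres_agree:
  assumes M: "smooth_2_manifold M" and gen: "two_generic M" and rk: "conjugate_dim_eq M 2"
  shows "tau_vanishes M \<longleftrightarrow> central_spheres_agree M"
proof
  assume t: "tau_vanishes M"
  show "central_spheres_agree M"
    unfolding central_spheres_agree_def
  proof
    fix p assume "p \<in> topspace (manifold M)"
    then obtain U \<phi> v \<omega> l \<epsilon> \<tau> b12 b21 u where u: "u \<in> U" "\<phi> u = p" and n: "normalized3 M U \<phi> v \<omega> l \<epsilon>"
      and be: "\<forall>u\<in>U. \<forall>h. be1 \<omega> u h = \<tau> u * th1 \<omega> u h + b12 u * th2 \<omega> u h \<and>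
                 be2 \<omega> u h = b21 u * th1 \<omega> u h + \<epsilon> u * \<tau> u * th2 \<omega> u h" and 0: "\<tau> u = 0"
      using t unfolding tau_vanishes_def by metis
    obtain l' where l': "has_lambda U (structure_forms (conjugate_frame v)) l'"
      using moving_frame_has_lambda[OF moving_frame_conjugate_frame[OF M rk n]] by blast
    have "lam12 l' u = 0" using tau_zero_iff(1)[OF n u(1) _ l', of "\<tau> u" "b12 u" "b21 u"] be u 0 by blast
    then show "central_tangent_sphere M p = central_tangent_sphere (conjugate_manifold M) p"
      using central_spheres_agree_at[OF M rk n u(1) l'] u by simp
  qed
next
  assume c: "central_spheres_agree M"
  show "tau_vanishes M"
    unfolding tau_vanishes_def
  proof
    fix p assume p: "p \<in> topspace (manifold M)"
    obtain U \<phi> v \<omega> l \<epsilon> u where u: "u \<in> U" "\<phi> u = p" and n: "normalized3 M U \<phi> v \<omega> l \<epsilon>"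
      using normalized3_exists[OF gen p] by blast
    obtain l' where l': "has_lambda U (structure_forms (conjugate_frame v)) l'"
      using moving_frame_has_lambda[OF moving_frame_conjugate_frame[OF M rk n]] by blast
    have 0: "lam12 l' u = 0"
      using central_spheres_agree_at[OF M rk n u(1) l'] c p u by (simp add: central_spheres_agree_def)
    show "\<exists>U \<phi> v \<omega> l \<epsilon> \<tau> b12 b21. \<exists>u\<in>U. normalized3 M U \<phi> v \<omega> l \<epsilon> \<and> \<phi> u = p \<and>
       (\<forall>u\<in>U. \<forall>h. be1 \<omega> u h = \<tau> u * th1 \<omega> u h + b12 u * th2 \<omega> u h \<and>
                 be2 \<omega> u h = b21 u * th1 \<omega> u h + \<epsilon> u * \<tau> u * th2 \<omega> u h) \<and> \<tau> u = 0"
    proof (rule normalized3_tau[OF n])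
      fix \<tau> b12 b21
      assume be: "\<And>u h. u \<in> U \<Longrightarrow> be1 \<omega> u h = \<tau> u * th1 \<omega> u h + b12 u * th2 \<omega> u h \<and>
        be2 \<omega> u h = b21 u * th1 \<omega> u h + \<epsilon> u * \<tau> u * th2 \<omega> u h"
      have "\<tau> u = 0" using tau_zero_iff(1)[OF n u(1) be[OF u(1)] l'] 0 by blast
      then show ?thesis using u n be 
        by (intro exI[of _ U] exI[of _ \<phi>] exI[of _ v] exI[of _ \<omega>] exI[of _ l] exI[of _ \<epsilon>]
            exI[of _ \<tau>] exI[of _ b12] exI[of _ b21] bexI[of _ u] conjI ballI allI) simp_all
    qed
  qed
qed

text \<open>Agreement of the spheres makes the conjugate frame 2-adapted, its \<open>be3\<close> is
  zero anyway, and \<tau> = 0 makes its other two coefficients nonzero. So it is 3-adapted on a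
  2-generic surface, and its last vector is \<open>v 0\<close>.\<close>

lemma central_spheres_agree_imp_double_conjugate:
  assumes M: "smooth_2_manifold M" and gen: "two_generic M" and rk: "conjugate_dim_eq M 2"
    and c: "central_spheres_agree M"
  shows "double_conjugate_eq M"
proof -
  \<comment> \<open>Phrased with \<open>adapted1\<close>, since \<open>adapted3\<close> presupposes
    the type of the conjugate surface; that it is 2-generic is itself drawn from this fact.\<close>
  have *: "\<exists>U v l. \<exists>u\<in>U. \<exists>\<phi>. adapted1 (conjugate_manifold M) U \<phi> v (structure_forms v) \<and>
      has_lambda U (structure_forms v) l \<and> \<phi> u = p \<and> lam11 l u * lam22 l u \<noteq> 0 \<and>
      (\<forall>u\<in>U. lam12 l u = 0 \<and> (\<forall>h. be3 (structure_forms v) u h = 0)) \<and> imm M p = proj_pt (v 4 u)"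
    if p: "p \<in> topspace (manifold M)" for p
  proof -
    obtain U \<phi> v \<omega> l \<epsilon> u where u: "u \<in> U" "\<phi> u = p" and n: "normalized3 M U \<phi> v \<omega> l \<epsilon>"
      using normalized3_exists[OF gen p] by blast
    obtain l' where l': "has_lambda U (structure_forms (conjugate_frame v)) l'"
      using moving_frame_has_lambda[OF moving_frame_conjugate_frame[OF M rk n]] by blast
    \<comment> \<open>Being 2-adapted is a condition on the whole patch, so the spheres are compared
      at every point of it.\<close>
    have 0: "lam12 l' w = 0" if w: "w \<in> U" for w
      using central_spheres_agree_at[OF M rk n w l'] c patch_image_topspace[OF M normalized3D(3)[OF n] w]
      by (simp add: central_spheres_agree_def)
    have g: "lam11 l' u * lam22 l' u \<noteq> 0"
    proof (rule normalized3_tau[OF n])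
      fix \<tau> b12 b21
      assume be: "\<And>u h. u \<in> U \<Longrightarrow> be1 \<omega> u h = \<tau> u * th1 \<omega> u h + b12 u * th2 \<omega> u h \<and>
        be2 \<omega> u h = b21 u * th1 \<omega> u h + \<epsilon> u * \<tau> u * th2 \<omega> u h"
      note tz = tau_zero_iff[OF n u(1) be[OF u(1)] l']
      show ?thesis using tz 0[OF u(1)] by blast
    qed
    have "be3 (structure_forms (conjugate_frame v)) w h = 0" if "w \<in> U" for w h
      by (rule structure_forms_conjugate_frame(5)[OF normalized3D(4)[OF n] that])
    then show ?thesis
      using u l' 0 g adapted1_conjugate_frame[OF M rk n] normalized3D(7)[OF n u(1)]
      by (intro exI[of _ U] exI[of _ "conjugate_frame v"] exI[of _ l'] bexI[of _ u] exI[of _ \<phi>]) auto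
  qed
  have g: "two_generic (conjugate_manifold M)"
    unfolding two_generic_def
  proof (intro conjI ballI hyperbolic_conjugate_manifold M gen rk)
    fix p assume "p \<in> topspace (manifold (conjugate_manifold M))"
    then show "\<exists>U \<phi> v \<omega> l. \<exists>u\<in>U. adapted1 (conjugate_manifold M) U \<phi> v \<omega> \<and> has_lambda U \<omega> l \<and> \<phi> u = p \<and>
        lam11 l u * lam22 l u \<noteq> 0"
      using *[of p] by (metis conjugate_manifold_simps(1))
  qed
  have "is_conjugate_point (conjugate_manifold M) p (imm M p)" if "p \<in> topspace (manifold M)" for p
    using *[OF that] g unfolding is_conjugate_point_def adapted3_def by metis
  then show ?thesis using g by (simp add: double_conjugate_eq_def)
qed

theorem theorem6p9:
  fixes M :: "'m surface"
  assumes "hyperbolic_surface M"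
    and "two_generic M"
    and "conjugate_dim_eq M 2"
  shows "hyperbolic_surface (conjugate_manifold M) \<and>
    (double_conjugate_eq M \<longleftrightarrow> tau_vanishes M) \<and>
    (tau_vanishes M \<longleftrightarrow> central_spheres_agree M)"
proof -
  have M: "smooth_2_manifold M"
    using assms(1) by (simp add: hyperbolic_surface_def surface_in_quadric_def)
  note a = M assms(2,3)
  show ?thesis
    using hyperbolic_conjugate_manifold[OF a] tau_vanishes_iff_central_spheres_agree[OF a]
      double_conjugate_imp_central_spheres_agree[OF a] central_spheres_agree_imp_double_conjugate[OF a]
    by blast
qed

end
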